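(* Let $\omega$ be a smooth closed 1-form on a smooth closed manifold $M$. Assume that the set of zeros $Y=\{p\in M;\ \omega_p=0\}$ admits a neighbourhood $U$, $Y\subset U\subset M$, such that $\omega|_U$ is exact, and that $Y$ has finitely many connected components $Y_1,\dots,Y_k$ which satisfy $$\sum_{i=1}^k \mathrm{cat}_M(Y_i) < \mathrm{cat}(M,[\omega]),$$ where $[\omega]\in H^1(M;\mathbb{R})$ denotes the cohomology class of $\omega$. Then there exists an integer $N>0$ such that for any gradient-like vector field $v$ for $\omega$ there exist a finite chain of orbits (integral trajectories of $v$) $$\gamma_1,\dots,\gamma_\ell,\ \gamma_{\ell+1}=\gamma_1$$ lying in $M-Y$, with $1\le \ell\le k$, and labels $1\le i(j)\le k$ such that $$\bigcap_{t\in\mathbb{R}} \overline{\gamma_j([t,+\infty))}\subset Y_{i(j)}\quad\text{and}\quad \bigcap_{t\in\mathbb{R}}\overline{\gamma_{j+1}((-\infty,t])}\subset Y_{i(j)}$$ for all $1\le j\le \ell$, and additionally $$\sum_{i=1}^{\ell}\ \int_{\gamma_i}\omega\ \le\ N .$$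
   Context: **Gradient-like vector field.** Let $\omega$ be a smooth closed 1-form on a closed smooth manifold $M$ and $Y=\{p\in M;\ \omega_p=0\}$. A smooth vector field $v$ on $M$ is a gradient-like vector field for $\omega$ if $\omega$ is a Lyapunov 1-form for the pair $(\Phi,Y)$, where $\Phi$ is the flow on $M$ generated by $-v$. Explicitly: $Y$ is invariant under the flow; $\omega(v)>0$ on $M-Y$; and $\omega|_Y=0$ and there is a smooth function $f:W\to\mathbb{R}$ on an open neighbourhood $W$ of $Y$ with $\omega|_W=df$. An orbit (integral trajectory) of $v$ is a curve $\gamma:\mathbb{R}\to M$ with $\dot\gamma(t)=v(\gamma(t))$, and $\int_\gamma\omega=\int_{-\infty}^{\infty}\omega(\dot\gamma(t))\,dt$. **Relative category.** For $A\subset X$, $\mathrm{cat}_X(A)$ is the minimal integer $k$ such that $A$ can be covered by $k$ open subsets of $X$, each of which is null-homotopic in $X$ (the inclusion into $X$ is homotopic to a constant map). **Closed 1-forms on topological spaces.** A continuous closed 1-form $\omega$ on a topological space $X$ is a collection $\{f_U\}_{U\in\mathcal U}$ of continuous functions $f_U:U\to\mathbb{R}$, where $\mathcal U$ is an open cover of $X$, such that $f_U-f_V$ is locally constant on $U\cap V$ for all $U,V\in\mathcal U$; two such collections are equivalent if their union is again such a collection. For a path $\gamma:[0,1]\to X$, $\int_\gamma\omega=\sum_{i=0}^{n-1}[f_{U_i}(\gamma(t_{i+1}))-f_{U_i}(\gamma(t_i))]$ for any subdivision $0=t_0<\dots<t_n=1$ with $\gamma([t_i,t_{i+1}])\subset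 U_i\in\mathcal U$. The class $[\omega]\in H^1(X;\mathbb{R})$ is given by integration over loops. A smooth closed 1-form on a manifold is a special case. **$N$-movability.** Let $\omega$ be a closed 1-form on $X$ and $N$ an integer. A subset $A\subset X$ is $N$-movable with respect to $\omega$ if there is a homotopy $H:A\times[0,1]\to X$ with $H(a,0)=a$ and $\int_a^{H_1(a)}\omega\le -N$ for all $a\in A$, the integral being taken along the path $t\mapsto H(a,t)$. **$\mathrm{cat}(X,\xi)$.** Let $X$ be a finite CW-complex (e.g. a closed smooth manifold) and $\xi\in H^1(X;\mathbb{R})$. Fix a closed 1-form $\omega$ representing $\xi$. Then $\mathrm{cat}(X,\xi)$ is the minimal integer $k$ such that for every $N>0$ there exists a closed subset $A\subset X$ which is $N$-movable with respect to $\omega$ and such that $\mathrm{cat}_X(X-A)\le k$. (This is independent of the choice of $\omega$ in the class $\xi$.) *)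

theory Defs
  imports "HOL-Analysis.Analysis" "HOL-Library.Extended_Nat"
begin

section \<open>Smooth manifolds\<close>

text \<open>
  \<open>Ck_on n S f\<close> says that \<open>f\<close> is of class \<open>C\<^sup>n\<close> on \<open>S\<close>. The derivatives are unrestricted
  ones, so this is only meant for open \<open>S\<close>.
\<close>

primrec Ck_on ::
  "nat \<Rightarrow> 'e::real_normed_vector set \<Rightarrow> ('e \<Rightarrow> 'f::real_normed_vector) \<Rightarrow> bool"
where
  "Ck_on 0 S f \<longleftrightarrow> continuous_on S f"
| "Ck_on (Suc n) S f \<longleftrightarrow>
     (\<forall>x\<in>S. f differentiable (at x)) \<and>
     (\<forall>h. Ck_on n S (\<lambda>x. frechet_derivative f (at x) h))"

definition smooth_on ::
  "'e::real_normed_vector set \<Rightarrow> ('e \<Rightarrow> 'f::real_normed_vector) \<Rightarrow> bool"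
where
  "smooth_on S f \<longleftrightarrow> (\<forall>n. Ck_on n S f)"

text \<open>
  A chart is a pair of its domain and its coordinate map; the values of the coordinate map
  outside the domain are irrelevant. The manifold is the whole type \<open>'a\<close>, and its smooth
  structure is given by an atlas (not necessarily a maximal one) with values in \<open>'e\<close>.
\<close>

type_synonym ('a, 'e) chart = "'a set \<times> ('a \<Rightarrow> 'e)"

abbreviation chart_dom :: "('a, 'e) chart \<Rightarrow> 'a set" where
  "chart_dom c \<equiv> fst c"

abbreviation coord :: "('a, 'e) chart \<Rightarrow> 'a \<Rightarrow> 'e" where
  "coord c \<equiv> snd c"

definition inv_coord :: "('a, 'e) chart \<Rightarrow> 'e \<Rightarrow> 'a" where
  "inv_coord c = inv_into (chart_dom c) (coord c)"

definition is_chart :: "('a::topological_space, 'e::euclidean_space) chart \<Rightarrow> bool" where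
  "is_chart c \<longleftrightarrow> open (chart_dom c) \<and> open (coord c ` chart_dom c) \<and>
     homeomorphism (chart_dom c) (coord c ` chart_dom c) (coord c) (inv_coord c)"

definition transition :: "('a, 'e) chart \<Rightarrow> ('a, 'e) chart \<Rightarrow> 'e \<Rightarrow> 'e" where
  "transition c d = coord d \<circ> inv_coord c"

definition smooth_atlas :: "('a::topological_space, 'e::euclidean_space) chart set \<Rightarrow> bool" where
  "smooth_atlas A \<longleftrightarrow>
     (\<forall>c\<in>A. is_chart c) \<and> (\<Union>c\<in>A. chart_dom c) = UNIV \<and>
     (\<forall>c\<in>A. \<forall>d\<in>A. smooth_on (coord c ` (chart_dom c \<inter> chart_dom d)) (transition c d))"

definition closed_smooth_manifold ::
  "('a::{t2_space, second_countable_topology}, 'e::euclidean_space) chart set \<Rightarrow> bool"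
where
  "closed_smooth_manifold A \<longleftrightarrow> smooth_atlas A \<and> compact (UNIV :: 'a set)"

definition smooth_fun_on ::
  "('a::topological_space, 'e::euclidean_space) chart set \<Rightarrow> 'a set \<Rightarrow> ('a \<Rightarrow> real) \<Rightarrow> bool"
where
  "smooth_fun_on A U f \<longleftrightarrow>
     (\<forall>c\<in>A. smooth_on (coord c ` (U \<inter> chart_dom c)) (f \<circ> inv_coord c))"


section \<open>Tangent vectors, vector fields and differential forms\<close>

definition charts_at :: "('a, 'e) chart set \<Rightarrow> 'a \<Rightarrow> ('a, 'e) chart set" where
  "charts_at A p = {c \<in> A. p \<in> chart_dom c}"

text \<open>
  A tangent vector at \<open>p\<close> is a family of coordinate vectors, one for each chart around \<open>p\<close>,
  transforming under the differentials of the coordinate changes; a tangent covector is a family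
  of linear forms transforming accordingly. Values at charts not around \<open>p\<close> are irrelevant.
\<close>

type_synonym ('a, 'e) tvec = "('a, 'e) chart \<Rightarrow> 'e"
type_synonym ('a, 'e) tcovec = "('a, 'e) chart \<Rightarrow> 'e \<Rightarrow> real"

definition d_transition ::
  "('a, 'e::euclidean_space) chart \<Rightarrow> ('a, 'e) chart \<Rightarrow> 'a \<Rightarrow> 'e \<Rightarrow> 'e"
where
  "d_transition c d p = frechet_derivative (transition c d) (at (coord c p))"

definition tangent_space ::
  "('a, 'e::euclidean_space) chart set \<Rightarrow> 'a \<Rightarrow> ('a, 'e) tvec set"
where
  "tangent_space A p =
     {X. \<forall>c\<in>charts_at A p. \<forall>d\<in>charts_at A p. X d = d_transition c d p (X c)}"

definition cotangent_space ::
  "('a, 'e::euclidean_space) chart set \<Rightarrow> 'a \<Rightarrow> ('a, 'e) tcovec set"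
where
  "cotangent_space A p =
     {\<theta>. (\<forall>c\<in>charts_at A p. linear (\<theta> c)) \<and>
         (\<forall>c\<in>charts_at A p. \<forall>d\<in>charts_at A p. \<forall>h. \<theta> c h = \<theta> d (d_transition c d p h))}"

text \<open>For \<open>\<theta>\<close> a covector and \<open>X\<close> a vector at \<open>p\<close>, the choice of the chart does not matter.\<close>

definition pairing ::
  "('a, 'e::euclidean_space) chart set \<Rightarrow> 'a \<Rightarrow> ('a, 'e) tcovec \<Rightarrow> ('a, 'e) tvec \<Rightarrow> real"
where
  "pairing A p \<theta> X = (let c = (SOME c. c \<in> charts_at A p) in \<theta> c (X c))"

definition smooth_vector_field ::
  "('a::topological_space, 'e::euclidean_space) chart set \<Rightarrow> ('a \<Rightarrow> ('a, 'e) tvec) \<Rightarrow> bool"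
where
  "smooth_vector_field A v \<longleftrightarrow>
     (\<forall>p. v p \<in> tangent_space A p) \<and>
     (\<forall>c\<in>A. smooth_on (coord c ` chart_dom c) (\<lambda>x. v (inv_coord c x) c))"

definition smooth_one_form ::
  "('a::topological_space, 'e::euclidean_space) chart set \<Rightarrow> ('a \<Rightarrow> ('a, 'e) tcovec) \<Rightarrow> bool"
where
  "smooth_one_form A \<omega> \<longleftrightarrow>
     (\<forall>p. \<omega> p \<in> cotangent_space A p) \<and>
     (\<forall>c\<in>A. \<forall>h. smooth_on (coord c ` chart_dom c) (\<lambda>x. \<omega> (inv_coord c x) c h))"

text \<open>
  The second condition is \<open>d\<omega> = 0\<close>: in coordinates,
  \<open>(d\<omega>)\<^sub>x (h, k) = D\<^sub>h (\<omega> k) (x) - D\<^sub>k (\<omega> h) (x)\<close> for constant vector fields \<open>h\<close> and \<open>k\<close>.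
\<close>

definition smooth_closed_one_form ::
  "('a::topological_space, 'e::euclidean_space) chart set \<Rightarrow> ('a \<Rightarrow> ('a, 'e) tcovec) \<Rightarrow> bool"
where
  "smooth_closed_one_form A \<omega> \<longleftrightarrow> smooth_one_form A \<omega> \<and>
     (\<forall>c\<in>A. \<forall>x\<in>coord c ` chart_dom c. \<forall>h k.
        frechet_derivative (\<lambda>y. \<omega> (inv_coord c y) c k) (at x) h =
        frechet_derivative (\<lambda>y. \<omega> (inv_coord c y) c h) (at x) k)"

definition vanishes_at ::
  "('a, 'e::euclidean_space) chart set \<Rightarrow> ('a \<Rightarrow> ('a, 'e) tcovec) \<Rightarrow> 'a \<Rightarrow> bool"
where
  "vanishes_at A \<omega> p \<longleftrightarrow> (\<forall>c\<in>charts_at A p. \<forall>h. \<omega> p c h = 0)"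

definition zeros ::
  "('a, 'e::euclidean_space) chart set \<Rightarrow> ('a \<Rightarrow> ('a, 'e) tcovec) \<Rightarrow> 'a set"
where
  "zeros A \<omega> = {p. vanishes_at A \<omega> p}"

definition differential :: "('a \<Rightarrow> real) \<Rightarrow> 'a \<Rightarrow> ('a, 'e::euclidean_space) tcovec" where
  "differential f p c = frechet_derivative (f \<circ> inv_coord c) (at (coord c p))"

definition primitive_on ::
  "('a::topological_space, 'e::euclidean_space) chart set \<Rightarrow> ('a \<Rightarrow> ('a, 'e) tcovec) \<Rightarrow>
     'a set \<Rightarrow> ('a \<Rightarrow> real) \<Rightarrow> bool"
where
  "primitive_on A \<omega> U f \<longleftrightarrow> smooth_fun_on A U f \<and>
     (\<forall>p\<in>U. \<forall>c\<in>charts_at A p. \<omega> p c = differential f p c)"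


section \<open>Integral curves and gradient-like vector fields\<close>

definition integral_curve ::
  "('a::topological_space, 'e::euclidean_space) chart set \<Rightarrow> ('a \<Rightarrow> ('a, 'e) tvec) \<Rightarrow>
     (real \<Rightarrow> 'a) \<Rightarrow> bool"
where
  "integral_curve A v \<gamma> \<longleftrightarrow> continuous_on UNIV \<gamma> \<and>
     (\<forall>t. \<forall>c\<in>charts_at A (\<gamma> t). ((coord c \<circ> \<gamma>) has_vector_derivative v (\<gamma> t) c) (at t))"

definition velocity :: "(real \<Rightarrow> 'a) \<Rightarrow> real \<Rightarrow> ('a, 'e::euclidean_space) tvec" where
  "velocity \<gamma> t c = vector_derivative (coord c \<circ> \<gamma>) (at t)"

definition flow ::
  "('a::topological_space, 'e::euclidean_space) chart set \<Rightarrow> ('a \<Rightarrow> ('a, 'e) tvec) \<Rightarrow>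
     real \<Rightarrow> 'a \<Rightarrow> 'a"
where
  "flow A v t p = (THE \<gamma>. integral_curve A v \<gamma> \<and> \<gamma> 0 = p) t"

definition lyapunov_one_form ::
  "('a::topological_space, 'e::euclidean_space) chart set \<Rightarrow> ('a \<Rightarrow> ('a, 'e) tcovec) \<Rightarrow>
     ('a \<Rightarrow> ('a, 'e) tvec) \<Rightarrow> 'a set \<Rightarrow> bool"
where
  "lyapunov_one_form A \<omega> v Y \<longleftrightarrow>
     (\<forall>t. \<forall>p\<in>Y. flow A (\<lambda>q c. - v q c) t p \<in> Y) \<and>
     (\<forall>p. p \<notin> Y \<longrightarrow> pairing A p (\<omega> p) (v p) > 0) \<and>
     (\<forall>p\<in>Y. vanishes_at A \<omega> p) \<and>
     (\<exists>W f. open W \<and> Y \<subseteq> W \<and> primitive_on A \<omega> W f)"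

definition gradient_like ::
  "('a::topological_space, 'e::euclidean_space) chart set \<Rightarrow> ('a \<Rightarrow> ('a, 'e) tcovec) \<Rightarrow>
     ('a \<Rightarrow> ('a, 'e) tvec) \<Rightarrow> bool"
where
  "gradient_like A \<omega> v \<longleftrightarrow> smooth_vector_field A v \<and> lyapunov_one_form A \<omega> v (zeros A \<omega>)"

abbreviation form_along ::
  "('a::topological_space, 'e::euclidean_space) chart set \<Rightarrow> ('a \<Rightarrow> ('a, 'e) tcovec) \<Rightarrow>
     (real \<Rightarrow> 'a) \<Rightarrow> real \<Rightarrow> real"
where
  "form_along A \<omega> \<gamma> t \<equiv> pairing A (\<gamma> t) (\<omega> (\<gamma> t)) (velocity \<gamma> t)"


section \<open>Relative category\<close>

definition null_homotopic :: "'a::topological_space set \<Rightarrow> bool" where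
  "null_homotopic U \<longleftrightarrow> (\<exists>a. homotopic_with_canon (\<lambda>_. True) U UNIV id (\<lambda>_. a))"

text \<open>The infimum of the empty set is \<open>\<infinity>\<close>.\<close>

definition rel_cat :: "'a::topological_space set \<Rightarrow> enat" where
  "rel_cat S = Inf {enat (card \<U>) | \<U>.
     finite \<U> \<and> (\<forall>U\<in>\<U>. open U \<and> null_homotopic U) \<and> S \<subseteq> \<Union>\<U>}"


section \<open>Closed 1-forms on topological spaces\<close>

text \<open>
  A collection of local functions is a set of pairs of a domain and a function on it; the values
  of the function outside the domain are irrelevant.
\<close>

type_synonym 'a top_form = "('a set \<times> ('a \<Rightarrow> real)) set"

definition locally_constant_on :: "'a::topological_space set \<Rightarrow> ('a \<Rightarrow> real) \<Rightarrow> bool" where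
  "locally_constant_on S g \<longleftrightarrow>
     (\<forall>x\<in>S. \<exists>V. openin (top_of_set S) V \<and> x \<in> V \<and> g constant_on V)"

definition closed_top_form :: "'a::topological_space top_form \<Rightarrow> bool" where
  "closed_top_form F \<longleftrightarrow>
     (\<forall>(U, f)\<in>F. open U \<and> continuous_on U f) \<and> (\<Union>(U, f)\<in>F. U) = UNIV \<and>
     (\<forall>(U, f)\<in>F. \<forall>(V, g)\<in>F. locally_constant_on (U \<inter> V) (\<lambda>x. f x - g x))"

definition has_path_integral ::
  "'a::topological_space top_form \<Rightarrow> (real \<Rightarrow> 'a) \<Rightarrow> real \<Rightarrow> bool"
where
  "has_path_integral F \<gamma> r \<longleftrightarrow>
     (\<exists>n t U f. t 0 = 0 \<and> t n = 1 \<and>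
        (\<forall>i<n. t i < t (Suc i) \<and> (U i, f i) \<in> F \<and> \<gamma> ` {t i..t (Suc i)} \<subseteq> U i) \<and>
        r = (\<Sum>i<n. f i (\<gamma> (t (Suc i))) - f i (\<gamma> (t i))))"

definition path_integral :: "'a::topological_space top_form \<Rightarrow> (real \<Rightarrow> 'a) \<Rightarrow> real" where
  "path_integral F \<gamma> = (THE r. has_path_integral F \<gamma> r)"

text \<open>A class in \<open>H\<^sup>1(X; \<real>)\<close> is represented by its values on loops.\<close>

type_synonym 'a cohom = "(real \<Rightarrow> 'a) \<Rightarrow> real"

definition cohom_class :: "'a::topological_space top_form \<Rightarrow> 'a cohom" where
  "cohom_class F \<gamma> =
     (if path \<gamma> \<and> pathfinish \<gamma> = pathstart \<gamma> then path_integral F \<gamma> else 0)"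

definition represents :: "'a::topological_space top_form \<Rightarrow> 'a cohom \<Rightarrow> bool" where
  "represents F \<xi> \<longleftrightarrow> closed_top_form F \<and> cohom_class F = \<xi>"

text \<open>
  A smooth closed 1-form viewed as a continuous one, through all its smooth local primitives
  (whose domains cover the manifold by the Poincare lemma).
\<close>

definition top_form_of ::
  "('a::topological_space, 'e::euclidean_space) chart set \<Rightarrow> ('a \<Rightarrow> ('a, 'e) tcovec) \<Rightarrow>
     'a top_form"
where
  "top_form_of A \<omega> = {(U, f). open U \<and> primitive_on A \<omega> U f}"


section \<open>The category of a space with respect to a cohomology class\<close>

definition movable :: "'a::topological_space top_form \<Rightarrow> int \<Rightarrow> 'a set \<Rightarrow> bool" where
  "movable F N S \<longleftrightarrow>
     (\<exists>H :: 'a \<times> real \<Rightarrow> 'a. continuous_on (S \<times> {0..1}) H \<and>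
        (\<forall>a\<in>S. H (a, 0) = a \<and> path_integral F (\<lambda>t. H (a, t)) \<le> - real_of_int N))"

text \<open>
  On the spaces considered here (finite CW complexes), the result does not depend on the chosen
  representative of \<open>\<xi>\<close>.
\<close>

definition cat_class :: "'a::topological_space cohom \<Rightarrow> enat" where
  "cat_class \<xi> = (let F = (SOME F. represents F \<xi>) in
     Inf {enat k | k. \<forall>N>0. \<exists>S. closed S \<and> movable F N S \<and> rel_cat (- S) \<le> enat k})"

end

theory Submission
  imports Defs
begin

text \<open>
  Let \<open>g = \<omega>(v) \<ge> 0\<close> and let \<open>\<psi>\<close> be the flow of \<open>-v\<close>, along which \<open>\<omega>\<close> decreases at rate \<open>g\<close>.
  Since \<open>\<Sum>cat(Y\<^sub>i) < cat(M, \<xi>)\<close>, there is \<open>N\<close> such that for no \<open>T\<close> the set of points losing less than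
  \<open>N\<close> in time \<open>T\<close> has category at most \<open>\<Sum>cat(Y\<^sub>i)\<close>. It depends on \<open>\<omega>\<close> alone: passing to another
  representative of \<open>\<xi>\<close> changes path integrals by a bounded amount.

  Take disjoint neighbourhoods \<open>V\<^sub>i\<close> of the \<open>Y\<^sub>i\<close> inside optimal categorical covers. Suppose that for each
  \<open>i\<close> no orbit that starts close enough to \<open>Y\<^sub>i\<close> leaves \<open>V\<^sub>i\<close> and comes back close to \<open>Y\<^sub>i\<close> with loss at
  most \<open>N\<close>. For large \<open>T\<close> every point losing less than \<open>N\<close> comes close to some \<open>Y\<^sub>i\<close> before time \<open>T\<close>,
  and flowing for the mean time of its visits deforms the set of such points into \<open>V\<^sub>i\<close>. This bounds
  the category, a contradiction. Hence orbits do return for some \<open>i\<close>, from and to points arbitrarily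
  close to \<open>Y\<^sub>i\<close>. They converge to broken orbits, whose pieces connect components and lose at most \<open>N\<close>;
  following these among the \<open>k\<close> components gives a cycle of at most \<open>k\<close> orbits.
\<close>

section \<open>Ordinary differential equations\<close>

text \<open>The bound has to be fixed before the vector field. Negating that the category is at most
  \<open>K\<close> yields one number \<open>N0\<close> such that no closed \<open>N0\<close>-movable
  set has a complement of category at most \<open>K\<close>; each field and each time
  \<open>T\<close> merely supply one more candidate, the set of points losing at least
  \<open>N\<close> by time \<open>T\<close>. Flow times and the closeness demanded of a return may
  therefore depend on the field.

  The zero set carries no local model of the flow, and orbits need not converge to points. Closeness
  to zeros is measured by the rate \<omega>(v), and convergence to a component means staying in its
  neighbourhood while the rate tends to 0.

  A broken orbit is not assembled all at once. With the target component i kept fixed, consider the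
  components from whose vicinity orbits go to i: each of them has a limit orbit leading to one of
  them, so pigeonhole gives a cycle, possibly one that misses i. Every step uses an approximating
  sequence of its own, so only the single pieces are known to lose at most \<open>N\<close>; this is
  the source of the total k N.\<close>

lemma scaled_integral_has_vector_derivative:
  fixes f :: "real \<Rightarrow> 'b::banach"
  assumes f: "continuous_on UNIV f"
  shows "((\<lambda>t. t *\<^sub>R integral {0..1} (\<lambda>u. f (u * t))) has_vector_derivative f t) (at t)"
proof -
  \<comment> \<open>A window with 0 and \<open>t\<close> in its interior, so that the primitive
    \<open>F\<close> has an unrestricted derivative there.\<close>
  define R where "R = \<bar>t\<bar> + 1"
  define F where "F s = integral {-R..s} f" for s
  have F: "(F has_vector_derivative f s) (at s)" if "s \<in> {-R<..<R}" for s
  proof -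
    have "(F has_vector_derivative f s) (at s within {-R..R})"
      unfolding F_def using that
      by (intro integral_has_vector_derivative continuous_on_subset[OF f]) auto
    then show ?thesis
      using that at_within_interior[of s "{-R..R}"] by simp
  qed
  \<comment> \<open>Substitution turns the integral from 0 to \<open>s\<close> into one over a fixed
    interval. This form covers both signs of \<open>s\<close> and makes continuity in parameters
    immediate.\<close>
  have eq: "F s - F 0 = s *\<^sub>R integral {0..1} (\<lambda>u. f (u * s))" if s: "s \<in> {-R<..<R}" for s
  proof -
    have "((\<lambda>u. s *\<^sub>R f (u * s)) has_integral (F (1 * s) - F (0 * s))) {0..1}"
    proof (rule fundamental_theorem_of_calculus)
      fix u :: real assume u: "u \<in> {0..1}"
      have "\<bar>u * s\<bar> \<le> 1 * \<bar>s\<bar>"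
        unfolding abs_mult using u by (intro mult_right_mono) auto
      then have "u * s \<in> {-R<..<R}" using s by auto
      then have "((F \<circ> (\<lambda>u. u * s)) has_vector_derivative (s *\<^sub>R f (u * s))) (at u within {0..1})"
        by (intro vector_diff_chain_within has_vector_derivative_at_within[OF F])
          (auto intro!: derivative_eq_intros simp: has_vector_derivative_def)
      then show "((\<lambda>u. F (u * s)) has_vector_derivative (s *\<^sub>R f (u * s))) (at u within {0..1})"
        by (simp add: o_def)
    qed simp
    then have "integral {0..1} (\<lambda>u. s *\<^sub>R f (u * s)) = F s - F 0"
      by (rule integral_unique[THEN trans]) simp
    then show ?thesis by simp
  qed
  have "((\<lambda>s. F s - F 0) has_vector_derivative f t) (at t)"
    using has_vector_derivative_diff[OF F has_vector_derivative_const, of t "F 0"]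
    by (simp add: R_def abs_if)
  moreover have "t \<in> {-R<..<R}" by (auto simp: R_def)
  ultimately show ?thesis
    by (rule has_vector_derivative_transform_within_open[OF _ open_greaterThanLessThan])
      (simp add: eq)
qed

text \<open>Picard iteration by the contraction principle, for all starting points at once: the
  unknown is the displacement as a bounded continuous function of time and starting point, so joint
  continuity comes with the fixed point.\<close>

lemma Lipschitz_flow_exists:
  fixes V :: "'e::euclidean_space \<Rightarrow> 'e"
  assumes lip: "\<And>x y. norm (V x - V y) \<le> L * norm (x - y)"
    and bd: "\<And>x. norm (V x) \<le> B" and h: "0 < h" "h * L \<le> 1 / 2"
  obtains y where "continuous_on UNIV (\<lambda>(t, x). y t x)" "\<And>x. y 0 x = x"
    "\<And>t x. \<bar>t\<bar> < h \<Longrightarrow> ((\<lambda>t. y t x) has_vector_derivative V (y t x)) (at t)"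
    "\<And>t x. norm (y t x - x) \<le> h * B"
proof -
  \<comment> \<open>Time is clamped to \<open>[-h, h]\<close>: the operator acts on functions
    defined for all times and must keep the displacement bounded. Inside the open interval the clamp
    is the identity.\<close>
  define c where "c t = max (-h) (min h t)" for t
  have c: "\<bar>c t\<bar> \<le> h" for t using h by (auto simp: c_def)
  have cont_c: "continuous_on UNIV c" unfolding c_def by (intro continuous_intros)
  have L0: "L \<ge> 0"
  proof -
    obtain b :: 'e where "b \<in> Basis" by fastforce
    then have "norm (V b - V 0) \<le> L" using lip[of b 0] by simp
    then show ?thesis using norm_ge_zero order_trans by blast
  qed
  have B0: "B \<ge> 0" using bd[of 0] norm_ge_zero order_trans by blast
  have cV: "continuous_on UNIV V"
    using lip L0 by (intro lipschitz_on_continuous_on[of L] lipschitz_onI) (auto simp: dist_norm)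
  define T0 where "T0 w = (\<lambda>(t, x). c t *\<^sub>R integral {0..1} (\<lambda>s. V (x + w (s * c t, x))))"
    for w :: "real \<times> 'e \<Rightarrow> 'e"
  have icont: "continuous_on S (\<lambda>s. V (x + w (s * r, x)))" if "continuous_on UNIV w" for w :: "real \<times> 'e \<Rightarrow> 'e" and x r S
    by (rule continuous_on_compose2[OF cV _ subset_UNIV],
        rule continuous_on_add[OF continuous_on_const],
        rule continuous_on_compose2[OF that _ subset_UNIV]) (intro continuous_intros)
  have T0_cont: "continuous_on UNIV (T0 w)" if w: "continuous_on UNIV w" for w
  proof -
    have "continuous_on UNIV (\<lambda>z. integral (cbox 0 1) (\<lambda>s. V (snd z + w (s * c (fst z), snd z))))"
      by (rule integral_continuous_on_param, unfold split_beta,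
          rule continuous_on_compose2[OF cV _ subset_UNIV], rule continuous_on_add,
          intro continuous_intros, rule continuous_on_compose2[OF w _ subset_UNIV])
        (intro continuous_intros continuous_on_compose2[OF cont_c _ subset_UNIV])
    then show ?thesis
      unfolding T0_def split_beta
      by (intro continuous_on_scaleR continuous_on_compose2[OF cont_c _ subset_UNIV] continuous_intros)
        simp
  qed
  have T0_bd: "norm (T0 w z) \<le> h * B" if w: "continuous_on UNIV w" for w z
  proof -
    have "norm (integral {0..1} (\<lambda>s. V (snd z + w (s * c (fst z), snd z)))) \<le> B * (1 - 0)"
      by (rule integral_bound) (auto intro: icont w bd)
    then show ?thesis
      unfolding T0_def split_beta norm_scaleR using c[of "fst z"] h
      by (intro mult_mono) auto
  qed
  have T0_bcont: "T0 (apply_bcontfun w) \<in> bcontfun" for w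
    using T0_cont[of "apply_bcontfun w"] T0_bd[of "apply_bcontfun w"]
    by (auto simp: bcontfun_def bounded_iff)
  define T where "T w = Bcontfun (T0 (apply_bcontfun w))" for w
  have T: "apply_bcontfun (T w) = T0 (apply_bcontfun w)" for w
    unfolding T_def by (rule Bcontfun_inverse[OF T0_bcont])
  have contr: "dist (T w) (T w') \<le> (1/2) * dist w w'" for w w'
  proof (rule dist_bound)
    fix z :: "real \<times> 'e"
    obtain t x where z: "z = (t, x)" by force
    let ?f = "\<lambda>w s. V (x + apply_bcontfun w (s * c t, x))"
    have int: "?f w integrable_on {0..1}" for w
      by (intro integrable_continuous_real icont) simp
    have "norm (integral {0..1} (?f w) - integral {0..1} (?f w'))
        = norm (integral {0..1} (\<lambda>s. ?f w s - ?f w' s))"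
      by (subst integral_diff[OF int int]) simp
    also have "\<dots> \<le> (L * dist w w') * (1 - 0)"
    proof (rule integral_bound)
      fix s :: real
      have "norm (?f w s - ?f w' s) \<le> L * dist (w (s * c t, x)) (w' (s * c t, x))"
        using lip[of "x + apply_bcontfun w (s * c t, x)" "x + apply_bcontfun w' (s * c t, x)"]
        by (simp add: dist_norm)
      also have "\<dots> \<le> L * dist w w'" by (intro mult_left_mono dist_bounded L0)
      finally show "norm (?f w s - ?f w' s) \<le> L * dist w w'" .
    qed (auto intro!: continuous_intros icont)
    finally have 1: "norm (integral {0..1} (?f w) - integral {0..1} (?f w')) \<le> L * dist w w'" by simp
    have "dist (T w z) (T w' z) = \<bar>c t\<bar> * norm (integral {0..1} (?f w) - integral {0..1} (?f w'))"
      unfolding T T0_def z dist_norm by (simp flip: scaleR_diff_right)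
    also have "\<dots> \<le> h * (L * dist w w')"
      using 1 c[of t] h by (intro mult_mono) auto
    also have "\<dots> \<le> (1/2) * dist w w'"
      using h mult_right_mono[OF h(2), of "dist w w'"] by (simp add: mult.assoc)
    finally show "dist (T w z) (T w' z) \<le> (1/2) * dist w w'" .
  qed
  obtain w where w: "T w = w"
    using banach_fix_type[of "1/2" T] contr by auto
  have wT: "apply_bcontfun w = T0 (apply_bcontfun w)" using T[of w] by (simp only: w)
  have wz: "apply_bcontfun w (t, x) = c t *\<^sub>R integral {0..1} (\<lambda>s. V (x + w (s * c t, x)))" for t x
    by (subst wT) (simp only: T0_def case_prod_conv)
  define y where "y t x = x + apply_bcontfun w (t, x)" for t x
  have cw: "continuous_on UNIV (apply_bcontfun w)" by simp
  show ?thesis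
  proof
    show "continuous_on UNIV (\<lambda>(t, x). y t x)"
      unfolding y_def split_beta prod.collapse by (intro continuous_intros cw)
    show "y 0 x = x" for x unfolding y_def by (subst wz) (use h in \<open>simp add: c_def\<close>)
    show "norm (y t x - x) \<le> h * B" for t x
      using T0_bd[OF cw, of "(t, x)"] unfolding y_def wT[symmetric] by simp
    fix t :: real and x assume t: "\<bar>t\<bar> < h"
    have "((\<lambda>t. t *\<^sub>R integral {0..1} (\<lambda>u. V (y (u * t) x))) has_vector_derivative V (y t x)) (at t)"
      by (rule scaled_integral_has_vector_derivative[where f = "\<lambda>r. V (y r x)"], unfold y_def)
         (rule continuous_on_compose2[OF cV _ subset_UNIV], intro continuous_intros
           continuous_on_compose2[OF cw _ subset_UNIV])
    then have "((\<lambda>t. x + t *\<^sub>R integral {0..1} (\<lambda>u. V (y (u * t) x))) has_vector_derivative V (y t x)) (at t)"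
      using has_vector_derivative_add[OF has_vector_derivative_const, of _ _ "at t" x] by simp
    then show "((\<lambda>t. y t x) has_vector_derivative V (y t x)) (at t)"
    proof (rule has_vector_derivative_transform_within_open[where S = "{-h<..<h}"])
      show "x + s *\<^sub>R integral {0..1} (\<lambda>u. V (y (u * s) x)) = y s x" if "s \<in> {-h<..<h}" for s
      proof -
        have "c s = s" using that by (auto simp: c_def)
        then show ?thesis unfolding y_def by (simp only: wz[of s x])
      qed
    qed (use t in auto)
  qed
qed

text \<open>At a maximum \<open>m\<close> of the distance on \<open>[-h, h]\<close>, the mean value
  estimate bounds that maximum by \<open>h * L\<close> times itself, hence by half of
  itself.\<close>

lemma Lipschitz_ode_unique:
  fixes V :: "'e::real_normed_vector \<Rightarrow> 'e"
  assumes lip: "\<And>x y. x \<in> D \<Longrightarrow> y \<in> D \<Longrightarrow> norm (V x - V y) \<le> L * norm (x - y)"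
    and h: "0 < h" "h * L \<le> 1 / 2" and L: "0 \<le> L"
    and y: "\<And>t. \<bar>t\<bar> \<le> h \<Longrightarrow> (y has_vector_derivative V (y t)) (at t) \<and> y t \<in> D"
    and z: "\<And>t. \<bar>t\<bar> \<le> h \<Longrightarrow> (z has_vector_derivative V (z t)) (at t) \<and> z t \<in> D"
    and 0: "y 0 = z 0" and t: "\<bar>t\<bar> \<le> h"
  shows "y t = z t"
proof -
  define d where "d s = y s - z s" for s
  have dd: "(d has_vector_derivative V (y s) - V (z s)) (at s)" if "\<bar>s\<bar> \<le> h" for s
    unfolding d_def using y[OF that] z[OF that] by (auto intro!: derivative_intros)
  have cd: "continuous_on {-h..h} d"
    by (auto intro!: continuous_at_imp_continuous_on has_vector_derivative_continuous[OF dd])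
  obtain m where m: "m \<in> {-h..h}" "\<And>s. s \<in> {-h..h} \<Longrightarrow> norm (d s) \<le> norm (d m)"
    using continuous_attains_sup[of "{-h..h}" "\<lambda>s. norm (d s)", OF _ _ continuous_on_norm[OF cd]] h
    by auto
  have "norm (d m - d 0) \<le> (L * norm (d m)) * norm (m - 0)"
  proof (rule differentiable_bound[where S = "{-h..h}" and f' = "\<lambda>s r. r *\<^sub>R (V (y s) - V (z s))"])
    fix s assume s: "s \<in> {-h..h}"
    show "(d has_derivative (\<lambda>r. r *\<^sub>R (V (y s) - V (z s)))) (at s within {-h..h})"
      using dd[of s] s unfolding has_vector_derivative_def by (auto intro: has_derivative_at_withinI)
    have "norm (V (y s) - V (z s)) \<le> L * norm (d s)"
      unfolding d_def using y[of s] z[of s] s by (intro lip) auto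
    also have "\<dots> \<le> L * norm (d m)" using m(2)[OF s] L by (rule mult_left_mono)
    finally have *: "norm (V (y s) - V (z s)) \<le> L * norm (d m)" .
    show "onorm (\<lambda>r. r *\<^sub>R (V (y s) - V (z s))) \<le> L * norm (d m)"
      by (rule onorm_le) (use * in \<open>auto simp: mult.commute intro: mult_left_mono\<close>)
  qed (use m h in auto)
  also have "\<dots> \<le> (L * norm (d m)) * h" using m L by (intro mult_left_mono) auto
  also have "\<dots> \<le> (1/2) * norm (d m)"
    using mult_right_mono[OF h(2), of "norm (d m)"] by (simp add: mult_ac)
  finally have "norm (d m) \<le> 0" using 0 by (simp add: d_def)
  then have "norm (d t) \<le> 0" using m(2)[of t] t by (simp add: abs_le_iff)
  then show ?thesis by (simp add: d_def)
qed

section \<open>Flows of vector fields on compact manifolds\<close>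

locale atlas =
  fixes A :: "('a::t2_space, 'e::euclidean_space) chart set"
  assumes smooth_atlas: "smooth_atlas A"
begin

lemma
  assumes "c \<in> A"
  shows open_chart_dom: "open (chart_dom c)"
    and open_coord_image: "open (coord c ` chart_dom c)"
    and continuous_on_coord: "continuous_on (chart_dom c) (coord c)"
    and continuous_on_inv_coord: "continuous_on (coord c ` chart_dom c) (inv_coord c)"
    and inv_coord_coord: "\<And>q. q \<in> chart_dom c \<Longrightarrow> inv_coord c (coord c q) = q"
    and coord_inv_coord: "\<And>x. x \<in> coord c ` chart_dom c \<Longrightarrow> coord c (inv_coord c x) = x"
    and inv_coord_in: "\<And>x. x \<in> coord c ` chart_dom c \<Longrightarrow> inv_coord c x \<in> chart_dom c"
  using smooth_atlas assms unfolding smooth_atlas_def is_chart_def homeomorphism_def by auto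

lemma charts_atD: "c \<in> charts_at A p \<Longrightarrow> c \<in> A" "c \<in> charts_at A p \<Longrightarrow> p \<in> chart_dom c"
  by (auto simp: charts_at_def)

lemma charts_at_nonempty: obtains c where "c \<in> charts_at A p"
  using smooth_atlas unfolding smooth_atlas_def charts_at_def by blast

lemma open_coord_image_subset:
  assumes "c \<in> A" "open U" "U \<subseteq> chart_dom c"
  shows "open (coord c ` U)"
proof -
  have "coord c ` U = coord c ` chart_dom c \<inter> inv_coord c -` U"
    using assms inv_coord_coord[OF assms(1)] by force
  then show ?thesis
    using continuous_on_open_vimage[OF open_coord_image[OF assms(1)], of "inv_coord c"]
      continuous_on_inv_coord[OF assms(1)] assms(2) by (metis Int_commute)
qed

lemma open_coord_preimage:
  assumes "c \<in> A" "open W"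
  shows "open (chart_dom c \<inter> coord c -` W)"
  using continuous_on_open_vimage[OF open_chart_dom[OF assms(1)], of "coord c"]
    continuous_on_coord[OF assms(1)] assms(2) by (metis Int_commute)

lemma transition_has_derivative:
  assumes c: "c \<in> charts_at A p" and d: "d \<in> charts_at A p"
  shows "(transition c d has_derivative d_transition c d p) (at (coord c p))"
proof -
  have "Ck_on (Suc 0) (coord c ` (chart_dom c \<inter> chart_dom d)) (transition c d)"
    using smooth_atlas c d unfolding smooth_atlas_def charts_at_def smooth_on_def by blast
  then show ?thesis
    using c d unfolding d_transition_def charts_at_def by (auto simp flip: frechet_derivative_works)
qed

text \<open>Tangent vectors transform as velocities do, so the equation of an integral curve has to
  be verified in one chart only.\<close>

lemma velocity_change_of_chart:
  assumes c: "c \<in> charts_at A (\<gamma> t)" and d: "d \<in> charts_at A (\<gamma> t)"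
    and X: "X \<in> tangent_space A (\<gamma> t)"
    and S: "open S" "t \<in> S" "continuous_on S \<gamma>"
    and der: "((coord c \<circ> \<gamma>) has_vector_derivative X c) (at t)"
  shows "((coord d \<circ> \<gamma>) has_vector_derivative X d) (at t)"
proof -
  note tr = transition_has_derivative[OF c d]
  have "((transition c d \<circ> (coord c \<circ> \<gamma>)) has_derivative
      (d_transition c d (\<gamma> t) \<circ> (\<lambda>h. h *\<^sub>R X c))) (at t)"
    using der tr unfolding has_vector_derivative_def by (intro diff_chain_at) auto
  moreover have "d_transition c d (\<gamma> t) \<circ> (\<lambda>h. h *\<^sub>R X c) = (\<lambda>h. h *\<^sub>R X d)"
  proof -
    have "X d = d_transition c d (\<gamma> t) (X c)" using X c d unfolding tangent_space_def by blast
    then show ?thesis using linear_scale[OF has_derivative_linear[OF tr]] by (simp add: o_def)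
  qed
  ultimately have "((transition c d \<circ> (coord c \<circ> \<gamma>)) has_vector_derivative X d) (at t)"
    unfolding has_vector_derivative_def by simp
  moreover have "open (\<gamma> -` (chart_dom c) \<inter> S)"
    using continuous_on_open_vimage[OF S(1)] S(3) open_chart_dom[OF charts_atD(1)[OF c]] by blast
  ultimately show ?thesis
    by (rule has_vector_derivative_transform_within_open)
      (use c S inv_coord_coord[OF charts_atD(1)[OF c]] in \<open>auto simp: transition_def charts_at_def\<close>)
qed

end

text \<open>\<open>Ck_on\<close> gives continuity of the derivative only in each fixed direction.
  The finitely many basis directions already bound the operator norm on the compact ball, and
  convexity turns this bound into a Lipschitz constant.\<close>

lemma C1_imp_Lipschitz:
  fixes V :: "'e::euclidean_space \<Rightarrow> 'f::real_normed_vector"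
  assumes C1: "Ck_on (Suc 0) S V" and sub: "cball x r \<subseteq> S"
  obtains L where "0 \<le> L" "\<And>y z. y \<in> cball x r \<Longrightarrow> z \<in> cball x r \<Longrightarrow> norm (V y - V z) \<le> L * norm (y - z)"
proof -
  let ?D = "\<lambda>y. frechet_derivative V (at y)"
  have der: "(V has_derivative ?D y) (at y)" if "y \<in> cball x r" for y
    using C1 sub that by (auto simp flip: frechet_derivative_works)
  have "\<exists>K. \<forall>y\<in>cball x r. norm (?D y b) \<le> K" for b
  proof -
    have "continuous_on (cball x r) (\<lambda>y. ?D y b)"
      using C1 sub by (auto intro: continuous_on_subset)
    then have "bounded ((\<lambda>y. ?D y b) ` cball x r)"
      by (intro compact_imp_bounded compact_continuous_image) auto
    then show ?thesis by (auto simp: bounded_iff)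
  qed
  then obtain K where K: "\<And>b y. y \<in> cball x r \<Longrightarrow> norm (?D y b) \<le> K b" by metis
  \<comment> \<open>The absolute value keeps the constant nonnegative even if the ball is
    empty.\<close>
  define L where "L = \<bar>\<Sum>b\<in>Basis. K b\<bar>"
  have "norm (V y - V z) \<le> L * norm (y - z)" if yz: "y \<in> cball x r" "z \<in> cball x r" for y z
  proof (rule differentiable_bound[OF convex_cball _ _ yz])
    fix w assume w: "w \<in> cball x r"
    show "(V has_derivative ?D w) (at w within cball x r)"
      by (rule has_derivative_at_withinI[OF der[OF w]])
    show "onorm (?D w) \<le> L"
    proof (rule onorm_le)
      fix h
      have lin: "linear (?D w)" by (rule has_derivative_linear[OF der[OF w]])
      have "?D w h = ?D w (\<Sum>b\<in>Basis. (h \<bullet> b) *\<^sub>R b)" by (simp add: euclidean_representation)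
      also have "\<dots> = (\<Sum>b\<in>Basis. (h \<bullet> b) *\<^sub>R ?D w b)"
        by (simp add: linear_sum[OF lin] linear_scale[OF lin])
      also have "norm \<dots> \<le> (\<Sum>b\<in>Basis. norm h * K b)"
        by (rule sum_norm_le) (auto intro!: mult_mono K[OF w] Basis_le_norm)
      also have "\<dots> \<le> L * norm h"
        unfolding L_def sum_distrib_left[symmetric] by (simp add: mult.commute mult_left_mono)
      finally show "norm (?D w h) \<le> L * norm h" .
    qed
  qed
  then show thesis by (intro that[of L]) (auto simp: L_def)
qed

section \<open>Integral curves of a C1 vector field\<close>

definition integral_curve_on ::
  "('a::topological_space, 'e::euclidean_space) chart set \<Rightarrow> ('a \<Rightarrow> ('a, 'e) tvec) \<Rightarrow>
     real set \<Rightarrow> (real \<Rightarrow> 'a) \<Rightarrow> bool"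
where
  "integral_curve_on A u S \<gamma> \<longleftrightarrow> continuous_on S \<gamma> \<and>
     (\<forall>t\<in>S. \<forall>c\<in>charts_at A (\<gamma> t). ((coord c \<circ> \<gamma>) has_vector_derivative u (\<gamma> t) c) (at t))"

lemma integral_curve_on_UNIV: "integral_curve_on A u UNIV = integral_curve A u"
  by (auto simp: fun_eq_iff integral_curve_on_def integral_curve_def)

lemma integral_curve_on_subset:
  "integral_curve_on A u S \<gamma> \<Longrightarrow> T \<subseteq> S \<Longrightarrow> integral_curve_on A u T \<gamma>"
  by (auto simp: integral_curve_on_def intro: continuous_on_subset)

lemma integral_curve_on_shift:
  assumes "integral_curve_on A u S \<gamma>" "\<And>t. t \<in> T \<Longrightarrow> t + s \<in> S"
  shows "integral_curve_on A u T (\<lambda>t. \<gamma> (t + s))"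
  unfolding integral_curve_on_def
proof (intro conjI ballI)
  show "continuous_on T (\<lambda>t. \<gamma> (t + s))"
    by (rule continuous_on_compose2[of S \<gamma>])
      (use assms in \<open>auto simp: integral_curve_on_def intro!: continuous_intros\<close>)
  fix t c assume "t \<in> T" "c \<in> charts_at A (\<gamma> (t + s))"
  then have "((coord c \<circ> \<gamma>) has_vector_derivative u (\<gamma> (t + s)) c) (at (t + s))"
    using assms by (auto simp: integral_curve_on_def)
  then have "(((coord c \<circ> \<gamma>) \<circ> (\<lambda>t. t + s)) has_vector_derivative 1 *\<^sub>R u (\<gamma> (t + s)) c) (at t)"
    by (intro vector_diff_chain_at) (auto intro!: derivative_eq_intros)
  then show "((coord c \<circ> (\<lambda>t. \<gamma> (t + s))) has_vector_derivative u (\<gamma> (t + s)) c) (at t)"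
    by (simp add: o_def)
qed

text \<open>Continuity and the differential equation are local conditions; this allows curves to be
  glued from pieces that agree on overlaps.\<close>

lemma integral_curve_on_local:
  assumes "\<And>t. t \<in> S \<Longrightarrow> \<exists>T \<eta>. open T \<and> t \<in> T \<and> integral_curve_on A u T \<eta> \<and> (\<forall>s\<in>T. \<gamma> s = \<eta> s)"
  shows "integral_curve_on A u S \<gamma>"
proof -
  have "isCont \<gamma> t \<and> (\<forall>c\<in>charts_at A (\<gamma> t). ((coord c \<circ> \<gamma>) has_vector_derivative u (\<gamma> t) c) (at t))"
    if t: "t \<in> S" for t
  proof -
    obtain T \<eta> where T: "open T" "t \<in> T" "integral_curve_on A u T \<eta>" "\<forall>s\<in>T. \<gamma> s = \<eta> s"
      using assms[OF t] by blast
    have "continuous_on T \<eta>" using T(3) by (simp add: integral_curve_on_def)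
    then have "continuous_on T \<gamma>" by (rule continuous_on_eq) (simp add: T(4))
    then have "isCont \<gamma> t" using T continuous_on_eq_continuous_at by blast
    moreover have "((coord c \<circ> \<gamma>) has_vector_derivative u (\<gamma> t) c) (at t)" if "c \<in> charts_at A (\<gamma> t)" for c
      by (rule has_vector_derivative_transform_within_open[of "coord c \<circ> \<eta>" _ _ T])
        (use T that in \<open>auto simp: integral_curve_on_def\<close>)
    ultimately show ?thesis by blast
  qed
  then show ?thesis by (auto simp: integral_curve_on_def intro: continuous_at_imp_continuous_on)
qed

locale C1_vector_field = atlas A for A :: "('a::t2_space, 'e::euclidean_space) chart set" +
  fixes u :: "'a \<Rightarrow> ('a, 'e) tvec"
  assumes tangent: "u p \<in> tangent_space A p"
    and C1: "c \<in> A \<Longrightarrow> Ck_on (Suc 0) (coord c ` chart_dom c) (\<lambda>x. u (inv_coord c x) c)"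
begin

lemma Lipschitz_chart:
  assumes c: "c \<in> charts_at A p"
  obtains r L where "0 < r" "cball (coord c p) r \<subseteq> coord c ` chart_dom c" "0 \<le> L"
    "\<And>y z. y \<in> cball (coord c p) r \<Longrightarrow> z \<in> cball (coord c p) r \<Longrightarrow>
       norm (u (inv_coord c y) c - u (inv_coord c z) c) \<le> L * norm (y - z)"
proof -
  obtain r where r: "0 < r" "cball (coord c p) r \<subseteq> coord c ` chart_dom c"
    using open_contains_cball open_coord_image charts_atD[OF c] by (metis image_eqI)
  then show thesis
    using C1_imp_Lipschitz[OF C1 r(2)] charts_atD[OF c] that by metis
qed

text \<open>In coordinates the field is Lipschitz only near \<open>p\<close>. Composed with the
  nearest-point projection onto a ball it becomes globally Lipschitz and bounded; solutions starting
  in the half ball stay in the ball, where the projection changes nothing.\<close>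

lemma local_flow_exists:
  obtains U h \<Phi> where "open U" "p \<in> U" "0 < h" "continuous_on ({-h<..<h} \<times> U) (\<lambda>(t, q). \<Phi> t q)"
    "\<And>q. q \<in> U \<Longrightarrow> \<Phi> 0 q = q \<and> integral_curve_on A u {-h<..<h} (\<lambda>t. \<Phi> t q)"
proof -
  obtain c where c: "c \<in> charts_at A p" by (rule charts_at_nonempty)
  note cA = charts_atD(1)[OF c]
  define x0 where "x0 = coord c p"
  define V where "V x = u (inv_coord c x) c" for x
  obtain r L where r: "0 < r" "cball x0 r \<subseteq> coord c ` chart_dom c" and L: "0 \<le> L"
    "\<And>y z. y \<in> cball x0 r \<Longrightarrow> z \<in> cball x0 r \<Longrightarrow> norm (V y - V z) \<le> L * norm (y - z)"
    unfolding x0_def V_def using Lipschitz_chart[OF c] by metis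
  define P where "P = closest_point (cball x0 r)"
  have P: "P x \<in> cball x0 r" for x
    unfolding P_def using r by (intro closest_point_in_set) auto
  have Plip: "norm (P x - P y) \<le> norm (x - y)" for x y
    unfolding P_def using closest_point_lipschitz[of "cball x0 r" x y] r by (simp add: dist_norm)
  have Pid: "P x = x" if "x \<in> cball x0 r" for x
    unfolding P_def using that by (rule closest_point_self)
  define B where "B = norm (V x0) + L * r"
  have B: "norm (V (P x)) \<le> B" for x
  proof -
    have "norm (V (P x)) \<le> norm (V x0) + norm (V (P x) - V x0)" by (rule norm_triangle_sub)
    also have "norm (V (P x) - V x0) \<le> L * norm (P x - x0)" using r P by (intro L) auto
    also have "\<dots> \<le> L * r" using P[of x] L by (intro mult_left_mono) (auto simp: dist_norm norm_minus_commute)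
    finally show ?thesis by (simp add: B_def)
  qed
  have B0: "0 \<le> B" using L r by (simp add: B_def)
  \<comment> \<open>The first bound makes the iteration contract, the second keeps the displacement
    \<open>h * B\<close> below half the radius. The added 1 avoids division by zero.\<close>
  define h where "h = min (1 / (2 * (L + 1))) (r / (2 * (B + 1)))"
  have h0: "0 < h" using L r B0 by (simp add: h_def)
  have hL: "h * L \<le> 1 / 2"
  proof -
    have "h * L \<le> 1 / (2 * (L + 1)) * (L + 1)" using L by (intro mult_mono) (auto simp: h_def)
    also have "\<dots> = 1 / 2" using L by (simp add: field_simps)
    finally show ?thesis .
  qed
  have hB: "h * B < r / 2"
  proof -
    have "h * B < h * (B + 1)" using h0 by simp
    also have "\<dots> \<le> r / (2 * (B + 1)) * (B + 1)" using B0 by (intro mult_right_mono) (auto simp: h_def)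
    also have "\<dots> = r / 2" using B0 by (simp add: field_simps)
    finally show ?thesis .
  qed
  have lipVP: "norm ((V \<circ> P) x - (V \<circ> P) y) \<le> L * norm (x - y)" for x y
    using L(2)[OF P P, of x y] mult_left_mono[OF Plip[of x y] L(1)] by simp
  have BVP: "norm ((V \<circ> P) x) \<le> B" for x using B by simp
  obtain y where y: "continuous_on UNIV (\<lambda>(t, x). y t x)" "\<And>x. y 0 x = x"
    "\<And>t x. \<bar>t\<bar> < h \<Longrightarrow> ((\<lambda>t. y t x) has_vector_derivative (V \<circ> P) (y t x)) (at t)"
    "\<And>t x. norm (y t x - x) \<le> h * B"
    by (rule Lipschitz_flow_exists[OF lipVP BVP h0 hL]) (rule that)
  define U where "U = chart_dom c \<inter> coord c -` ball x0 (r / 2)"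
  define \<Phi> where "\<Phi> t q = inv_coord c (y t (coord c q))" for t q
  have yin: "y t (coord c q) \<in> cball x0 r" if "q \<in> U" for t q
  proof -
    have "dist x0 (y t (coord c q)) \<le> dist x0 (coord c q) + dist (coord c q) (y t (coord c q))"
      by (rule dist_triangle)
    also have "dist (coord c q) (y t (coord c q)) < r / 2"
      using y(4)[of t "coord c q"] hB by (simp add: dist_norm norm_minus_commute)
    also have "dist x0 (coord c q) < r / 2" using that by (simp add: U_def)
    finally show ?thesis by simp
  qed
  have yim: "y t (coord c q) \<in> coord c ` chart_dom c" if "q \<in> U" for t q
    using yin[OF that] r(2) by blast
  have cont: "continuous_on (UNIV \<times> U) (\<lambda>(t, q). \<Phi> t q)"
    unfolding \<Phi>_def split_beta
  proof (rule continuous_on_compose2[OF continuous_on_inv_coord[OF cA]])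
    show "continuous_on (UNIV \<times> U) (\<lambda>x. y (fst x) (coord c (snd x)))"
    proof (rule continuous_on_compose2[of UNIV "\<lambda>z. y (fst z) (snd z)" _ "\<lambda>z. (fst z, coord c (snd z))"
          , unfolded fst_conv snd_conv])
      show "continuous_on UNIV (\<lambda>z. y (fst z) (snd z))" using y(1) by (simp add: split_beta)
      show "continuous_on (UNIV \<times> U) (\<lambda>z. (fst z, coord c (snd z)))"
        by (intro continuous_intros continuous_on_compose2[OF continuous_on_coord[OF cA]])
          (auto simp: U_def)
    qed auto
  qed (use yim in auto)
  show thesis
  proof
    show "open U" unfolding U_def by (rule open_coord_preimage[OF cA]) simp
    show "p \<in> U" using c r by (auto simp: U_def x0_def charts_at_def)
    show "continuous_on ({-h<..<h} \<times> U) (\<lambda>(t, q). \<Phi> t q)"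
      by (rule continuous_on_subset[OF cont]) auto
    fix q assume q: "q \<in> U"
    have "\<Phi> 0 q = q"
      using q by (simp add: \<Phi>_def y(2) U_def inv_coord_coord[OF cA])
    moreover have cq: "continuous_on {-h<..<h} (\<lambda>t. \<Phi> t q)"
    proof -
      have "continuous_on {-h<..<h} (\<lambda>t. case (t, q) of (t, q) \<Rightarrow> \<Phi> t q)"
        by (rule continuous_on_compose2[OF cont]) (use q in \<open>auto intro!: continuous_intros\<close>)
      then show ?thesis by simp
    qed
    moreover have "((coord d \<circ> (\<lambda>t. \<Phi> t q)) has_vector_derivative u (\<Phi> t q) d) (at t)"
      if t: "t \<in> {-h<..<h}" and d: "d \<in> charts_at A (\<Phi> t q)" for t d
    proof (rule velocity_change_of_chart[where c = c and S = "{-h<..<h}"])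
      show "c \<in> charts_at A (\<Phi> t q)"
        using cA inv_coord_in[OF cA yim[OF q]] by (simp add: charts_at_def \<Phi>_def)
      have "coord c \<circ> (\<lambda>t. \<Phi> t q) = (\<lambda>t. y t (coord c q))"
        using coord_inv_coord[OF cA yim[OF q]] by (auto simp: \<Phi>_def)
      moreover have "u (\<Phi> t q) c = (V \<circ> P) (y t (coord c q))"
        using Pid[OF yin[OF q]] by (simp add: V_def \<Phi>_def)
      ultimately show "((coord c \<circ> (\<lambda>t. \<Phi> t q)) has_vector_derivative u (\<Phi> t q) c) (at t)"
        using y(3)[of t "coord c q"] abs_less_iff[of t h] t by simp
    qed (use t d tangent cq in auto)
    ultimately show "\<Phi> 0 q = q \<and> integral_curve_on A u {-h<..<h} (\<lambda>t. \<Phi> t q)"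
      by (auto simp: integral_curve_on_def)
  qed fact
qed

lemma integral_curves_agree_near:
  assumes S: "open S" and \<gamma>: "integral_curve_on A u S \<gamma>" and \<eta>: "integral_curve_on A u S \<eta>"
    and t0: "t0 \<in> S" "\<gamma> t0 = \<eta> t0"
  obtains e where "0 < e" "\<And>t. \<bar>t - t0\<bar> < e \<Longrightarrow> t \<in> S \<and> \<gamma> t = \<eta> t"
proof -
  obtain c where c: "c \<in> charts_at A (\<gamma> t0)" by (rule charts_at_nonempty)
  note cA = charts_atD(1)[OF c]
  define x0 where "x0 = coord c (\<gamma> t0)"
  define V where "V x = u (inv_coord c x) c" for x
  obtain r L where r: "0 < r" "cball x0 r \<subseteq> coord c ` chart_dom c" and L: "0 \<le> L"
    "\<And>y z. y \<in> cball x0 r \<Longrightarrow> z \<in> cball x0 r \<Longrightarrow> norm (V y - V z) \<le> L * norm (y - z)"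
    unfolding x0_def V_def using Lipschitz_chart[OF c] by metis
  define W where "W = chart_dom c \<inter> coord c -` ball x0 r"
  have "open W" unfolding W_def by (rule open_coord_preimage[OF cA]) simp
  then have "open (\<gamma> -` W \<inter> S)" "open (\<eta> -` W \<inter> S)"
    using continuous_on_open_vimage[OF S] \<gamma> \<eta> unfolding integral_curve_on_def by blast+
  moreover have "\<gamma> t0 \<in> W" using c r by (auto simp: W_def x0_def charts_at_def)
  ultimately have "open ((\<gamma> -` W \<inter> S) \<inter> (\<eta> -` W \<inter> S))" "t0 \<in> (\<gamma> -` W \<inter> S) \<inter> (\<eta> -` W \<inter> S)"
    using t0 by auto
  then obtain e where e: "0 < e" "ball t0 e \<subseteq> (\<gamma> -` W \<inter> S) \<inter> (\<eta> -` W \<inter> S)"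
    using open_contains_ball by blast
  \<comment> \<open>Half of \<open>e\<close>, since solutions are compared on a closed interval,
    which has to fit into the open ball.\<close>
  define h where "h = min (e / 2) (1 / (2 * (L + 1)))"
  have h0: "0 < h" using L e by (simp add: h_def)
  have hL: "h * L \<le> 1 / 2"
  proof -
    have "h * L \<le> 1 / (2 * (L + 1)) * (L + 1)" using L by (intro mult_mono) (auto simp: h_def)
    also have "\<dots> = 1 / 2" using L by (simp add: field_simps)
    finally show ?thesis .
  qed
  have sol: "((\<lambda>t. coord c (\<phi> (t + t0))) has_vector_derivative V (coord c (\<phi> (t + t0)))) (at t)
      \<and> coord c (\<phi> (t + t0)) \<in> cball x0 r"
    if \<phi>: "integral_curve_on A u S \<phi>" "ball t0 e \<subseteq> \<phi> -` W \<inter> S" and t: "\<bar>t\<bar> \<le> h" for \<phi> t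
  proof -
    have "t + t0 \<in> ball t0 e" using t e by (auto simp: h_def dist_real_def)
    then have in_W: "\<phi> (t + t0) \<in> W" "t + t0 \<in> S" using \<phi> by auto
    then have "c \<in> charts_at A (\<phi> (t + t0))" using cA by (simp add: W_def charts_at_def)
    moreover have "integral_curve_on A u {s. s + t0 \<in> S} (\<lambda>t. \<phi> (t + t0))"
      by (rule integral_curve_on_shift[OF \<phi>(1)]) simp
    ultimately have "((coord c \<circ> (\<lambda>t. \<phi> (t + t0))) has_vector_derivative u (\<phi> (t + t0)) c) (at t)"
      using in_W by (simp add: integral_curve_on_def)
    moreover have "V (coord c (\<phi> (t + t0))) = u (\<phi> (t + t0)) c"
      using in_W by (simp add: V_def W_def inv_coord_coord[OF cA])
    ultimately show ?thesis using in_W by (simp add: o_def W_def)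
  qed
  show thesis
  proof
    fix t assume t: "\<bar>t - t0\<bar> < h"
    have "coord c (\<gamma> ((t - t0) + t0)) = coord c (\<eta> ((t - t0) + t0))"
      by (rule Lipschitz_ode_unique[where D = "cball x0 r" and V = V and L = L and h = h and t = "t - t0"
          and y = "\<lambda>t. coord c (\<gamma> (t + t0))" and z = "\<lambda>t. coord c (\<eta> (t + t0))"])
        (use L h0 hL sol[OF \<gamma>] sol[OF \<eta>] e t t0 in auto)
    moreover have "t \<in> ball t0 e" using t e by (auto simp: h_def dist_real_def abs_minus_commute)
    then have "\<gamma> t \<in> chart_dom c" "\<eta> t \<in> chart_dom c" "t \<in> S" using e(2) by (auto simp: W_def)
    ultimately show "t \<in> S \<and> \<gamma> t = \<eta> t"
      using inv_coord_coord[OF cA] by (metis diff_add_cancel)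
  qed fact
qed

text \<open>The times of agreement form an open set by local uniqueness, those of disagreement by
  the Hausdorff property, and a connected domain cannot split.\<close>

lemma integral_curve_on_unique:
  assumes S: "open S" "connected S" and \<gamma>: "integral_curve_on A u S \<gamma>" and \<eta>: "integral_curve_on A u S \<eta>"
    and t0: "t0 \<in> S" "\<gamma> t0 = \<eta> t0" and t: "t \<in> S"
  shows "\<gamma> t = \<eta> t"
proof -
  let ?E = "{t \<in> S. \<gamma> t = \<eta> t}" and ?N = "{t \<in> S. \<gamma> t \<noteq> \<eta> t}"
  have "open ?E"
    unfolding open_dist
    using integral_curves_agree_near[OF S(1) \<gamma> \<eta>]
    by (metis (mono_tags, lifting) dist_real_def mem_Collect_eq)
  moreover have "open ?N"
  proof (rule topological_space_class.openI)
    fix t assume t: "t \<in> ?N"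
    then obtain P Q where PQ: "open P" "open Q" "\<gamma> t \<in> P" "\<eta> t \<in> Q" "P \<inter> Q = {}"
      using hausdorff[of "\<gamma> t" "\<eta> t"] by blast
    have "continuous_on S \<gamma>" "continuous_on S \<eta>" using \<gamma> \<eta> by (auto simp: integral_curve_on_def)
    then have "open ((\<gamma> -` P \<inter> S) \<inter> (\<eta> -` Q \<inter> S))"
      using PQ(1,2) S(1) by (auto simp: continuous_on_open_vimage intro: open_Int[of "_ \<inter> S"])
    moreover have "t \<in> (\<gamma> -` P \<inter> S) \<inter> (\<eta> -` Q \<inter> S)" using PQ t by simp
    moreover have "\<gamma> s \<noteq> \<eta> s" if "s \<in> (\<gamma> -` P \<inter> S) \<inter> (\<eta> -` Q \<inter> S)" for s
    proof
      assume "\<gamma> s = \<eta> s"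
      then have "\<gamma> s \<in> P \<inter> Q" using that by simp
      then show False using PQ(5) by simp
    qed
    ultimately show "\<exists>T. open T \<and> t \<in> T \<and> T \<subseteq> ?N" by blast
  qed
  moreover have "?E \<union> ?N = S" "?E \<inter> ?N = {}" by auto
  ultimately have "?E \<inter> S = {} \<or> ?N \<inter> S = {}"
    using S(2) unfolding connected_def by (metis (no_types, lifting) Int_assoc Int_empty_left subset_refl)
  then show ?thesis using t0 t by blast
qed

text \<open>Since the lifetime \<open>a\<close> is common to all starting points, the curve can be
  restarted at the times \<open>a/2\<close> and \<open>- a/2\<close>.\<close>

lemma integral_curve_extend:
  assumes a: "0 < a" and ex: "\<And>p. \<exists>\<gamma>. integral_curve_on A u {-a<..<a} \<gamma> \<and> \<gamma> 0 = p"
  shows "\<exists>\<gamma>. integral_curve_on A u {-(3/2 * a)<..<3/2 * a} \<gamma> \<and> \<gamma> 0 = p"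
proof -
  obtain \<gamma> where \<gamma>: "integral_curve_on A u {-a<..<a} \<gamma>" "\<gamma> 0 = p" using ex by blast
  obtain \<eta> where \<eta>: "integral_curve_on A u {-a<..<a} \<eta>" "\<eta> 0 = \<gamma> (a/2)" using ex by blast
  obtain \<zeta> where \<zeta>: "integral_curve_on A u {-a<..<a} \<zeta>" "\<zeta> 0 = \<gamma> (- a/2)" using ex by blast
  have \<eta>': "integral_curve_on A u {-a/2<..<3/2 * a} (\<lambda>t. \<eta> (t - a/2))"
    using integral_curve_on_shift[OF \<eta>(1), of "{-a/2<..<3/2 * a}" "- a/2"] by simp
  have \<zeta>': "integral_curve_on A u {-(3/2 * a)<..<a/2} (\<lambda>t. \<zeta> (t + a/2))"
    by (rule integral_curve_on_shift[OF \<zeta>(1)]) auto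
  \<comment> \<open>The restarted pieces agree with \<open>\<gamma>\<close> on intervals around 0,
    so switching between them at time 0 is harmless.\<close>
  have 1: "\<eta> (t - a/2) = \<gamma> t" if "t \<in> {-a/2<..<a}" for t
    by (rule integral_curve_on_unique[of "{-a/2<..<a}" _ _ "a/2"])
      (use a \<eta>(2) that in \<open>auto intro: integral_curve_on_subset[OF \<eta>'] integral_curve_on_subset[OF \<gamma>(1)]\<close>)
  have 2: "\<zeta> (t + a/2) = \<gamma> t" if "t \<in> {-a<..<a/2}" for t
    by (rule integral_curve_on_unique[of "{-a<..<a/2}" _ _ "-a/2"])
      (use a \<zeta>(2) that in \<open>auto intro: integral_curve_on_subset[OF \<zeta>'] integral_curve_on_subset[OF \<gamma>(1)]\<close>)
  define \<theta> where "\<theta> t = (if t \<ge> 0 then \<eta> (t - a/2) else \<zeta> (t + a/2))" for t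
  have "integral_curve_on A u {-(3/2 * a)<..<3/2 * a} \<theta>"
  proof (rule integral_curve_on_local)
    fix t assume t: "t \<in> {-(3/2 * a)<..<3/2 * a}"
    consider "t \<in> {-a/2<..<a/2}" | "t \<in> {0<..<3/2 * a}" | "t \<in> {-(3/2 * a)<..<0}" using t a by fastforce
    then show "\<exists>T \<eta>. open T \<and> t \<in> T \<and> integral_curve_on A u T \<eta> \<and> (\<forall>s\<in>T. \<theta> s = \<eta> s)"
    proof cases
      case 1
      have "integral_curve_on A u {-a/2<..<a/2} \<gamma>"
        by (rule integral_curve_on_subset[OF \<gamma>(1)]) (use a in auto)
      moreover have "\<forall>s\<in>{-a/2<..<a/2}. \<theta> s = \<gamma> s"
        unfolding \<theta>_def using \<open>\<And>t. t \<in> {-a/2<..<a} \<Longrightarrow> _\<close> 2 a by auto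
      ultimately show ?thesis using 1 open_greaterThanLessThan by blast
    next
      case 2
      have "integral_curve_on A u {0<..<3/2 * a} (\<lambda>t. \<eta> (t - a/2))"
        by (rule integral_curve_on_subset[OF \<eta>']) (use a in auto)
      moreover have "\<forall>s\<in>{0<..<3/2 * a}. \<theta> s = \<eta> (s - a/2)" by (simp add: \<theta>_def)
      ultimately show ?thesis using 2 open_greaterThanLessThan by blast
    next
      case 3
      have "integral_curve_on A u {-(3/2 * a)<..<0} (\<lambda>t. \<zeta> (t + a/2))"
        by (rule integral_curve_on_subset[OF \<zeta>']) (use a in auto)
      moreover have "\<forall>s\<in>{-(3/2 * a)<..<0}. \<theta> s = \<zeta> (s + a/2)" by (simp add: \<theta>_def)
      ultimately show ?thesis using 3 open_greaterThanLessThan by blast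
    qed
  qed
  moreover have "\<theta> 0 = p" using 1[of 0] \<gamma>(2) a by (simp add: \<theta>_def)
  ultimately show ?thesis by blast
qed

section \<open>The global flow on a compact manifold\<close>

lemma uniform_local_flow:
  assumes compact: "compact (UNIV :: 'a set)"
  obtains h \<Phi> where "0 < h" "continuous_on ({-h<..<h} \<times> UNIV) (\<lambda>(t, q). \<Phi> t q)"
    "\<And>q. \<Phi> 0 q = q" "\<And>q. integral_curve_on A u {-h<..<h} (\<lambda>t. \<Phi> t q)"
proof -
  have "\<exists>U h \<Phi>. open U \<and> p \<in> U \<and> 0 < h \<and> continuous_on ({-h<..<h} \<times> U) (\<lambda>(t, q). \<Phi> t q) \<and>
      (\<forall>q\<in>U. \<Phi> 0 q = q \<and> integral_curve_on A u {-h<..<h} (\<lambda>t. \<Phi> t q))" for p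
    by (rule local_flow_exists[of p]) blast
  then obtain U e \<Psi> where *: "\<And>p. open (U p)" "\<And>p. p \<in> U p" "\<And>p. 0 < e p"
    "\<And>p. continuous_on ({-e p<..<e p} \<times> U p) (\<lambda>(t, q). \<Psi> p t q)"
    "\<And>p q. q \<in> U p \<Longrightarrow> \<Psi> p 0 q = q \<and> integral_curve_on A u {-e p<..<e p} (\<lambda>t. \<Psi> p t q)"
    by metis
  obtain F where F: "finite F" "UNIV \<subseteq> (\<Union>p\<in>F. U p)"
    by (rule compactE_image[OF compact, of UNIV U]) (use * in auto)
  define h where "h = Min (e ` F)"
  have "F \<noteq> {}" using F by auto
  then have h: "0 < h" "\<And>p. p \<in> F \<Longrightarrow> h \<le> e p" using F * by (auto simp: h_def)
  have "\<exists>p. p \<in> F \<and> q \<in> U p" for q using F(2) by blast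
  then obtain s where s: "\<And>q. s q \<in> F \<and> q \<in> U (s q)" by metis
  define \<Phi> where "\<Phi> t q = \<Psi> (s q) t q" for t q
  have ic: "integral_curve_on A u {-h<..<h} (\<lambda>t. \<Psi> p t q)" if "p \<in> F" "q \<in> U p" for p q
    using *(5)[OF that(2)] h(2)[OF that(1)] by (auto elim!: integral_curve_on_subset)
  \<comment> \<open>By uniqueness the arbitrary choice of the box \<open>s q\<close> does not
    influence the value, so continuity is inherited from every box.\<close>
  have \<Phi>: "\<Phi> t q = \<Psi> p t q" if "p \<in> F" "q \<in> U p" "t \<in> {-h<..<h}" for p q t
    unfolding \<Phi>_def
    by (rule integral_curve_on_unique[OF _ _ ic ic, of _ _ _ _ 0]) (use s *(5) that h in auto)
  show thesis
  proof
    show "\<Phi> 0 q = q" "integral_curve_on A u {-h<..<h} (\<lambda>t. \<Phi> t q)" for q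
      using ic[of "s q" q] s[of q] *(5) by (auto simp: \<Phi>_def)
    have "continuous_on (\<Union>p\<in>F. {-h<..<h} \<times> U p) (\<lambda>(t, q). \<Phi> t q)"
    proof (rule continuous_on_open_UN)
      fix p assume p: "p \<in> F"
      have "continuous_on ({-h<..<h} \<times> U p) (\<lambda>(t, q). \<Psi> p t q)"
        by (rule continuous_on_subset[OF *(4)]) (use h(2)[OF p] in auto)
      then show "continuous_on ({-h<..<h} \<times> U p) (\<lambda>(t, q). \<Phi> t q)"
        by (rule continuous_on_eq) (use \<Phi>[OF p] in auto)
    qed (use * in \<open>auto intro: open_Times\<close>)
    moreover have "(\<Union>p\<in>F. {-h<..<h} \<times> U p) = {-h<..<h} \<times> UNIV" using F by auto
    ultimately show "continuous_on ({-h<..<h} \<times> UNIV) (\<lambda>(t, q). \<Phi> t q)" by simp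
  qed fact
qed

context
  assumes compact: "compact (UNIV :: 'a set)"
begin

lemma integral_curve_exists: "\<exists>\<gamma>. integral_curve A u \<gamma> \<and> \<gamma> 0 = p"
proof -
  obtain h \<Phi> where h: "0 < h" and \<Phi>: "\<And>q. \<Phi> 0 q = q" "\<And>q. integral_curve_on A u {-h<..<h} (\<lambda>t. \<Phi> t q)"
    using uniform_local_flow[OF compact] by metis
  \<comment> \<open>Each extension multiplies the common lifetime by 3/2, so the lifetimes exceed
    every bound.\<close>
  define a where "a n = (3/2)^n * h" for n
  have a0: "0 < a n" for n using h by (simp add: a_def)
  have "\<exists>\<gamma>. integral_curve_on A u {-a n<..<a n} \<gamma> \<and> \<gamma> 0 = p" for n p
  proof (induction n arbitrary: p)
    case 0
    then show ?case using \<Phi> unfolding a_def by auto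
  next
    case (Suc n)
    then show ?case using integral_curve_extend[OF a0 Suc] by (simp add: a_def mult.assoc)
  qed
  then have "\<exists>\<gamma>. \<forall>n. integral_curve_on A u {-a n<..<a n} (\<gamma> n) \<and> \<gamma> n 0 = p"
    by (intro choice) blast
  then obtain \<gamma> where \<gamma>: "\<And>n. integral_curve_on A u {-a n<..<a n} (\<gamma> n)" "\<And>n. \<gamma> n 0 = p" by blast
  have mono: "a m \<le> a n" if "m \<le> n" for m n
    unfolding a_def using that h by (intro mult_right_mono power_increasing) auto
  have agree: "\<gamma> m t = \<gamma> n t" if "m \<le> n" "t \<in> {-a m<..<a m}" for m n t
  proof (rule integral_curve_on_unique[of "{-a m<..<a m}" _ _ 0])
    show "integral_curve_on A u {-a m<..<a m} (\<gamma> n)"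
      by (rule integral_curve_on_subset[OF \<gamma>(1)]) (use mono[OF that(1)] in auto)
  qed (use that \<gamma> a0 in auto)
  have "\<exists>n. t \<in> {-a n<..<a n}" for t
  proof -
    obtain n where "\<bar>t\<bar> / h < (3/2)^n" using real_arch_pow[of "3/2" "\<bar>t\<bar> / h"] by auto
    then have "\<bar>t\<bar> < a n" using h by (simp add: a_def pos_divide_less_eq)
    then show ?thesis by (auto intro!: exI[of _ n])
  qed
  then obtain N where N: "\<And>t. t \<in> {-a (N t)<..<a (N t)}" by metis
  define \<eta> where "\<eta> t = \<gamma> (N t) t" for t
  have \<eta>: "\<eta> t = \<gamma> n t" if "t \<in> {-a n<..<a n}" for n t
    unfolding \<eta>_def using agree[of "N t" n t] agree[of n "N t" t] N[of t] that by (metis nat_le_linear)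
  have "integral_curve_on A u UNIV \<eta>"
  proof (rule integral_curve_on_local)
    fix t
    show "\<exists>T \<zeta>. open T \<and> t \<in> T \<and> integral_curve_on A u T \<zeta> \<and> (\<forall>s\<in>T. \<eta> s = \<zeta> s)"
      using N[of t] \<eta> \<gamma>(1)[of "N t"] open_greaterThanLessThan by blast
  qed
  moreover have "\<eta> 0 = p" by (simp add: \<eta>_def \<gamma>)
  ultimately show ?thesis by (auto simp: integral_curve_on_UNIV)
qed

lemma integral_curve_unique:
  assumes "integral_curve A u \<gamma>" "integral_curve A u \<eta>" "\<gamma> t0 = \<eta> t0"
  shows "\<gamma> = \<eta>"
  using integral_curve_on_unique[of UNIV \<gamma> \<eta> t0] assms by (auto simp: integral_curve_on_UNIV)

lemma flow_integral_curve: "integral_curve A u (\<lambda>t. flow A u t p)" (is ?I)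
  and flow_0: "flow A u 0 p = p"
proof -
  have "\<exists>!\<gamma>. integral_curve A u \<gamma> \<and> \<gamma> 0 = p"
    using integral_curve_exists[of p] integral_curve_unique by metis
  from theI'[OF this] show ?I "flow A u 0 p = p" by (auto simp: flow_def)
qed

lemma flow_eqI: "integral_curve A u \<gamma> \<Longrightarrow> flow A u t (\<gamma> 0) = \<gamma> t"
  using integral_curve_unique[OF flow_integral_curve[of "\<gamma> 0"], of \<gamma> 0] flow_0 by metis

lemma flow_add: "flow A u (s + t) p = flow A u s (flow A u t p)"
proof -
  have "integral_curve A u (\<lambda>s. flow A u (s + t) p)"
    using integral_curve_on_shift[of A u UNIV "\<lambda>s. flow A u s p" UNIV t] flow_integral_curve
    by (simp add: integral_curve_on_UNIV)
  from flow_eqI[OF this, of s] show ?thesis by simp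
qed

text \<open>Dividing \<open>t\<close> into n equal steps reduces large times to iterates of the
  short-time flow, which is continuous by construction.\<close>

lemma flow_continuous: "continuous_on UNIV (\<lambda>(t, p). flow A u t p)"
proof -
  obtain h \<Phi> where h: "0 < h" and \<Phi>: "continuous_on ({-h<..<h} \<times> UNIV) (\<lambda>(t, q). \<Phi> t q)"
    "\<And>q. \<Phi> 0 q = q" "\<And>q. integral_curve_on A u {-h<..<h} (\<lambda>t. \<Phi> t q)"
    using uniform_local_flow[OF compact] by metis
  have eq: "\<Phi> t q = flow A u t q" if "t \<in> {-h<..<h}" for t q
    by (rule integral_curve_on_unique[of "{-h<..<h}" _ _ 0])
      (use that h \<Phi> flow_0 flow_integral_curve[of q] in
        \<open>auto intro: integral_curve_on_subset simp: integral_curve_on_UNIV[symmetric]\<close>)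
  have small: "continuous_on ({-h<..<h} \<times> UNIV) (\<lambda>(t, q). flow A u t q)"
    by (rule continuous_on_eq[OF \<Phi>(1)]) (use eq in auto)
  have iter: "continuous_on ({-h<..<h} \<times> UNIV) (\<lambda>(t, q). flow A u (real n * t) q)" for n
  proof (induction n)
    case 0
    then show ?case by (simp add: flow_0 split_beta continuous_on_snd)
  next
    case (Suc n)
    have "flow A u (real (Suc n) * t) q = flow A u t (flow A u (real n * t) q)" for t q
      using flow_add[of t "real n * t" q] by (simp add: algebra_simps)
    moreover have "continuous_on ({-h<..<h} \<times> UNIV)
        (\<lambda>z. (\<lambda>(t, q). flow A u t q) (fst z, flow A u (real n * fst z) (snd z)))"
      by (rule continuous_on_compose2[OF small])
        (use Suc.IH in \<open>auto simp: split_beta intro!: continuous_intros\<close>)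
    ultimately show ?case by (simp add: split_beta)
  qed
  have "continuous_on (\<Union>n\<in>{0<..}. {-(real n * h)<..<real n * h} \<times> UNIV) (\<lambda>(t, p). flow A u t p)"
  proof (rule continuous_on_open_UN)
    fix n :: nat assume n: "n \<in> {0<..}"
    have "continuous_on ({-(real n * h)<..<real n * h} \<times> UNIV)
        (\<lambda>z. (\<lambda>(t, q). flow A u (real n * t) q) (fst z / real n, snd z))"
      by (rule continuous_on_compose2[OF iter[of n]])
        (use n h in \<open>auto intro!: continuous_intros simp: field_simps\<close>)
    then show "continuous_on ({-(real n * h)<..<real n * h} \<times> UNIV) (\<lambda>(t, p). flow A u t p)"
      using n by (simp add: split_beta)
  qed (auto intro: open_Times)
  moreover have "(\<Union>n\<in>{0<..}. {-(real n * h)<..<real n * h} \<times> (UNIV :: 'a set)) = UNIV"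
  proof -
    have "\<exists>n>0. \<bar>t\<bar> < real n * h" for t
    proof -
      obtain n where "\<bar>t\<bar> / h < real n" using reals_Archimedean2 by blast
      then show ?thesis using h by (intro exI[of _ "Suc n"]) (auto simp: field_simps)
    qed
    then have ex: "\<exists>n>0. - (real n * h) < t \<and> t < real n * h" for t
      by (metis abs_less_iff minus_less_iff)
    have "z \<in> (\<Union>n\<in>{0<..}. {-(real n * h)<..<real n * h} \<times> (UNIV :: 'a set))" for z
      using ex[of "fst z"] by (cases z) fastforce
    then show ?thesis by blast
  qed
  ultimately show ?thesis by simp
qed

end

end

section \<open>Path integrals of closed 1-forms\<close>

lemma closed_top_formD:
  assumes "closed_top_form F" "(U, f) \<in> F"
  shows "open U" "continuous_on U f"
  using assms unfolding closed_top_form_def by blast+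

lemma closed_top_form_cover:
  assumes "closed_top_form F"
  obtains U f where "(U, f) \<in> F" "p \<in> U"
  using assms unfolding closed_top_form_def by blast

lemma closed_top_form_locally_const:
  assumes "closed_top_form F" "(U, f) \<in> F" "(V, g) \<in> F" "p \<in> U" "p \<in> V"
  obtains W where "open W" "p \<in> W" "W \<subseteq> U \<inter> V" "\<And>q. q \<in> W \<Longrightarrow> f q - f p = g q - g p"
proof -
  have "locally_constant_on (U \<inter> V) (\<lambda>x. f x - g x)"
    using assms(1-3) unfolding closed_top_form_def by fast
  then obtain W where W: "openin (top_of_set (U \<inter> V)) W" "p \<in> W" "(\<lambda>x. f x - g x) constant_on W"
    using assms unfolding locally_constant_on_def by blast
  have "open W"
    using W(1) closed_top_formD(1)[OF assms(1)] assms(2,3) openin_open_eq[of "U \<inter> V" W] by blast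
  moreover have "f q - f p = g q - g p" if "q \<in> W" for q
  proof -
    obtain c where "\<And>x. x \<in> W \<Longrightarrow> f x - g x = c" using W(3) unfolding constant_on_def by blast
    from this[OF that] this[OF W(2)] show ?thesis by linarith
  qed
  ultimately show thesis using that W openin_imp_subset by metis
qed

text \<open>The pull-back of the form to the curve, integrated: \<open>h\<close> is its primitive in
  the parameter. Path integrals become increments of \<open>h\<close>, so that subdivisions never
  have to be compared with each other.\<close>

definition primitive_along :: "'a::topological_space top_form \<Rightarrow> (real \<Rightarrow> 'a) \<Rightarrow> real set \<Rightarrow> (real \<Rightarrow> real) \<Rightarrow> bool"
where
  "primitive_along F \<gamma> S h \<longleftrightarrow>
     (\<forall>t\<in>S. \<forall>(U, f)\<in>F. \<gamma> t \<in> U \<longrightarrow>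
        (\<exists>e>0. \<forall>s\<in>S. \<bar>s - t\<bar> < e \<longrightarrow> h s - h t = f (\<gamma> s) - f (\<gamma> t)))"

lemma primitive_alongI:
  assumes "\<And>t U f. t \<in> S \<Longrightarrow> (U, f) \<in> F \<Longrightarrow> \<gamma> t \<in> U \<Longrightarrow>
    \<exists>e>0. \<forall>s\<in>S. \<bar>s - t\<bar> < e \<longrightarrow> h s - h t = f (\<gamma> s) - f (\<gamma> t)"
  shows "primitive_along F \<gamma> S h"
  using assms unfolding primitive_along_def by blast

lemma primitive_alongE:
  assumes "primitive_along F \<gamma> S h" "t \<in> S" "(U, f) \<in> F" "\<gamma> t \<in> U"
  obtains e where "0 < e" "\<And>s. s \<in> S \<Longrightarrow> \<bar>s - t\<bar> < e \<Longrightarrow> h s - h t = f (\<gamma> s) - f (\<gamma> t)"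
  using assms unfolding primitive_along_def by blast

lemma primitive_along_reparam:
  assumes h: "primitive_along F \<gamma> S h" and \<sigma>: "continuous_on T \<sigma>" "\<sigma> ` T \<subseteq> S"
    and eq: "\<And>t. t \<in> T \<Longrightarrow> \<eta> t = \<gamma> (\<sigma> t)"
  shows "primitive_along F \<eta> T (\<lambda>t. h (\<sigma> t))"
proof (rule primitive_alongI)
  fix t U f assume t: "t \<in> T" and U: "(U, f) \<in> F" "\<eta> t \<in> U"
  have "\<sigma> t \<in> S" "\<gamma> (\<sigma> t) \<in> U" using t U \<sigma> eq[OF t] by auto
  then obtain e where e: "0 < e"
    "\<And>s. s \<in> S \<Longrightarrow> \<bar>s - \<sigma> t\<bar> < e \<Longrightarrow> h s - h (\<sigma> t) = f (\<gamma> s) - f (\<gamma> (\<sigma> t))"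
    using primitive_alongE[OF h _ U(1)] by blast
  obtain d where d: "0 < d" "\<And>s. s \<in> T \<Longrightarrow> \<bar>s - t\<bar> < d \<Longrightarrow> \<bar>\<sigma> s - \<sigma> t\<bar> < e"
    using \<sigma>(1) t e(1) unfolding continuous_on_iff dist_real_def by blast
  show "\<exists>e>0. \<forall>s\<in>T. \<bar>s - t\<bar> < e \<longrightarrow> h (\<sigma> s) - h (\<sigma> t) = f (\<eta> s) - f (\<eta> t)"
  proof (intro exI[of _ d] conjI ballI impI)
    fix s assume s: "s \<in> T" "\<bar>s - t\<bar> < d"
    then show "h (\<sigma> s) - h (\<sigma> t) = f (\<eta> s) - f (\<eta> t)"
      unfolding eq[OF s(1)] eq[OF t] using \<sigma>(2) by (intro e(2) d(2)) auto
  qed fact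
qed

text \<open>The difference of \<open>h\<close> and \<open>f\<close> along the curve is locally
  constant on an interval, hence constant.\<close>

lemma primitive_along_increment:
  assumes h: "primitive_along F \<gamma> S h" and ab: "a \<le> b" "{a..b} \<subseteq> S"
    and U: "(U, f) \<in> F" "\<gamma> ` {a..b} \<subseteq> U"
  shows "h b - h a = f (\<gamma> b) - f (\<gamma> a)"
proof -
  have "h a - f (\<gamma> a) = h b - f (\<gamma> b)"
  proof (rule connected_local_const[of "{a..b}" a b "\<lambda>t. h t - f (\<gamma> t)"])
    show "\<forall>t\<in>{a..b}. \<forall>\<^sub>F s in at t within {a..b}. h t - f (\<gamma> t) = h s - f (\<gamma> s)"
    proof
      fix t assume t: "t \<in> {a..b}"
      obtain e where e: "0 < e" "\<And>s. s \<in> S \<Longrightarrow> \<bar>s - t\<bar> < e \<Longrightarrow> h s - h t = f (\<gamma> s) - f (\<gamma> t)"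
        by (rule primitive_alongE[OF h _ U(1), of t]) (use t ab U in auto)
      show "\<forall>\<^sub>F s in at t within {a..b}. h t - f (\<gamma> t) = h s - f (\<gamma> s)"
        unfolding eventually_at dist_real_def
      proof (intro exI[of _ e] conjI ballI impI)
        fix s assume "s \<in> {a..b}" "s \<noteq> t \<and> \<bar>s - t\<bar> < e"
        then have "h s - h t = f (\<gamma> s) - f (\<gamma> t)" using ab by (intro e) auto
        then show "h t - f (\<gamma> t) = h s - f (\<gamma> s)" by simp
      qed fact
    qed
  qed (use ab in auto)
  then show ?thesis by simp
qed

text \<open>The sum over a subdivision telescopes in \<open>h\<close>. Hence the value does not
  depend on the subdivision, and the description in \<open>path_integral\<close> is unique.\<close>

lemma has_path_integral_eq_increment:
  assumes "has_path_integral F \<gamma> r" and h: "primitive_along F \<gamma> {0..1} h"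
  shows "r = h 1 - h 0"
proof -
  obtain n t U f where t: "t 0 = 0" "t n = 1"
    and *: "\<And>i. i < n \<Longrightarrow> t i < t (Suc i) \<and> (U i, f i) \<in> F \<and> \<gamma> ` {t i..t (Suc i)} \<subseteq> U i"
    and r: "r = (\<Sum>i<n. f i (\<gamma> (t (Suc i))) - f i (\<gamma> (t i)))"
    using assms(1) unfolding has_path_integral_def by blast
  have mono: "t i \<le> t j" if "i \<le> j" "j \<le> n" for i j
    using that
  proof (induction j rule: dec_induct)
    case (step m)
    then show ?case using *[of m] by simp
  qed simp
  have "f i (\<gamma> (t (Suc i))) - f i (\<gamma> (t i)) = h (t (Suc i)) - h (t i)" if i: "i < n" for i
  proof (rule primitive_along_increment[symmetric, OF h])
    show "{t i..t (Suc i)} \<subseteq> {0..1}"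
      using mono[of 0 i] mono[of "Suc i" n] i t by auto
  qed (use *[OF i] in auto)
  then have "r = (\<Sum>i<n. h (t (Suc i)) - h (t i))" unfolding r by (intro sum.cong) auto
  also have "\<dots> = h (t n) - h (t 0)" by (rule sum_lessThan_telescope)
  finally show ?thesis using t by simp
qed

lemma primitive_along_of_member:
  assumes F: "closed_top_form F" and \<gamma>: "continuous_on S \<gamma>"
    and U: "(U, f) \<in> F" "\<gamma> ` S \<subseteq> U"
  shows "primitive_along F \<gamma> S (\<lambda>t. f (\<gamma> t))"
proof (rule primitive_alongI)
  fix t V g assume t: "t \<in> S" and V: "(V, g) \<in> F" "\<gamma> t \<in> V"
  obtain W where W: "open W" "\<gamma> t \<in> W" "\<And>q. q \<in> W \<Longrightarrow> f q - f (\<gamma> t) = g q - g (\<gamma> t)"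
    by (rule closed_top_form_locally_const[OF F U(1) V(1), of "\<gamma> t"]) (use U V t in auto)
  obtain e where "0 < e" "\<And>s. s \<in> S \<Longrightarrow> \<bar>s - t\<bar> < e \<Longrightarrow> \<gamma> s \<in> W"
  proof -
    have "\<forall>\<^sub>F s in at t within S. \<gamma> s \<in> W"
      using \<gamma> t W(1,2) unfolding continuous_on_def by (blast intro: topological_tendstoD)
    then obtain e where "0 < e" "\<And>s. s \<in> S \<Longrightarrow> s \<noteq> t \<Longrightarrow> \<bar>s - t\<bar> < e \<Longrightarrow> \<gamma> s \<in> W"
      unfolding eventually_at dist_real_def by blast
    then show thesis using W(2) by (intro that[of e]) auto
  qed
  then show "\<exists>e>0. \<forall>s\<in>S. \<bar>s - t\<bar> < e \<longrightarrow> f (\<gamma> s) - f (\<gamma> t) = g (\<gamma> s) - g (\<gamma> t)"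
    using W(3) by blast
qed

text \<open>Primitives along a path are free up to a constant, which is chosen so that the pieces
  match at \<open>b\<close>.\<close>

lemma primitive_along_join:
  assumes h: "primitive_along F \<gamma> {a..b} h" and k: "primitive_along F \<gamma> {b..c} k"
    and ab: "a \<le> b" "b \<le> c"
  shows "primitive_along F \<gamma> {a..c} (\<lambda>s. if s \<le> b then h s else k s - k b + h b)" (is "primitive_along _ _ _ ?l")
proof (rule primitive_alongI)
  fix t U f assume t: "t \<in> {a..c}" and U: "(U, f) \<in> F" "\<gamma> t \<in> U"
  have left: "\<exists>e>0. \<forall>s\<in>{a..b}. \<bar>s - t\<bar> < e \<longrightarrow> h s - h t = f (\<gamma> s) - f (\<gamma> t)" if "t \<le> b"
    using primitive_alongE[OF h _ U] t that by (metis atLeastAtMost_iff)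
  have right: "\<exists>e>0. \<forall>s\<in>{b..c}. \<bar>s - t\<bar> < e \<longrightarrow> k s - k t = f (\<gamma> s) - f (\<gamma> t)" if "b \<le> t"
    using primitive_alongE[OF k _ U] t that by (metis atLeastAtMost_iff)
  consider "t < b" | "t = b" | "b < t" by linarith
  then show "\<exists>e>0. \<forall>s\<in>{a..c}. \<bar>s - t\<bar> < e \<longrightarrow> ?l s - ?l t = f (\<gamma> s) - f (\<gamma> t)"
  proof cases
    case 1
    then obtain e where e: "e > 0" "\<forall>s\<in>{a..b}. \<bar>s - t\<bar> < e \<longrightarrow> h s - h t = f (\<gamma> s) - f (\<gamma> t)"
      using left by auto
    then show ?thesis using 1 by (intro exI[of _ "min e (b - t)"]) auto
  next
    case 2
    then obtain e d where "e > 0" "\<forall>s\<in>{a..b}. \<bar>s - t\<bar> < e \<longrightarrow> h s - h t = f (\<gamma> s) - f (\<gamma> t)"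
      "d > 0" "\<forall>s\<in>{b..c}. \<bar>s - t\<bar> < d \<longrightarrow> k s - k t = f (\<gamma> s) - f (\<gamma> t)"
      using left right by auto
    then show ?thesis using 2 by (intro exI[of _ "min e d"]) auto
  next
    case 3
    then obtain e where e: "e > 0" "\<forall>s\<in>{b..c}. \<bar>s - t\<bar> < e \<longrightarrow> k s - k t = f (\<gamma> s) - f (\<gamma> t)"
      using right by auto
    then show ?thesis using 3 by (intro exI[of _ "min e (t - b)"]) auto
  qed
qed

lemma path_near_in_member:
  assumes F: "closed_top_form F" and \<gamma>: "path \<gamma>" and x: "x \<in> {0..1}"
  obtains U f d where "(U, f) \<in> F" "0 < d" "\<And>s. s \<in> {0..1} \<Longrightarrow> \<bar>s - x\<bar> < d \<Longrightarrow> \<gamma> s \<in> U"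
proof -
  obtain U f where U: "(U, f) \<in> F" "\<gamma> x \<in> U" by (rule closed_top_form_cover[OF F])
  have "\<forall>\<^sub>F s in at x within {0..1}. \<gamma> s \<in> U"
    using \<gamma> x U closed_top_formD(1)[OF F] unfolding path_def continuous_on_def
    by (blast intro: topological_tendstoD)
  then obtain d where "0 < d" "\<And>s. s \<in> {0..1} \<Longrightarrow> s \<noteq> x \<Longrightarrow> \<bar>s - x\<bar> < d \<Longrightarrow> \<gamma> s \<in> U"
    unfolding eventually_at dist_real_def by blast
  then show thesis using U by (intro that[of U f d]) auto
qed

text \<open>On a short interval the path stays in one member of the form, whose function serves;
  bisection passes from short intervals to the whole one.\<close>

lemma primitive_along_exists:
  assumes F: "closed_top_form F" and \<gamma>: "path \<gamma>"
  obtains h where "primitive_along F \<gamma> {0..1} h"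
proof -
  have "0 \<le> (0::real) \<and> 1 \<le> (1::real) \<longrightarrow> (\<exists>h. primitive_along F \<gamma> {0..1} h)"
  proof (rule Bolzano[where P = "\<lambda>a b. 0 \<le> a \<and> b \<le> 1 \<longrightarrow> (\<exists>h. primitive_along F \<gamma> {a..b} h)"])
    fix a b c :: real
    assume "0 \<le> a \<and> b \<le> 1 \<longrightarrow> (\<exists>h. primitive_along F \<gamma> {a..b} h)"
      "0 \<le> b \<and> c \<le> 1 \<longrightarrow> (\<exists>h. primitive_along F \<gamma> {b..c} h)" "a \<le> b" "b \<le> c"
    then show "0 \<le> a \<and> c \<le> 1 \<longrightarrow> (\<exists>h. primitive_along F \<gamma> {a..c} h)"
      using primitive_along_join[of F \<gamma> a b _ c] by fastforce
  next
    fix x :: real assume x: "0 \<le> x" "x \<le> 1"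
    obtain U f d where d: "(U, f) \<in> F" "0 < d" "\<And>s. s \<in> {0..1} \<Longrightarrow> \<bar>s - x\<bar> < d \<Longrightarrow> \<gamma> s \<in> U"
      by (rule path_near_in_member[OF F \<gamma>, of x]) (use x in auto)
    have "\<exists>h. primitive_along F \<gamma> {a..b} h" if "a \<le> x \<and> x \<le> b \<and> b - a < d" "0 \<le> a \<and> b \<le> 1" for a b
    proof -
      have "continuous_on {a..b} \<gamma>"
        using \<gamma> that unfolding path_def by (auto elim: continuous_on_subset)
      moreover have "\<gamma> ` {a..b} \<subseteq> U"
        using that by (auto intro!: d(3))
      ultimately show ?thesis using primitive_along_of_member[OF F _ d(1)] by blast
    qed
    then show "\<exists>d>0. \<forall>a b. a \<le> x \<and> x \<le> b \<and> b - a < d \<longrightarrow>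
        0 \<le> a \<and> b \<le> 1 \<longrightarrow> (\<exists>h. primitive_along F \<gamma> {a..b} h)"
      using d(2) by blast
  qed simp
  then show thesis using that by auto
qed

lemma has_path_integral_exists:
  assumes F: "closed_top_form F" and \<gamma>: "path \<gamma>"
  shows "\<exists>r. has_path_integral F \<gamma> r"
proof -
  let ?P = "\<lambda>a b n t U f. t 0 = a \<and> t n = b \<and>
      (\<forall>i<n. t i < t (Suc i) \<and> (U i, f i) \<in> F \<and> \<gamma> ` {t i..t (Suc i)} \<subseteq> U i)"
  let ?Q = "\<lambda>a b. \<exists>n t U f. ?P a b n t U f"
  have "0 \<le> (0::real) \<and> 1 \<le> (1::real) \<longrightarrow> ?Q 0 1"
  proof (rule Bolzano[where P = "\<lambda>a b. 0 \<le> a \<and> b \<le> 1 \<longrightarrow> ?Q a b"])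
    fix a b c :: real
    assume 1: "0 \<le> a \<and> b \<le> 1 \<longrightarrow> ?Q a b" and 2: "0 \<le> b \<and> c \<le> 1 \<longrightarrow> ?Q b c" and ab: "a \<le> b" "b \<le> c"
    show "0 \<le> a \<and> c \<le> 1 \<longrightarrow> ?Q a c"
    proof
      assume ac: "0 \<le> a \<and> c \<le> 1"
      then obtain n t U f where P: "?P a b n t U f" using 1 ab by auto
      obtain n' t' U' f' where P': "?P b c n' t' U' f'" using 2 ab ac by auto
      \<comment> \<open>Concatenation of the subdivisions. Index \<open>n\<close> is read from the
        first one, and both have the value \<open>b\<close> there.\<close>
      have "?P a c (n + n') (\<lambda>i. if i \<le> n then t i else t' (i - n))
          (\<lambda>i. if i < n then U i else U' (i - n)) (\<lambda>i. if i < n then f i else f' (i - n))"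
      proof (intro conjI allI impI)
        fix i assume i: "i < n + n'"
        define j where "j = i - n"
        consider "i < n" | "i \<ge> n" "i = n + j" "j < n'" using i unfolding j_def by linarith
        then have "(if i \<le> n then t i else t' (i - n)) < (if Suc i \<le> n then t (Suc i) else t' (Suc i - n)) \<and>
          (if i < n then U i else U' (i - n), if i < n then f i else f' (i - n)) \<in> F \<and>
          \<gamma> ` {if i \<le> n then t i else t' (i - n)..if Suc i \<le> n then t (Suc i) else t' (Suc i - n)}
            \<subseteq> (if i < n then U i else U' (i - n))"
        proof cases
          case 1
          then show ?thesis using P by simp
        next
          case 2
          then have "(if i \<le> n then t i else t' (i - n)) = t' j" "Suc i - n = Suc j" "\<not> Suc i \<le> n"
            using P P' by auto
          then show ?thesis using 2 P' by simp
        qed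
        then show "(if i \<le> n then t i else t' (i - n)) < (if Suc i \<le> n then t (Suc i) else t' (Suc i - n))"
          "(if i < n then U i else U' (i - n), if i < n then f i else f' (i - n)) \<in> F"
          "\<gamma> ` {if i \<le> n then t i else t' (i - n)..if Suc i \<le> n then t (Suc i) else t' (Suc i - n)}
            \<subseteq> (if i < n then U i else U' (i - n))" by blast+
      qed (use P P' in auto)
      then show "?Q a c" by (intro exI)
    qed
  next
    fix x :: real assume x: "0 \<le> x" "x \<le> 1"
    obtain U f d where d: "(U, f) \<in> F" "0 < d" "\<And>s. s \<in> {0..1} \<Longrightarrow> \<bar>s - x\<bar> < d \<Longrightarrow> \<gamma> s \<in> U"
      by (rule path_near_in_member[OF F \<gamma>, of x]) (use x in auto)
    have "?Q a b" if ab: "a \<le> x \<and> x \<le> b \<and> b - a < d" "0 \<le> a \<and> b \<le> 1" for a b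
    proof (cases "a = b")
      case True
      \<comment> \<open>The empty subdivision: steps are strictly increasing, so a degenerate
        interval admits no step.\<close>
      then show ?thesis by (intro exI[of _ 0] exI[of _ "\<lambda>_. a"]) auto
    next
      case False
      have "\<gamma> ` {a..b} \<subseteq> U" using ab by (auto intro!: d(3))
      then show ?thesis
        using False ab d(1)
        by (intro exI[of _ 1] exI[of _ "\<lambda>i. if i = 0 then a else b"] exI[of _ "\<lambda>_. U"] exI[of _ "\<lambda>_. f"]) auto
    qed
    then show "\<exists>d>0. \<forall>a b. a \<le> x \<and> x \<le> b \<and> b - a < d \<longrightarrow> 0 \<le> a \<and> b \<le> 1 \<longrightarrow> ?Q a b"
      using d(2) by blast
  qed simp
  then obtain n t U f where "?P 0 1 n t U f" by auto
  then show ?thesis unfolding has_path_integral_def by blast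
qed

lemma path_integral_eq_increment:
  assumes F: "closed_top_form F" and \<gamma>: "path \<gamma>" and h: "primitive_along F \<gamma> {0..1} h"
  shows "path_integral F \<gamma> = h 1 - h 0"
  unfolding path_integral_def
proof (rule the_equality)
  show "has_path_integral F \<gamma> (h 1 - h 0)"
    using has_path_integral_exists[OF F \<gamma>] has_path_integral_eq_increment[OF _ h] by metis
qed (rule has_path_integral_eq_increment[OF _ h])

lemma path_integral_join:
  assumes F: "closed_top_form F" and g: "path g1" "path g2" "pathfinish g1 = pathstart g2"
  shows "path_integral F (g1 +++ g2) = path_integral F g1 + path_integral F g2"
proof -
  have p: "path (g1 +++ g2)" using g by simp
  obtain h where h: "primitive_along F (g1 +++ g2) {0..1} h" by (rule primitive_along_exists[OF F p])
  have "primitive_along F g1 {0..1} (\<lambda>t. h (t / 2))"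
    by (rule primitive_along_reparam[OF h]) (auto intro!: continuous_intros simp: joinpaths_def)
  then have 1: "path_integral F g1 = h (1 / 2) - h 0"
    using path_integral_eq_increment[OF F g(1)] by fastforce
  have "primitive_along F g2 {0..1} (\<lambda>t. h ((t + 1) / 2))"
    by (rule primitive_along_reparam[OF h])
      (use g(3) in \<open>auto intro!: continuous_intros simp: joinpaths_def pathfinish_def pathstart_def add_divide_distrib\<close>)
  then have 2: "path_integral F g2 = h 1 - h (1 / 2)"
    using path_integral_eq_increment[OF F g(2)] by fastforce
  show ?thesis using path_integral_eq_increment[OF F p h] 1 2 by simp
qed

lemma path_integral_reversepath:
  assumes F: "closed_top_form F" and g: "path g"
  shows "path_integral F (reversepath g) = - path_integral F g"
proof -
  obtain h where h: "primitive_along F g {0..1} h" by (rule primitive_along_exists[OF F g])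
  have "primitive_along F (reversepath g) {0..1} (\<lambda>t. h (1 - t))"
    by (rule primitive_along_reparam[OF h]) (auto intro!: continuous_intros simp: reversepath_def)
  then have "path_integral F (reversepath g) = h 0 - h 1"
    using path_integral_eq_increment[OF F, of "reversepath g"] g by fastforce
  then show ?thesis using path_integral_eq_increment[OF F g h] by simp
qed

lemma path_integral_in_member:
  assumes F: "closed_top_form F" and g: "path g" and U: "(U, f) \<in> F" "path_image g \<subseteq> U"
  shows "path_integral F g = f (pathfinish g) - f (pathstart g)"
  using path_integral_eq_increment[OF F g primitive_along_of_member[OF F _ U(1)]] g U(2)
  by (simp add: path_def path_image_def pathfinish_def pathstart_def)

text \<open>
  Cohomologous forms have the same integrals over loops, so the difference of their integrals over
  a path depends on the end points only; these vary in a compact space.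
\<close>

lemma cohomologous_path_integrals_bounded:
  fixes F G :: "'a::topological_space top_form"
  assumes F: "closed_top_form F" and G: "closed_top_form G" and FG: "cohom_class F = cohom_class G"
    and compact: "compact (UNIV :: 'a set)"
    and lpc: "\<And>(U :: 'a set) p. open U \<Longrightarrow> p \<in> U \<Longrightarrow> \<exists>W. open W \<and> p \<in> W \<and> W \<subseteq> U \<and> path_connected W"
  obtains C where "\<And>\<gamma>. path \<gamma> \<Longrightarrow> \<bar>path_integral F \<gamma> - path_integral G \<gamma>\<bar> \<le> C"
proof -
  define D where "D \<gamma> = path_integral F \<gamma> - path_integral G \<gamma>" for \<gamma>
  have D_join: "D (g1 +++ g2) = D g1 + D g2" if "path g1" "path g2" "pathfinish g1 = pathstart g2" for g1 g2
    using that by (simp add: D_def path_integral_join[OF F] path_integral_join[OF G])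
  have D_loop: "D g = 0" if "path g" "pathfinish g = pathstart g" for g
    using fun_cong[OF FG, of g] that by (simp add: cohom_class_def D_def)
  have D_eq: "D g1 = D g2" if "path g1" "path g2" "pathstart g1 = pathstart g2" "pathfinish g1 = pathfinish g2" for g1 g2
  proof -
    have "D (g1 +++ reversepath g2) = D g1 - D g2"
      using that D_join[of g1 "reversepath g2"]
      by (simp add: D_def path_integral_reversepath[OF F] path_integral_reversepath[OF G])
    moreover have "D (g1 +++ reversepath g2) = 0" using that by (intro D_loop) auto
    ultimately show ?thesis by simp
  qed
  \<comment> \<open>Near \<open>p\<close> a local function differs from its value at
    \<open>p\<close> by less than 1, so each of the two integrals is at most 2 in absolute value;
    hence the 4.\<close>
  have small: "\<exists>W. open W \<and> p \<in> W \<and> path_connected W \<and> (\<forall>g. path g \<longrightarrow> path_image g \<subseteq> W \<longrightarrow> \<bar>D g\<bar> \<le> 4)" for p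
  proof -
    have near: "\<exists>V. open V \<and> p \<in> V \<and> (\<forall>g. path g \<longrightarrow> path_image g \<subseteq> V \<longrightarrow> \<bar>path_integral F g\<bar> \<le> 2)"
      if F: "closed_top_form F" for F
    proof -
      obtain U f where U: "(U, f) \<in> F" "p \<in> U" by (rule closed_top_form_cover[OF F])
      note Uo = closed_top_formD[OF F U(1)]
      define V where "V = f -` ball (f p) 1 \<inter> U"
      have "open V" unfolding V_def
        using continuous_on_open_vimage[OF Uo(1)] Uo(2) by blast
      moreover have "\<bar>path_integral F g\<bar> \<le> 2" if g: "path g" "path_image g \<subseteq> V" for g
      proof -
        have "pathfinish g \<in> V" "pathstart g \<in> V" using g by auto
        then have "\<bar>f p - f (pathfinish g)\<bar> < 1" "\<bar>f p - f (pathstart g)\<bar> < 1"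
          by (auto simp: V_def dist_real_def)
        moreover have "path_integral F g = f (pathfinish g) - f (pathstart g)"
          using g by (intro path_integral_in_member[OF F _ U(1)]) (auto simp: V_def)
        ultimately show ?thesis by linarith
      qed
      ultimately show ?thesis using U(2) by (intro exI[of _ V]) (auto simp: V_def)
    qed
    obtain V where V: "open V" "p \<in> V" "\<And>g. path g \<Longrightarrow> path_image g \<subseteq> V \<Longrightarrow> \<bar>path_integral F g\<bar> \<le> 2"
      using near[OF F] by blast
    obtain V' where V': "open V'" "p \<in> V'" "\<And>g. path g \<Longrightarrow> path_image g \<subseteq> V' \<Longrightarrow> \<bar>path_integral G g\<bar> \<le> 2"
      using near[OF G] by blast
    obtain W where W: "open W" "p \<in> W" "W \<subseteq> V \<inter> V'" "path_connected W"
      using lpc[of "V \<inter> V'" p] V V' by blast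
    have "\<bar>D g\<bar> \<le> 4" if "path g" "path_image g \<subseteq> W" for g
      using V(3)[of g] V'(3)[of g] that W(3) unfolding D_def by fastforce
    then show ?thesis using W by blast
  qed
  define W where "W p = (SOME W. open W \<and> p \<in> W \<and> path_connected W \<and> (\<forall>g. path g \<longrightarrow> path_image g \<subseteq> W \<longrightarrow> \<bar>D g\<bar> \<le> 4))" for p
  have W: "open (W p)" "p \<in> W p" "path_connected (W p)" "\<And>g. path g \<Longrightarrow> path_image g \<subseteq> W p \<Longrightarrow> \<bar>D g\<bar> \<le> 4" for p
    using someI_ex[OF small[of p]] unfolding W_def by blast+
  obtain P where P: "finite P" "UNIV \<subseteq> (\<Union>p\<in>P. W p)"
    by (rule compactE_image[OF compact, of UNIV W]) (use W in auto)
  \<comment> \<open>Reference paths between the finitely many centres. In a disconnected space some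
    pairs have none; the value is then arbitrary and can only enlarge \<open>C\<close>.\<close>
  define \<delta> where "\<delta> p q = (SOME g. path g \<and> pathstart g = p \<and> pathfinish g = q)" for p q :: 'a
  \<comment> \<open>The 8 pays for the two short paths that join the end points to their
    centres.\<close>
  define C where "C = 8 + (\<Sum>z\<in>P \<times> P. \<bar>D (\<delta> (fst z) (snd z))\<bar>)"
  show thesis
  proof
    fix \<gamma> :: "real \<Rightarrow> 'a" assume \<gamma>: "path \<gamma>"
    obtain p where p: "p \<in> P" "pathstart \<gamma> \<in> W p" using P by blast
    obtain q where q: "q \<in> P" "pathfinish \<gamma> \<in> W q" using P by blast
    obtain \<alpha> where \<alpha>: "path \<alpha>" "path_image \<alpha> \<subseteq> W p" "pathstart \<alpha> = p" "pathfinish \<alpha> = pathstart \<gamma>"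
      using W(3)[of p] W(2)[of p] p(2) unfolding path_connected_def by blast
    obtain \<beta> where \<beta>: "path \<beta>" "path_image \<beta> \<subseteq> W q" "pathstart \<beta> = pathfinish \<gamma>" "pathfinish \<beta> = q"
      using W(3)[of q] W(2)[of q] q(2) unfolding path_connected_def by blast
    let ?J = "\<alpha> +++ (\<gamma> +++ \<beta>)"
    have J: "path ?J" "pathstart ?J = p" "pathfinish ?J = q" using \<alpha> \<beta> \<gamma> by auto
    then have "\<exists>g. path g \<and> pathstart g = p \<and> pathfinish g = q" by blast
    then have \<delta>: "path (\<delta> p q) \<and> pathstart (\<delta> p q) = p \<and> pathfinish (\<delta> p q) = q"
      unfolding \<delta>_def by (rule someI_ex)
    have "D \<alpha> + (D \<gamma> + D \<beta>) = D ?J" using \<alpha> \<beta> \<gamma> by (simp add: D_join)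
    also have "\<dots> = D (\<delta> p q)" using J \<delta> by (intro D_eq) auto
    finally have "\<bar>D \<gamma>\<bar> \<le> 8 + \<bar>D (\<delta> p q)\<bar>"
      using W(4)[OF \<alpha>(1,2)] W(4)[OF \<beta>(1,2)] by linarith
    also have "\<bar>D (\<delta> p q)\<bar> \<le> (\<Sum>z\<in>P \<times> P. \<bar>D (\<delta> (fst z) (snd z))\<bar>)"
      using member_le_sum[of "(p, q)" "P \<times> P" "\<lambda>z. \<bar>D (\<delta> (fst z) (snd z))\<bar>"] p q P by simp
    finally show "\<bar>path_integral F \<gamma> - path_integral G \<gamma>\<bar> \<le> C" by (simp add: D_def C_def)
  qed
qed

section \<open>Returning orbits of dissipative flows\<close>

text \<open>The manifold is forgotten; a continuous flow and the rate at which the form decreases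
  along it remain. Zeros are invariant for times of either sign, so the axioms survive time
  reversal, and results on the futures of orbits hold for their pasts as well.\<close>

locale dissipative_flow =
  fixes \<psi> :: "real \<Rightarrow> 'a::{t2_space, second_countable_topology} \<Rightarrow> 'a" and g :: "'a \<Rightarrow> real"
  assumes compact_space: "compact (UNIV :: 'a set)"
    and continuous_flow: "continuous_on UNIV (\<lambda>(t, p). \<psi> t p)"
    and flow_zero: "\<psi> 0 p = p"
    and flow_plus: "\<psi> (s + t) p = \<psi> s (\<psi> t p)"
    and continuous_rate: "continuous_on UNIV g"
    and rate_nonneg: "0 \<le> g p"
    and rate_invariant: "g p = 0 \<Longrightarrow> g (\<psi> t p) = 0"
begin

text \<open>This is the integral of the rate along the orbit from time 0 to \<open>t\<close>, with a
  minus sign for negative times.\<close>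

definition loss :: "real \<Rightarrow> 'a \<Rightarrow> real" where
  "loss t p = t * integral {0..1} (\<lambda>u. g (\<psi> (u * t) p))"

lemma continuous_on_flow:
  assumes "continuous_on S a" "continuous_on S b"
  shows "continuous_on S (\<lambda>x. \<psi> (a x) (b x))"
  using continuous_on_compose2[OF continuous_flow continuous_on_Pair[OF assms]] by simp

lemma continuous_on_rate:
  assumes "continuous_on S b"
  shows "continuous_on S (\<lambda>x. g (b x))"
  by (rule continuous_on_compose2[OF continuous_rate assms]) simp

lemma flow_minus: "\<psi> (- t) (\<psi> t p) = p" "\<psi> t (\<psi> (- t) p) = p"
  using flow_plus[of "- t" t p] flow_plus[of t "- t" p] by (simp_all add: flow_zero)

lemma rate_pos_flow: "0 < g p \<Longrightarrow> 0 < g (\<psi> t p)"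
  using rate_invariant[of "\<psi> t p" "- t"] rate_nonneg[of "\<psi> t p"] by (auto simp: flow_minus order_less_le)

lemma loss_has_derivative: "((\<lambda>t. loss t p) has_real_derivative g (\<psi> t p)) (at t)"
proof -
  have "continuous_on UNIV (\<lambda>t. g (\<psi> t p))"
    by (intro continuous_on_rate continuous_on_flow continuous_intros)
  from scaled_integral_has_vector_derivative[OF this, of t] show ?thesis
    by (simp add: loss_def has_real_derivative_iff_has_vector_derivative)
qed

lemma continuous_on_loss:
  assumes "continuous_on S a" "continuous_on S b"
  shows "continuous_on S (\<lambda>x. loss (a x) (b x))"
proof -
  have "continuous_on UNIV (\<lambda>z. integral (cbox 0 1) (\<lambda>u. g (\<psi> (u * fst z) (snd z))))"
    by (rule integral_continuous_on_param)
      (auto simp: split_beta intro!: continuous_on_rate continuous_on_flow continuous_intros)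
  then have "continuous_on UNIV (\<lambda>z. loss (fst z) (snd z))"
    unfolding loss_def by (auto intro!: continuous_intros)
  from continuous_on_compose2[OF this continuous_on_Pair[OF assms]] show ?thesis by simp
qed

lemma loss_0: "loss 0 p = 0"
  by (simp add: loss_def)

lemma loss_plus: "loss (s + t) p = loss s (\<psi> t p) + loss t p"
proof -
  have "((\<lambda>s. loss (s + t) p - loss s (\<psi> t p)) has_real_derivative 0) (at s)" for s
  proof -
    have "((\<lambda>s. loss (s + t) p) has_real_derivative g (\<psi> (s + t) p)) (at s)"
      using loss_has_derivative[of p "s + t"] by (simp add: DERIV_shift)
    from DERIV_diff[OF this loss_has_derivative[of "\<psi> t p" s]] show ?thesis by (simp add: flow_plus)
  qed
  from DERIV_isconst_all[of "\<lambda>s. loss (s + t) p - loss s (\<psi> t p)" s 0] this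
  show ?thesis by (simp add: loss_0)
qed

lemma loss_mono: "s \<le> t \<Longrightarrow> loss s p \<le> loss t p"
  by (rule DERIV_nonneg_imp_nondecreasing) (use loss_has_derivative rate_nonneg in auto)

lemma loss_nonneg: "0 \<le> t \<Longrightarrow> 0 \<le> loss t p"
  using loss_mono[of 0 t p] by (simp add: loss_0)

lemma loss_pos:
  assumes "0 < g p" "0 < t"
  shows "0 < loss t p"
proof -
  obtain d where d: "0 < d" "\<And>h. 0 < h \<Longrightarrow> h < d \<Longrightarrow> loss 0 p < loss (0 + h) p"
    using DERIV_pos_inc_right[OF loss_has_derivative[of p 0]] assms by (auto simp: flow_zero)
  have "0 < loss (min t (d / 2)) p" using d(2)[of "min t (d / 2)"] d(1) assms by (simp add: loss_0)
  also have "\<dots> \<le> loss t p" by (rule loss_mono) simp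
  finally show ?thesis .
qed

lemma reverse: "dissipative_flow (\<lambda>t. \<psi> (- t)) g"
proof
  show "continuous_on UNIV (\<lambda>(t, p). \<psi> (- t) p)"
    unfolding split_beta by (intro continuous_on_flow continuous_intros)
  show "\<psi> (- (s + t)) p = \<psi> (- s) (\<psi> (- t) p)" for s t p
    using flow_plus[of "- s" "- t" p] by simp
qed (use compact_space flow_zero continuous_rate rate_nonneg rate_invariant in auto)

lemma loss_reverse: "dissipative_flow.loss (\<lambda>t. \<psi> (- t)) g t p = - loss (- t) p"
proof -
  interpret rev: dissipative_flow "\<lambda>t. \<psi> (- t)" g by (rule reverse)
  show ?thesis by (simp add: rev.loss_def loss_def)
qed

lemma rate_bounded_below:
  assumes "closed K" "\<And>p. p \<in> K \<Longrightarrow> 0 < g p"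
  obtains c where "0 < c" "\<And>p. p \<in> K \<Longrightarrow> c \<le> g p"
proof (cases "K = {}")
  case False
  have "compact K" using compact_Int_closed[OF compact_space assms(1)] by simp
  then obtain q where "q \<in> K" "\<And>p. p \<in> K \<Longrightarrow> g q \<le> g p"
    using continuous_attains_inf[OF _ False continuous_on_subset[OF continuous_rate]] by blast
  then show ?thesis using assms that by blast
qed (use that[of 1] in auto)

text \<open>Outside \<open>V\<close> the loss in a unit of time is bounded below, so the total loss would be infinite.\<close>

lemma eventually_in_neighbourhood:
  assumes bound: "\<And>t. 0 \<le> t \<Longrightarrow> loss t x \<le> N"
    and V: "open V" "\<And>p. g p = 0 \<Longrightarrow> p \<in> V"
  obtains T where "0 \<le> T" "\<And>t. T \<le> t \<Longrightarrow> \<psi> t x \<in> V"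
proof -
  \<comment> \<open>The loss in unit time is bounded below rather than the rate: being outside
    \<open>V\<close> at a single instant then already costs the amount \<open>d\<close>.\<close>
  have pos: "0 < loss 1 p" if "p \<in> - V" for p
    using loss_pos[of p 1] rate_nonneg[of p] V(2)[of p] that by (auto simp: order_less_le)
  obtain d where d: "0 < d" "\<And>p. p \<in> - V \<Longrightarrow> d \<le> loss 1 p"
  proof (cases "- V = {}")
    case False
    have "closed (- V)" using V(1) by (simp add: closed_Compl)
    then have "compact (- V)" using compact_Int_closed[OF compact_space, of "- V"] by simp
    moreover have "continuous_on (- V) (loss 1)"
      using continuous_on_loss[of "- V" "\<lambda>_. 1" "\<lambda>p. p"] by (simp add: continuous_on_id)
    ultimately obtain q where "q \<in> - V" "\<And>p. p \<in> - V \<Longrightarrow> loss 1 q \<le> loss 1 p"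
      using continuous_attains_inf[OF _ False] by blast
    then show ?thesis using pos that by blast
  qed (use that[of 1] in auto)
  define S where "S = (SUP t\<in>{0..}. loss t x)"
  have bdd: "bdd_above ((\<lambda>t. loss t x) ` {0..})" unfolding bdd_above_def using bound by auto
  have S: "loss t x \<le> S" if "0 \<le> t" for t
    unfolding S_def using bdd that by (intro cSUP_upper) auto
  have "\<exists>t\<in>{0..}. S - d < loss t x"
    using less_cSUP_iff[of "{0..}" "\<lambda>t. loss t x" "S - d"] bdd d(1) unfolding S_def by auto
  \<comment> \<open>From time \<open>T\<close> on, less than \<open>d\<close> is left to be
    lost.\<close>
  then obtain T where T: "0 \<le> T" "S - d < loss T x" by auto
  show thesis
  proof
    fix t assume t: "T \<le> t"
    have "loss 1 (\<psi> t x) = loss (1 + t) x - loss t x" by (simp add: loss_plus)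
    also have "\<dots> < d" using S[of "1 + t"] loss_mono[OF t, of x] T t by simp
    finally show "\<psi> t x \<in> V" using d(2)[of "\<psi> t x"] by force
  qed fact
qed

section \<open>Limits of returning orbits\<close>

lemma first_exit:
  assumes V: "open V" and q: "q \<in> V" and s: "0 \<le> s" "\<psi> s q \<notin> V"
  obtains r where "0 < r" "r \<le> s" "\<psi> r q \<notin> V" "\<And>t. 0 \<le> t \<Longrightarrow> t < r \<Longrightarrow> \<psi> t q \<in> V"
proof -
  have cont: "continuous_on UNIV (\<lambda>t. \<psi> t q)" by (intro continuous_on_flow continuous_intros)
  have "closed ((\<lambda>t. \<psi> t q) -` (- V))"
    by (rule closed_vimage) (use V cont in auto)
  then have "compact ({0..s} \<inter> (\<lambda>t. \<psi> t q) -` (- V))" by (intro compact_Int_closed) auto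
  moreover have in_s: "s \<in> {0..s} \<inter> (\<lambda>t. \<psi> t q) -` (- V)" using s by simp
  ultimately obtain r where r: "r \<in> {0..s} \<inter> (\<lambda>t. \<psi> t q) -` (- V)"
    "\<And>t. t \<in> {0..s} \<inter> (\<lambda>t. \<psi> t q) -` (- V) \<Longrightarrow> r \<le> t"
    using compact_attains_inf[of "{0..s} \<inter> (\<lambda>t. \<psi> t q) -` (- V)"] by (metis empty_iff in_s)
  have "r \<noteq> 0" using r(1) q by (auto simp: flow_zero)
  moreover have "\<psi> t q \<in> V" if "0 \<le> t" "t < r" for t
    using r(2)[of t] r(1) that by fastforce
  ultimately show thesis using r(1) that[of r] by auto
qed

text \<open>Otherwise the times would accumulate at a finite \<open>l\<close>, and the orbit of
  \<open>x\<close> would be at a zero at time \<open>l\<close>, against the invariance of the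
  zeros.\<close>

lemma escape_times_unbounded:
  assumes x: "X \<longlonglongrightarrow> x" "0 < g x" and u: "(\<lambda>n. g (\<psi> (u n) (X n))) \<longlonglongrightarrow> 0"
  shows "\<forall>\<^sub>F n in sequentially. T < \<bar>u n\<bar>"
proof (rule ccontr)
  assume "\<not> ?thesis"
  then obtain r :: "nat \<Rightarrow> nat" where r: "strict_mono r" and "\<forall>n. \<not> T < \<bar>u (r n)\<bar>"
    using not_eventually_sequentiallyD[of "\<lambda>n. T < \<bar>u n\<bar>"] by blast
  then have range: "u (r n) \<in> {-T..T}" for n by (simp add: not_less abs_le_iff) (metis minus_le_iff)
  obtain l r' where r': "strict_mono r'" "((u \<circ> r) \<circ> r') \<longlonglongrightarrow> l"
    using compact_imp_seq_compact[OF compact_Icc, of "-T" T] range unfolding seq_compact_def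
    by (metis comp_apply)
  define f where "f = r \<circ> r'"
  have f: "strict_mono f" unfolding f_def using r r'(1) by (rule strict_mono_o)
  have "(\<lambda>n. (u (f n), X (f n))) \<longlonglongrightarrow> (l, x)"
    using r'(2) LIMSEQ_subseq_LIMSEQ[OF x(1) f] by (intro tendsto_Pair) (auto simp: f_def o_def)
  moreover have "continuous_on UNIV (\<lambda>z. g (\<psi> (fst z) (snd z)))"
    by (intro continuous_on_rate continuous_on_flow continuous_intros)
  ultimately have "(\<lambda>n. g (\<psi> (u (f n)) (X (f n)))) \<longlonglongrightarrow> g (\<psi> l x)"
    using continuous_on_tendsto_compose[of UNIV "\<lambda>z. g (\<psi> (fst z) (snd z))"] by fastforce
  moreover have "(\<lambda>n. g (\<psi> (u (f n)) (X (f n)))) \<longlonglongrightarrow> 0"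
    using LIMSEQ_subseq_LIMSEQ[OF u f] by (simp add: o_def)
  ultimately have "g (\<psi> l x) = 0" by (rule LIMSEQ_unique)
  then show False using rate_pos_flow[OF x(2), of l] by simp
qed

end

text \<open>\<open>closure_V\<close> forbids zeros on the boundary of any \<open>V i\<close>. In the
  application the zeros inside \<open>V i\<close> are exactly one component, so the components
  themselves need not be mentioned here.\<close>

locale isolated_zeros = dissipative_flow \<psi> g
  for \<psi> :: "real \<Rightarrow> 'a::{t2_space, second_countable_topology} \<Rightarrow> 'a" and g +
  fixes I :: "'i set" and V :: "'i \<Rightarrow> 'a set" and N :: real
  assumes finite_I: "finite I"
    and open_V: "i \<in> I \<Longrightarrow> open (V i)"
    and disjoint_V: "i \<in> I \<Longrightarrow> j \<in> I \<Longrightarrow> i \<noteq> j \<Longrightarrow> V i \<inter> V j = {}"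
    and zeros_subset: "g p = 0 \<Longrightarrow> \<exists>i\<in>I. p \<in> V i"
    and closure_V: "i \<in> I \<Longrightarrow> p \<in> closure (V i) \<Longrightarrow> g p = 0 \<Longrightarrow> p \<in> V i"
    and N_pos: "0 < N"
begin

text \<open>Convergence to the zeros in \<open>V i\<close> as a set; a limit point need not exist.
  Only the future of the curve is looked at, pasts enter through the reversed curve.\<close>

definition converges_to :: "(real \<Rightarrow> 'a) \<Rightarrow> 'i \<Rightarrow> bool" where
  "converges_to \<gamma> i \<longleftrightarrow> i \<in> I \<and> (\<exists>T. \<forall>t\<ge>T. \<gamma> t \<in> V i) \<and> (\<forall>e>0. \<exists>T. \<forall>t\<ge>T. g (\<gamma> t) < e)"

lemma limit_set_subset:
  assumes "converges_to \<gamma> i"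
  shows "(\<Inter>t. closure (\<gamma> ` {t..})) \<subseteq> {p \<in> V i. g p = 0}"
proof
  fix q assume q: "q \<in> (\<Inter>t. closure (\<gamma> ` {t..}))"
  obtain T where "\<forall>t\<ge>T. \<gamma> t \<in> V i" and i: "i \<in> I" using assms unfolding converges_to_def by blast
  then have "closure (\<gamma> ` {T..}) \<subseteq> closure (V i)" by (intro closure_mono) auto
  then have "q \<in> closure (V i)" using q by blast
  moreover have "g q \<le> e" if e: "0 < e" for e
  proof -
    obtain T where T: "\<forall>t\<ge>T. g (\<gamma> t) < e" using assms e unfolding converges_to_def by blast
    have "closed {p. g p \<le> e}" using continuous_rate by (intro closed_Collect_le continuous_intros)
    moreover have "\<gamma> ` {T..} \<subseteq> {p. g p \<le> e}" using T by (auto intro: less_imp_le)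
    ultimately have "closure (\<gamma> ` {T..}) \<subseteq> {p. g p \<le> e}" by (intro closure_minimal)
    then show ?thesis using q by blast
  qed
  then have "g q = 0" using rate_nonneg[of q] by (meson field_le_epsilon dense_ge le_less not_le)
  ultimately show "q \<in> {p \<in> V i. g p = 0}" using closure_V[OF i] by blast
qed

text \<open>Bounded loss forces the orbit finally into the union of the \<open>V i\<close>. Its tail
  is connected and the \<open>V i\<close> are open and disjoint, so one of them contains it. The
  sets of small rate are neighbourhoods of the zeros too, hence the rate tends to 0.\<close>

lemma orbit_converges:
  assumes "\<And>t. 0 \<le> t \<Longrightarrow> loss t x \<le> N"
  obtains i where "converges_to (\<lambda>t. \<psi> t x) i"
proof -
  let ?U = "\<Union>i\<in>I. V i"
  obtain T where T: "\<And>t. T \<le> t \<Longrightarrow> \<psi> t x \<in> ?U"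
    by (rule eventually_in_neighbourhood[OF assms, of ?U]) (use open_V zeros_subset in auto)
  obtain i where i: "i \<in> I" "\<psi> T x \<in> V i" using T[of T] by auto
  have "connected ((\<lambda>t. \<psi> t x) ` {T..})"
    by (intro connected_continuous_image continuous_on_flow continuous_intros) auto
  moreover have "open (\<Union>j\<in>I - {i}. V j)" using open_V by auto
  moreover have "(\<lambda>t. \<psi> t x) ` {T..} \<subseteq> V i \<union> (\<Union>j\<in>I - {i}. V j)" using T by blast
  moreover have "V i \<inter> (\<Union>j\<in>I - {i}. V j) \<inter> (\<lambda>t. \<psi> t x) ` {T..} = {}"
    using disjoint_V[OF i(1)] by blast
  moreover have "V i \<inter> (\<lambda>t. \<psi> t x) ` {T..} \<noteq> {}" using i by auto
  ultimately have "(\<Union>j\<in>I - {i}. V j) \<inter> (\<lambda>t. \<psi> t x) ` {T..} = {}"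
    using connectedD[of "(\<lambda>t. \<psi> t x) ` {T..}" "V i" "\<Union>j\<in>I - {i}. V j"] open_V[OF i(1)] by blast
  then have "\<forall>t\<ge>T. \<psi> t x \<in> V i" using T by fastforce
  moreover have "\<exists>T. \<forall>t\<ge>T. g (\<psi> t x) < e" if "0 < e" for e
  proof -
    have "open {p. g p < e}" using continuous_rate by (intro open_Collect_less continuous_intros)
    then show ?thesis
      using eventually_in_neighbourhood[OF assms, of "{p. g p < e}"] that by auto
  qed
  ultimately show thesis using i that unfolding converges_to_def by blast
qed

definition connects :: "'i \<Rightarrow> 'i \<Rightarrow> 'a \<Rightarrow> bool" where
  "connects i j x \<longleftrightarrow> 0 < g x \<and> (\<forall>a b. loss b x - loss a x \<le> N) \<and>
     converges_to (\<lambda>t. \<psi> (- t) x) i \<and> converges_to (\<lambda>t. \<psi> t x) j"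

text \<open>The second index is the start, the first the target, which later stays fixed. Demanding
  an exit from \<open>V j\<close> rules out segments that remain near the zeros and whose limits
  might consist of zeros only.\<close>

definition returns :: "'i \<Rightarrow> 'i \<Rightarrow> bool" where
  "returns i j \<longleftrightarrow> (\<forall>e>0. \<exists>q s t. q \<in> V j \<and> g q < e \<and> 0 \<le> s \<and> s \<le> t \<and> \<psi> s q \<notin> V j \<and>
     loss t q \<le> N \<and> \<psi> t q \<in> V i \<and> g (\<psi> t q) < e)"

text \<open>
  The points where returning orbits leave \<open>V j\<close> accumulate at a point of a connecting orbit:
  both the time since the start near the zeros and the time until the return tend to infinity.
\<close>

lemma returns_step:
  assumes i: "i \<in> I" "returns i i" and j: "j \<in> I" "returns i j"
  obtains j' x where "j' \<in> I" "returns i j'" "connects j j' x"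
proof -
  have "\<forall>n. \<exists>q s t. q \<in> V j \<and> g q < inverse (real (Suc n)) \<and> 0 \<le> s \<and> s \<le> t \<and> \<psi> s q \<notin> V j \<and>
     loss t q \<le> N \<and> \<psi> t q \<in> V i \<and> g (\<psi> t q) < inverse (real (Suc n))"
    using j(2) unfolding returns_def by (intro allI) simp
  then obtain q s t where q: "\<And>n. q n \<in> V j" "\<And>n. g (q n) < inverse (real (Suc n))"
    and s: "\<And>n. 0 \<le> s n" "\<And>n. s n \<le> t n" "\<And>n. \<psi> (s n) (q n) \<notin> V j"
    and t: "\<And>n. loss (t n) (q n) \<le> N" "\<And>n. \<psi> (t n) (q n) \<in> V i"
      "\<And>n. g (\<psi> (t n) (q n)) < inverse (real (Suc n))"
    by metis
  have "\<exists>r. 0 < r \<and> r \<le> s n \<and> \<psi> r (q n) \<notin> V j \<and> (\<forall>t. 0 \<le> t \<longrightarrow> t < r \<longrightarrow> \<psi> t (q n) \<in> V j)" for n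
    by (rule first_exit[OF open_V[OF j(1)] q(1) s(1) s(3)]) blast
  then obtain \<sigma> where \<sigma>: "\<And>n. 0 < \<sigma> n" "\<And>n. \<sigma> n \<le> s n" "\<And>n. \<psi> (\<sigma> n) (q n) \<notin> V j"
    "\<And>n t. 0 \<le> t \<Longrightarrow> t < \<sigma> n \<Longrightarrow> \<psi> t (q n) \<in> V j"
    by metis
  have \<sigma>t: "\<sigma> n \<le> t n" for n using \<sigma>(2) s(2) order_trans by blast
  \<comment> \<open>Compactness yields a convergent subsequence of exit points because the topology
    is second countable.\<close>
  obtain x r where r: "strict_mono r" and lim: "((\<lambda>n. \<psi> (\<sigma> n) (q n)) \<circ> r) \<longlonglongrightarrow> x"
    using compact_imp_seq_compact[OF compact_space] unfolding seq_compact_def by (metis UNIV_I)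
  \<comment> \<open>Time is recentred at the exit: the segment through \<open>X n\<close> started
    \<open>a n\<close> ago and ends after a further time \<open>b n\<close>.\<close>
  define X where "X n = \<psi> (\<sigma> (r n)) (q (r n))" for n
  define a where "a n = \<sigma> (r n)" for n
  define b where "b n = t (r n) - \<sigma> (r n)" for n
  have X: "X \<longlonglongrightarrow> x" using lim unfolding X_def[abs_def] o_def .
  have X_shift: "\<psi> u (X n) = \<psi> (u + a n) (q (r n))" for u n by (simp add: X_def a_def flow_plus)
  have cont_lim: "(\<lambda>n. \<psi> u (X n)) \<longlonglongrightarrow> \<psi> u x" for u
    using continuous_on_tendsto_compose[of UNIV "\<psi> u", OF _ X]
      continuous_on_flow[of UNIV "\<lambda>_. u" "\<lambda>p. p"] by (simp add: continuous_on_id)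
  have small: "(\<lambda>n. inverse (real (Suc (r n)))) \<longlonglongrightarrow> 0"
    using LIMSEQ_subseq_LIMSEQ[OF LIMSEQ_inverse_real_of_nat r] by (simp add: o_def)
  have start_lim: "(\<lambda>n. g (\<psi> (- a n) (X n))) \<longlonglongrightarrow> 0"
    by (rule tendsto_sandwich[OF _ _ tendsto_const small])
      (use q(2) rate_nonneg in \<open>auto simp: X_shift flow_zero intro: less_imp_le always_eventually\<close>)
  have end_lim: "(\<lambda>n. g (\<psi> (b n) (X n))) \<longlonglongrightarrow> 0"
    by (rule tendsto_sandwich[OF _ _ tendsto_const small])
      (use t(3) rate_nonneg in \<open>auto simp: X_shift a_def b_def intro: less_imp_le always_eventually\<close>)
  have ab: "0 < a n" "0 \<le> b n" for n using \<sigma>(1) \<sigma>t by (auto simp: a_def b_def)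
  \<comment> \<open>The limit of the exit points lies on the boundary of \<open>V j\<close>, where
    no zeros are, so its orbit avoids the zeros altogether.\<close>
  have x_clos: "x \<in> closure (V j)"
  proof (rule closed_sequentially[OF closed_closure _ X])
    fix n
    have "(\<lambda>t. \<psi> t (q (r n))) ` closure {0..<a n} \<subseteq> closure (V j)"
    proof (rule image_closure_subset)
      show "continuous_on (closure {0..<a n}) (\<lambda>t. \<psi> t (q (r n)))"
        by (intro continuous_on_flow continuous_intros)
      show "(\<lambda>t. \<psi> t (q (r n))) ` {0..<a n} \<subseteq> closure (V j)"
        using \<sigma>(4) closure_subset by (fastforce simp: a_def)
    qed simp
    moreover have "a n \<in> closure {0..<a n}" using ab(1)[of n] by (simp add: closure_atLeastLessThan)
    ultimately show "X n \<in> closure (V j)" unfolding X_def a_def by blast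
  qed
  have x_notin: "x \<in> - V j"
    by (rule closed_sequentially[OF _ _ X]) (use \<sigma>(3) open_V[OF j(1)] in \<open>auto simp: X_def\<close>)
  have gx: "0 < g x"
    using closure_V[OF j(1) x_clos] x_notin rate_nonneg[of x] by (auto simp: order_less_le)
  have ev_a: "\<forall>\<^sub>F n in sequentially. T < a n" for T
    using escape_times_unbounded[OF X gx start_lim, of T] ab(1) by (simp add: abs_of_pos)
  have ev_b: "\<forall>\<^sub>F n in sequentially. T < b n" for T
    using escape_times_unbounded[OF X gx end_lim, of T] ab(2) by (simp add: abs_of_nonneg)
  have past: "\<psi> (- c) x \<in> closure (V j)" if c: "0 < c" for c
  proof (rule Lim_in_closed_set[OF closed_closure _ _ cont_lim])
    show "\<forall>\<^sub>F n in sequentially. \<psi> (- c) (X n) \<in> closure (V j)"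
      using ev_a[of c]
    proof eventually_elim
      case (elim n)
      then have "\<psi> (a n - c) (q (r n)) \<in> V j" using c by (intro \<sigma>(4)) (auto simp: a_def)
      then show ?case using closure_subset by (auto simp: X_shift)
    qed
  qed simp
  \<comment> \<open>For large \<open>n\<close> the window from \<open>- c\<close> to
    \<open>d\<close> around the exit lies within the segment, whose loss is at most
    \<open>N\<close>; the bound passes to the limit.\<close>
  have window: "loss (c + d) (\<psi> (- c) x) \<le> N" if c: "0 \<le> c" and d: "0 \<le> d" for c d
  proof (rule tendsto_upperbound)
    have "continuous_on UNIV (loss (c + d))"
      using continuous_on_loss[of UNIV "\<lambda>_. c + d" "\<lambda>p. p"] by (simp add: continuous_on_id)
    then show "(\<lambda>n. loss (c + d) (\<psi> (- c) (X n))) \<longlonglongrightarrow> loss (c + d) (\<psi> (- c) x)"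
      using continuous_on_tendsto_compose[OF _ cont_lim] by fastforce
    show "\<forall>\<^sub>F n in sequentially. loss (c + d) (\<psi> (- c) (X n)) \<le> N"
      using ev_a[of c] ev_b[of d]
    proof eventually_elim
      case (elim n)
      let ?q = "q (r n)" and ?t = "t (r n)"
      have "loss (c + d) (\<psi> (- c) (X n)) = loss (c + d) (\<psi> (a n - c) ?q)" by (simp add: X_shift)
      also have "\<dots> \<le> loss (?t - (a n - c)) (\<psi> (a n - c) ?q)"
        using elim by (intro loss_mono) (simp add: a_def b_def)
      also have "\<dots> = loss ?t ?q - loss (a n - c) ?q"
        using loss_plus[of "?t - (a n - c)" "a n - c" ?q] by simp
      also have "\<dots> \<le> N" using t(1)[of "r n"] loss_nonneg[of "a n - c" ?q] elim by simp
      finally show ?case .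
    qed
  qed simp
  have split: "loss (c + d) (\<psi> (- c) x) = loss d x - loss (- c) x" for c d
    using loss_plus[of "c + d" "- c" x] by simp
  have total: "loss d x - loss c x \<le> N" for c d
  proof -
    have "loss d x \<le> loss \<bar>d\<bar> x" "loss (- \<bar>c\<bar>) x \<le> loss c x" by (auto intro: loss_mono)
    then show ?thesis using window[of "\<bar>c\<bar>" "\<bar>d\<bar>"] split[of "\<bar>c\<bar>" "\<bar>d\<bar>"] by simp
  qed
  obtain j' where j': "converges_to (\<lambda>t. \<psi> t x) j'"
    by (rule orbit_converges[of x]) (use total[of _ 0] in \<open>simp_all add: loss_0\<close>)
  have "converges_to (\<lambda>t. \<psi> (- t) x) j"
  proof -
    interpret rev: isolated_zeros "\<lambda>t. \<psi> (- t)" g I V N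
      using reverse finite_I open_V disjoint_V zeros_subset closure_V N_pos
      by (intro isolated_zeros.intro isolated_zeros_axioms.intro) auto
    have "rev.loss t x \<le> N" for t using total[of 0 "- t"] by (simp add: loss_reverse loss_0)
    then obtain j'' where j'': "rev.converges_to (\<lambda>t. \<psi> (- t) x) j''"
      by (rule rev.orbit_converges)
    then obtain T where T: "j'' \<in> I" "\<And>t. T \<le> t \<Longrightarrow> \<psi> (- t) x \<in> V j''"
      unfolding rev.converges_to_def by blast
    \<comment> \<open>A point of the past lies in the open set \<open>V j''\<close> and in the
      closure of \<open>V j\<close>, so these sets meet, and disjointness identifies the indices.
      The maximum with 1 makes the time positive, as \<open>past\<close> demands.\<close>
    have "\<psi> (- max T 1) x \<in> V j'' \<inter> closure (V j)" using T(2)[of "max T 1"] past[of "max T 1"] by simp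
    then have "V j'' \<inter> V j \<noteq> {}" using open_Int_closure_eq_empty[OF open_V[OF T(1)], of "V j"] by blast
    then have "j'' = j" using disjoint_V[OF T(1) j(1)] by blast
    then show ?thesis using j'' by (simp add: converges_to_def rev.converges_to_def)
  qed
  then have conn: "connects j j' x" using gx total j' by (simp add: connects_def)
  \<comment> \<open>For \<open>j' = i\<close> the assumption on \<open>i\<close> suffices. Otherwise
    the approximating segments still end in \<open>V i\<close>, which is disjoint from
    \<open>V j'\<close>, so the end of the segment is itself the required exit.\<close>
  have "returns i j'"
  proof (cases "j' = i")
    case False
    have j'I: "j' \<in> I" using j' by (simp add: converges_to_def)
    show ?thesis unfolding returns_def
    proof (intro allI impI)
      fix e :: real assume e: "0 < e"
      obtain T1 where T1: "\<And>t. T1 \<le> t \<Longrightarrow> \<psi> t x \<in> V j'" using j' unfolding converges_to_def by blast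
      obtain T2 where T2: "\<And>t. T2 \<le> t \<Longrightarrow> g (\<psi> t x) < e" using j' e unfolding converges_to_def by blast
      define T where "T = max 0 (max T1 T2)"
      have T: "0 \<le> T" "\<psi> T x \<in> V j'" "g (\<psi> T x) < e" using T1[of T] T2[of T] by (auto simp: T_def)
      have "\<forall>\<^sub>F n in sequentially. \<psi> T (X n) \<in> V j'"
        using topological_tendstoD[OF cont_lim open_V[OF j'I] T(2)] .
      moreover have "\<forall>\<^sub>F n in sequentially. \<psi> T (X n) \<in> {p. g p < e}"
        using continuous_rate T(3)
        by (intro topological_tendstoD[OF cont_lim] open_Collect_less continuous_intros) auto
      moreover have "\<forall>\<^sub>F n in sequentially. inverse (real (Suc (r n))) < e"
        using order_tendstoD(2)[OF small e] .
      ultimately have "\<forall>\<^sub>F n in sequentially. \<psi> T (X n) \<in> V j' \<and> g (\<psi> T (X n)) < e \<and>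
          inverse (real (Suc (r n))) < e \<and> T < b n"
        using ev_b[of T] by eventually_elim simp
      then obtain n where n: "\<psi> T (X n) \<in> V j'" "g (\<psi> T (X n)) < e"
          "inverse (real (Suc (r n))) < e" "T < b n"
        using eventually_happens'[OF sequentially_bot] by blast
      let ?q = "\<psi> (T + a n) (q (r n))" and ?t = "b n - T"
      have end_eq: "\<psi> ?t ?q = \<psi> (t (r n)) (q (r n))"
        using flow_plus[of ?t "T + a n" "q (r n)"] by (simp add: a_def b_def)
      have "\<psi> ?t ?q \<in> V i" using t(2) end_eq by simp
      moreover from this have "\<psi> ?t ?q \<notin> V j'" using disjoint_V[OF j'I i(1) False] by blast
      moreover have "loss ?t ?q \<le> N"
        using loss_plus[of ?t "T + a n" "q (r n)"] loss_nonneg[of "T + a n" "q (r n)"] t(1)[of "r n"] T(1) ab(1)[of n]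
        by (simp add: a_def b_def)
      moreover have "g (\<psi> ?t ?q) < e" using t(3)[of "r n"] n(3) end_eq by simp
      ultimately show "\<exists>q s t. q \<in> V j' \<and> g q < e \<and> 0 \<le> s \<and> s \<le> t \<and> \<psi> s q \<notin> V j' \<and>
          loss t q \<le> N \<and> \<psi> t q \<in> V i \<and> g (\<psi> t q) < e"
        using n by (intro exI[of _ ?q] exI[of _ ?t]) (auto simp: X_shift)
    qed
  qed (use i in simp)
  then show thesis using that conn j' by (auto simp: converges_to_def)
qed

end

section \<open>Cycles of orbits, and deformations in the absence of returns\<close>

lemma self_map_has_cycle:
  assumes Q: "finite Q" "i \<in> Q" and f: "\<And>j. j \<in> Q \<Longrightarrow> f j \<in> Q"
  obtains j l where "j \<in> Q" "1 \<le> l" "l \<le> card Q" "(f ^^ l) j = j"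
proof -
  have in_Q: "(f ^^ n) i \<in> Q" for n by (induction n) (use Q f in auto)
  \<comment> \<open>Pigeonhole: \<open>card Q + 1\<close> iterates lie in \<open>Q\<close>.\<close>
  have "\<not> inj_on (\<lambda>n. (f ^^ n) i) {..card Q}"
  proof
    assume "inj_on (\<lambda>n. (f ^^ n) i) {..card Q}"
    then have "card {..card Q} \<le> card Q"
      by (rule card_inj_on_le) (use in_Q Q in auto)
    then show False by simp
  qed
  then obtain m n where mn: "m \<le> card Q" "n \<le> card Q" "m \<noteq> n" "(f ^^ m) i = (f ^^ n) i"
    unfolding inj_on_def by auto
  define a b where "a = min m n" and "b = max m n"
  have ab: "a < b" "b \<le> card Q" "(f ^^ b) i = (f ^^ a) i"
    using mn by (auto simp: a_def b_def min_def max_def)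
  have "(f ^^ (b - a)) ((f ^^ a) i) = (f ^^ (b - a + a)) i" by (simp add: funpow_add)
  then have "(f ^^ (b - a)) ((f ^^ a) i) = (f ^^ a) i" using ab by simp
  then show thesis using that[OF in_Q[of a], of "b - a"] ab by simp
qed

lemma positive_continuous_integral:
  fixes f :: "real \<Rightarrow> real"
  assumes "continuous_on {0..T} f" "0 < T" "\<And>t. t \<in> {0..T} \<Longrightarrow> 0 \<le> f t" "s \<in> {0..T}" "0 < f s"
  shows "0 < integral {0..T} f"
proof -
  have "0 \<le> integral {0..T} f" by (rule integral_nonneg) (use assms in \<open>auto intro: integrable_continuous_real\<close>)
  moreover have "integral {0..T} f \<noteq> 0" using integral_eq_0_iff[of 0 T f] assms by force
  ultimately show ?thesis by simp
qed

text \<open>If all times of positive weight lay on one side of the mean \<open>m\<close>, then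
  \<open>(t - m) * k t\<close> would have constant sign and integral 0, hence vanish, and the weight
  with it.\<close>

lemma weighted_mean_between:
  fixes k :: "real \<Rightarrow> real"
  assumes T: "0 < T" and k: "continuous_on {0..T} k" "\<And>t. 0 \<le> k t" and pos: "0 < integral {0..T} k"
  shows "\<exists>a b. 0 \<le> a \<and> a \<le> integral {0..T} (\<lambda>t. t * k t) / integral {0..T} k \<and> 0 < k a \<and>
    integral {0..T} (\<lambda>t. t * k t) / integral {0..T} k \<le> b \<and> 0 < k b"
proof -
  define m where "m = integral {0..T} (\<lambda>t. t * k t) / integral {0..T} k"
  have int: "(\<lambda>t. t * k t) integrable_on {0..T}" "k integrable_on {0..T}"
    using k(1) by (auto intro!: integrable_continuous_real continuous_intros)
  have "(\<lambda>t. m * k t) integrable_on {0..T}"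
    using k(1) by (auto intro!: integrable_continuous_real continuous_intros)
  then have "integral {0..T} (\<lambda>t. t * k t - m * k t) = integral {0..T} (\<lambda>t. t * k t) - m * integral {0..T} k"
    using int by (simp add: integral_diff)
  then have "integral {0..T} (\<lambda>t. t * k t - m * k t) = 0" using pos by (simp add: m_def)
  then have mean: "integral {0..T} (\<lambda>t. (t - m) * k t) = 0" by (simp add: algebra_simps)
  then have mean': "integral {0..T} (\<lambda>t. (m - t) * k t) = 0"
    using integral_neg[of "{0..T}" "\<lambda>t. (t - m) * k t"] by (simp add: algebra_simps)
  have zero: "\<not> (\<forall>t\<in>{0..T}. k t = 0)" using integral_eq_0_iff[OF k(1) T] k(2) pos by simp
  have "\<exists>a\<in>{0..T}. a \<le> m \<and> 0 < k a"
  proof (rule ccontr)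
    assume no: "\<not> ?thesis"
    then have t: "k t = 0 \<or> m < t" if "t \<in> {0..T}" for t using that k(2)[of t] by (metis linorder_not_le order_less_le)
    have cont: "continuous_on {0..T} (\<lambda>t. (t - m) * k t)" using k(1) by (intro continuous_intros)
    have "0 \<le> (t - m) * k t" if "t \<in> {0..T}" for t using t[OF that] k(2)[of t] by auto
    from integral_eq_0_iff[OF cont T this] mean have "\<forall>t\<in>{0..T}. (t - m) * k t = 0" by simp
    then have "\<forall>t\<in>{0..T}. k t = 0" using t by fastforce
    then show False using zero by blast
  qed
  moreover have "\<exists>b\<in>{0..T}. m \<le> b \<and> 0 < k b"
  proof (rule ccontr)
    assume no: "\<not> ?thesis"
    then have t: "k t = 0 \<or> t < m" if "t \<in> {0..T}" for t using that k(2)[of t] by (metis linorder_not_le order_less_le)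
    have cont: "continuous_on {0..T} (\<lambda>t. (m - t) * k t)" using k(1) by (intro continuous_intros)
    have "0 \<le> (m - t) * k t" if "t \<in> {0..T}" for t using t[OF that] k(2)[of t] by auto
    from integral_eq_0_iff[OF cont T this] mean' have "\<forall>t\<in>{0..T}. (m - t) * k t = 0" by simp
    then have "\<forall>t\<in>{0..T}. k t = 0" using t by fastforce
    then show False using zero by blast
  qed
  ultimately show ?thesis unfolding m_def[symmetric] by auto
qed

context isolated_zeros
begin

text \<open>By \<open>returns_step\<close> the indices reachable with the fixed target
  \<open>i\<close> are mapped into themselves. The point \<open>X\<close> is chosen as a function of
  the index, so the chain of orbits closes as soon as the indices do.\<close>

lemma returns_cycle:
  assumes i: "i \<in> I" "returns i i"
  obtains l J X where "1 \<le> l" "l \<le> card I" "J l = J 0" "\<And>n. J n \<in> I" "\<And>n. connects (J n) (J (Suc n)) (X (J n))"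
proof -
  define Q where "Q = {j \<in> I. returns i j}"
  have "\<forall>j\<in>Q. \<exists>j' x. j' \<in> Q \<and> connects j j' x"
  proof
    fix j assume "j \<in> Q"
    then show "\<exists>j' x. j' \<in> Q \<and> connects j j' x"
      using returns_step[OF i, of j] unfolding Q_def by blast
  qed
  then obtain f X where fX: "\<And>j. j \<in> Q \<Longrightarrow> f j \<in> Q \<and> connects j (f j) (X j)" by metis
  have Q: "finite Q" "i \<in> Q" "Q \<subseteq> I" using finite_I i by (auto simp: Q_def)
  obtain j l where j: "j \<in> Q" "1 \<le> l" "l \<le> card Q" "(f ^^ l) j = j"
    by (rule self_map_has_cycle[of Q i f]) (use Q fX in auto)
  have in_Q: "(f ^^ n) j \<in> Q" for n by (induction n) (use j fX in auto)
  show thesis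
  proof (rule that[of l "\<lambda>n. (f ^^ n) j" X])
    show "l \<le> card I" using j(3) card_mono[OF finite_I Q(3)] by simp
    show "(f ^^ n) j \<in> I" for n using in_Q Q by blast
    show "connects ((f ^^ n) j) ((f ^^ Suc n) j) (X ((f ^^ n) j))" for n
      using fX[OF in_Q[of n]] by simp
  qed (use j in auto)
qed

text \<open>Absence of returns provides a threshold \<open>e\<close> for the rate. The weight lives
  where the rate is below it, so an excursion out of \<open>V i\<close> between two times of
  positive weight would be a return.\<close>

lemma no_return_weight:
  assumes i: "i \<in> I" "\<not> returns i i"
  obtains w :: "'a \<Rightarrow> real" where "continuous_on UNIV w" "\<And>p. 0 \<le> w p" "\<And>p. p \<in> V i \<Longrightarrow> g p = 0 \<Longrightarrow> 0 < w p"
    "\<And>q s t. 0 < w q \<Longrightarrow> 0 < w (\<psi> t q) \<Longrightarrow> loss t q \<le> N \<Longrightarrow> 0 \<le> s \<Longrightarrow> s \<le> t \<Longrightarrow> \<psi> s q \<in> V i"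
proof -
  obtain e where e: "0 < e" "\<And>q s t. q \<in> V i \<Longrightarrow> g q < e \<Longrightarrow> 0 \<le> s \<Longrightarrow> s \<le> t \<Longrightarrow> loss t q \<le> N \<Longrightarrow>
      \<psi> t q \<in> V i \<Longrightarrow> g (\<psi> t q) < e \<Longrightarrow> \<psi> s q \<in> V i"
    using i(2) unfolding returns_def by blast
  have "closed (closure (V i) - V i)" using open_V[OF i(1)] by (intro closed_Diff) auto
  moreover have "0 < g p" if "p \<in> closure (V i) - V i" for p
    using closure_V[OF i(1), of p] rate_nonneg[of p] that by (auto simp: order_less_le)
  ultimately obtain c where c: "0 < c" "\<And>p. p \<in> closure (V i) - V i \<Longrightarrow> c \<le> g p"
    using rate_bounded_below by blast
  \<comment> \<open>As \<open>d\<close> is at most the rate on the boundary of \<open>V i\<close>,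
    the weight vanishes there and extends continuously by 0; as it is at most \<open>e\<close>,
    positive weight implies a rate below the threshold.\<close>
  define d where "d = min c e"
  define w where "w p = (if p \<in> closure (V i) then max 0 (d - g p) else 0)" for p
  have "continuous_on (closure (V i) \<union> - V i) w"
    unfolding w_def using open_V[OF i(1)] c(2)
    by (intro continuous_on_cases continuous_intros continuous_on_rate) (auto simp: d_def closed_Compl max_def, fastforce)
  moreover have "closure (V i) \<union> - V i = UNIV" using closure_subset by blast
  ultimately have cont: "continuous_on UNIV w" by simp
  have w: "p \<in> V i \<and> g p < e" if "0 < w p" for p
    using that c(2)[of p] by (auto simp: w_def d_def less_max_iff_disj split: if_splits)
  show thesis
  proof (rule that[OF cont])
    show "0 \<le> w p" for p by (simp add: w_def)
    show "0 < w p" if "p \<in> V i" "g p = 0" for p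
      using that closure_subset[of "V i"] c(1) e(1) by (auto simp: w_def d_def)
    show "\<psi> s q \<in> V i" if "0 < w q" "0 < w (\<psi> t q)" "loss t q \<le> N" "0 \<le> s" "s \<le> t" for q s t
      using e(2)[of q s t] w[OF that(1)] w[OF that(2)] that by blast
  qed
qed

text \<open>
  Averaging the times at which the orbit is close to the zeros in \<open>V i\<close> gives, by the absence of
  returns, a time at which the orbit is in \<open>V i\<close>. Unlike an entrance time, this mean depends
  continuously on the orbit.
\<close>

lemma no_return_cover:
  assumes no_return: "\<And>i. i \<in> I \<Longrightarrow> \<not> returns i i"
  obtains T D \<tau> where "0 < T" "\<And>i. i \<in> I \<Longrightarrow> open (D i)" "\<And>i. i \<in> I \<Longrightarrow> continuous_on (D i) (\<tau> i)"
    "\<And>i p. i \<in> I \<Longrightarrow> p \<in> D i \<Longrightarrow> \<psi> (\<tau> i p) p \<in> V i"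
    "\<And>p. loss T p < N \<Longrightarrow> \<exists>i\<in>I. p \<in> D i"
proof -
  define weight :: "'i \<Rightarrow> ('a \<Rightarrow> real) \<Rightarrow> bool" where
    "weight i w \<longleftrightarrow> continuous_on UNIV w \<and> (\<forall>p. 0 \<le> w p) \<and> (\<forall>p. p \<in> V i \<longrightarrow> g p = 0 \<longrightarrow> 0 < w p) \<and>
      (\<forall>q s t. 0 < w q \<longrightarrow> 0 < w (\<psi> t q) \<longrightarrow> loss t q \<le> N \<longrightarrow> 0 \<le> s \<longrightarrow> s \<le> t \<longrightarrow> \<psi> s q \<in> V i)" for i w
  have "\<exists>w. weight i w" if i: "i \<in> I" for i
    unfolding weight_def by (rule no_return_weight[OF i no_return[OF i]]) blast
  then obtain w where "\<And>i. i \<in> I \<Longrightarrow> weight i (w i)" by metis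
  then have w: "\<And>i. i \<in> I \<Longrightarrow> continuous_on UNIV (w i)" "\<And>i p. i \<in> I \<Longrightarrow> 0 \<le> w i p"
    "\<And>i p. i \<in> I \<Longrightarrow> p \<in> V i \<Longrightarrow> g p = 0 \<Longrightarrow> 0 < w i p"
    "\<And>i q s t. i \<in> I \<Longrightarrow> 0 < w i q \<Longrightarrow> 0 < w i (\<psi> t q) \<Longrightarrow> loss t q \<le> N \<Longrightarrow>
      0 \<le> s \<Longrightarrow> s \<le> t \<Longrightarrow> \<psi> s q \<in> V i"
    unfolding weight_def by blast+
  define G where "G = (\<Union>i\<in>I. {p. 0 < w i p})"
  have "open G" unfolding G_def using w(1) by (intro open_UN ballI open_Collect_less continuous_intros) auto
  then have "closed (- G)" by (simp add: closed_Compl)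
  moreover have "0 < g p" if "p \<in> - G" for p
    using that zeros_subset[of p] w(3) rate_nonneg[of p] by (auto simp: G_def order_less_le)
  ultimately obtain c where c: "0 < c" "\<And>p. p \<in> - G \<Longrightarrow> c \<le> g p"
    using rate_bounded_below by blast
  \<comment> \<open>Outside \<open>G\<close> the rate is at least \<open>c\<close>, so an orbit that
    avoids \<open>G\<close> up to time \<open>T\<close> loses at least \<open>N\<close>.\<close>
  define T where "T = N / c"
  have T: "0 < T" using N_pos c by (simp add: T_def)
  have visit: "\<exists>t\<in>{0..T}. \<psi> t p \<in> G" if p: "loss T p < N" for p
  proof (rule ccontr)
    assume no: "\<not> ?thesis"
    have "loss 0 p - c * 0 \<le> loss T p - c * T"
    proof (rule DERIV_nonneg_imp_nondecreasing[where f = "\<lambda>t. loss t p - c * t"])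
      fix t assume t: "0 \<le> t" "t \<le> T"
      have "((\<lambda>t. loss t p - c * t) has_real_derivative g (\<psi> t p) - c) (at t)"
        by (auto intro!: derivative_eq_intros loss_has_derivative)
      moreover have "0 \<le> g (\<psi> t p) - c" using no t c(2)[of "\<psi> t p"] by auto
      ultimately show "\<exists>y. ((\<lambda>t. loss t p - c * t) has_real_derivative y) (at t) \<and> 0 \<le> y" by blast
    qed (use T in simp)
    then show False using p c by (simp add: loss_0 T_def)
  qed
  \<comment> \<open>The second factor continuously switches visits off as the loss reaches
    \<open>N\<close>; two nonnegative times of positive \<open>k\<close> are therefore separated by
    a loss below \<open>N\<close>, which the property of the weight requires.\<close>
  define k where "k i p t = w i (\<psi> t p) * max 0 (N - loss t p)" for i p t
  define W where "W i p = integral {0..T} (k i p)" for i p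
  define M where "M i p = integral {0..T} (\<lambda>t. t * k i p t)" for i p
  have k_joint: "continuous_on S (\<lambda>z. k i (fst z) (snd z))" if "i \<in> I" for i S
    unfolding k_def using that
    by (intro continuous_intros continuous_on_loss continuous_on_compose2[OF w(1)] continuous_on_flow) auto
  have k_cont: "continuous_on S (k i p)" if "i \<in> I" for i p S
    using continuous_on_compose2[OF k_joint[OF that, of UNIV], of S "\<lambda>t. (p, t)"]
    by (simp add: continuous_on_Pair continuous_on_id)
  have k_nonneg: "0 \<le> k i p t" if "i \<in> I" for i p t
    unfolding k_def using w(2)[OF that] by simp
  have W_cont: "continuous_on S (W i)" and M_cont: "continuous_on S (M i)" if "i \<in> I" for i S
  proof -
    have "continuous_on S (\<lambda>p. integral (cbox 0 T) (k i p))"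
      by (rule integral_continuous_on_param) (use k_joint[OF that] in \<open>simp add: split_beta\<close>)
    then show "continuous_on S (W i)" by (simp add: W_def[abs_def])
    have "continuous_on S (\<lambda>p. integral (cbox 0 T) (\<lambda>t. t * k i p t))"
      by (rule integral_continuous_on_param)
        (use k_joint[OF that] in \<open>auto simp: split_beta intro!: continuous_intros\<close>)
    then show "continuous_on S (M i)" by (simp add: M_def[abs_def])
  qed
  define D where "D i = {p. 0 < W i p}" for i
  show thesis
  proof (rule that[of T D "\<lambda>i p. M i p / W i p"])
    show "open (D i)" if "i \<in> I" for i
      unfolding D_def using W_cont[OF that] by (intro open_Collect_less continuous_intros)
    show "continuous_on (D i) (\<lambda>p. M i p / W i p)" if "i \<in> I" for i
      using W_cont[OF that] M_cont[OF that] by (intro continuous_intros) (auto simp: D_def)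
    show "\<psi> (M i p / W i p) p \<in> V i" if i: "i \<in> I" and p: "p \<in> D i" for i p
    proof -
      obtain a b where a_nonneg: "0 \<le> a" and a: "a \<le> M i p / W i p" "0 < k i p a" and b: "M i p / W i p \<le> b" "0 < k i p b"
        using weighted_mean_between[of T "k i p"] T k_cont[OF i] k_nonneg[OF i] p
        unfolding D_def W_def M_def by blast
      let ?s = "M i p / W i p - a"
      have *: "0 < w i (\<psi> t p) \<and> loss t p < N" if "0 < k i p t" for t
        using that w(2)[OF i, of "\<psi> t p"] by (auto simp: k_def zero_less_mult_iff max_def split: if_splits)
      have "\<psi> ?s (\<psi> a p) \<in> V i"
      proof (rule w(4)[OF i, of _ "b - a"])
        show "0 < w i (\<psi> a p)" using *[OF a(2)] by blast
        show "0 < w i (\<psi> (b - a) (\<psi> a p))" using *[OF b(2)] flow_plus[of "b - a" a p] by simp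
        show "loss (b - a) (\<psi> a p) \<le> N"
          using loss_plus[of "b - a" a p] loss_nonneg[OF a_nonneg, of p] *[OF b(2)] by simp
      qed (use a b in auto)
      then show ?thesis using flow_plus[of ?s a p] by simp
    qed
    show "\<exists>i\<in>I. p \<in> D i" if p: "loss T p < N" for p
    proof -
      obtain t i where t: "t \<in> {0..T}" "i \<in> I" "0 < w i (\<psi> t p)" using visit[OF p] by (auto simp: G_def)
      have "loss t p < N" using loss_mono[of t T p] t(1) p by simp
      then have "0 < k i p t" using t(3) by (simp add: k_def)
      then have "0 < W i p" unfolding W_def
        using positive_continuous_integral[OF k_cont[OF t(2)] T] k_nonneg[OF t(2)] t(1) by blast
      then show ?thesis using t(2) by (auto simp: D_def)
    qed
  qed fact
qed

end

section \<open>Relative category\<close>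

lemma rel_cat_le:
  assumes "finite \<U>" "\<And>U. U \<in> \<U> \<Longrightarrow> open U \<and> null_homotopic U" "S \<subseteq> \<Union>\<U>"
  shows "rel_cat S \<le> enat (card \<U>)"
  unfolding rel_cat_def by (rule Inf_lower) (use assms in blast)

lemma rel_cat_attained:
  assumes "rel_cat S \<noteq> \<infinity>"
  obtains \<U> where "finite \<U>" "\<And>U. U \<in> \<U> \<Longrightarrow> open U \<and> null_homotopic U" "S \<subseteq> \<Union>\<U>"
    "rel_cat S = enat (card \<U>)"
proof -
  let ?C = "{enat (card \<U>) | \<U>. finite \<U> \<and> (\<forall>U\<in>\<U>. open U \<and> null_homotopic U) \<and> S \<subseteq> \<Union>\<U>}"
  have ne: "?C \<noteq> {}"
  proof
    assume "?C = {}"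
    then have "rel_cat S = \<infinity>" unfolding rel_cat_def Inf_enat_def by (simp only: refl if_True)
    then show False using assms by simp
  qed
  then obtain e where "e \<in> ?C" by blast
  then have "(LEAST e. e \<in> ?C) \<in> ?C" by (rule LeastI)
  then have "rel_cat S \<in> ?C" unfolding rel_cat_def Inf_enat_def if_not_P[OF ne] .
  then show thesis using that by blast
qed

text \<open>The deformation into \<open>U\<close> is followed by the contraction of
  \<open>U\<close>; intermediate stages may leave both sets.\<close>

lemma null_homotopic_deform:
  fixes H :: "'a::topological_space \<times> real \<Rightarrow> 'a"
  assumes H: "continuous_on (D \<times> {0..1}) H" "\<And>p. p \<in> D \<Longrightarrow> H (p, 0) = p" "\<And>p. p \<in> D \<Longrightarrow> H (p, 1) \<in> U"
    and U: "null_homotopic U"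
  shows "null_homotopic D"
proof -
  obtain a where a: "homotopic_with_canon (\<lambda>_. True) U UNIV id (\<lambda>_. a)"
    using U unfolding null_homotopic_def by blast
  have c1: "continuous_on D (\<lambda>p. H (p, 1))"
    by (rule continuous_on_compose2[OF H(1)]) (auto intro!: continuous_intros)
  have "homotopic_with_canon (\<lambda>_. True) D UNIV (id \<circ> (\<lambda>p. H (p, 1))) ((\<lambda>_. a) \<circ> (\<lambda>p. H (p, 1)))"
    by (rule homotopic_with_compose_continuous_right[where X = U]) (use a c1 H(3) in auto)
  then have 1: "homotopic_with_canon (\<lambda>_. True) D UNIV (\<lambda>p. H (p, 1)) (\<lambda>_. a)" by (simp add: o_def)
  have "continuous_on ({0..1} \<times> D) (\<lambda>z. H (snd z, fst z))"
    by (rule continuous_on_compose2[OF H(1)]) (auto intro!: continuous_intros)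
  then have "homotopic_with_canon (\<lambda>_. True) D UNIV id (\<lambda>p. H (p, 1))"
    using H(2) by (subst homotopic_with)
      (auto simp: prod_topology_subtopology_eu intro!: exI[of _ "\<lambda>z. H (snd z, fst z)"])
  then show ?thesis using homotopic_with_trans[OF _ 1] unfolding null_homotopic_def by blast
qed

text \<open>The covers are pulled back along the end maps of the deformations; each preimage deforms
  into a null-homotopic set. Preimages may coincide, whence only an inequality of
  cardinalities.\<close>

lemma rel_cat_le_sum:
  fixes H :: "'i \<Rightarrow> 'a::topological_space \<times> real \<Rightarrow> 'a"
  assumes I: "finite I"
    and \<U>: "\<And>i. i \<in> I \<Longrightarrow> finite (\<U> i)" "\<And>i U. i \<in> I \<Longrightarrow> U \<in> \<U> i \<Longrightarrow> open U \<and> null_homotopic U"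
    and D: "\<And>i. i \<in> I \<Longrightarrow> open (D i)"
    and H: "\<And>i. i \<in> I \<Longrightarrow> continuous_on (D i \<times> {0..1}) (H i)" "\<And>i p. i \<in> I \<Longrightarrow> p \<in> D i \<Longrightarrow> H i (p, 0) = p"
      "\<And>i p. i \<in> I \<Longrightarrow> p \<in> D i \<Longrightarrow> H i (p, 1) \<in> \<Union>(\<U> i)"
    and S: "S \<subseteq> (\<Union>i\<in>I. D i)"
  shows "rel_cat S \<le> enat (\<Sum>i\<in>I. card (\<U> i))"
proof -
  define E where "E i U = D i \<inter> (\<lambda>p. H i (p, 1)) -` U" for i U
  define \<V> where "\<V> = (\<Union>i\<in>I. E i ` \<U> i)"
  have "rel_cat S \<le> enat (card \<V>)"
  proof (rule rel_cat_le)
    show "finite \<V>" using I \<U> by (simp add: \<V>_def)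
    show "S \<subseteq> \<Union>\<V>"
    proof
      fix p assume "p \<in> S"
      then obtain i where i: "i \<in> I" "p \<in> D i" using S by blast
      then obtain U where "U \<in> \<U> i" "H i (p, 1) \<in> U" using H(3) by blast
      then show "p \<in> \<Union>\<V>" using i by (auto simp: \<V>_def E_def)
    qed
    fix U' assume "U' \<in> \<V>"
    then obtain i U where U: "i \<in> I" "U \<in> \<U> i" and U': "U' = E i U" by (auto simp: \<V>_def)
    have "continuous_on (D i) (\<lambda>p. H i (p, 1))"
      by (rule continuous_on_compose2[OF H(1)[OF U(1)]]) (auto intro!: continuous_intros)
    then have "open ((\<lambda>p. H i (p, 1)) -` U \<inter> D i)"
      using continuous_on_open_vimage[OF D[OF U(1)]] \<U>(2)[OF U] by blast
    then have "open U'" by (simp add: U' E_def Int_commute)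
    moreover have "null_homotopic U'"
    proof (rule null_homotopic_deform)
      show "continuous_on (U' \<times> {0..1}) (H i)"
        by (rule continuous_on_subset[OF H(1)[OF U(1)]]) (auto simp: U' E_def)
      show "null_homotopic U" using \<U>(2)[OF U] by blast
    qed (use H(2)[OF U(1)] in \<open>auto simp: U' E_def\<close>)
    ultimately show "open U' \<and> null_homotopic U'" ..
  qed
  also have "card \<V> \<le> (\<Sum>i\<in>I. card (E i ` \<U> i))" unfolding \<V>_def by (rule card_UN_le[OF I])
  also have "\<dots> \<le> (\<Sum>i\<in>I. card (\<U> i))" by (intro sum_mono card_image_le \<U>(1))
  finally show ?thesis by simp
qed

section \<open>The Poincare lemma\<close>

lemma Ck_on_subset: "Ck_on n S f \<Longrightarrow> T \<subseteq> S \<Longrightarrow> Ck_on n T f"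
  by (induction n arbitrary: f) (auto intro: continuous_on_subset)

lemma Ck_on_cong:
  assumes "open S" "Ck_on n S f" "\<And>x. x \<in> S \<Longrightarrow> f x = g x"
  shows "Ck_on n S g"
  using assms(2,3)
proof (induction n arbitrary: f g)
  case 0
  then show ?case using continuous_on_eq[of S f g] by simp
next
  case (Suc n)
  have diff: "g differentiable (at x)" if x: "x \<in> S" for x
  proof -
    have "f differentiable (at x)" using Suc.prems(1) x by simp
    then obtain f' where "(f has_derivative f') (at x)" unfolding differentiable_def by blast
    then have "(g has_derivative f') (at x)"
      by (rule has_derivative_transform_within_open[OF _ assms(1) x]) (rule Suc.prems(2))
    then show ?thesis unfolding differentiable_def by blast
  qed
  have "Ck_on n S (\<lambda>x. frechet_derivative g (at x) h)" for h
  proof (rule Suc.IH)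
    show "Ck_on n S (\<lambda>x. frechet_derivative f (at x) h)" using Suc.prems by simp
    fix x assume x: "x \<in> S"
    have "frechet_derivative f (at x) = frechet_derivative g (at x)"
      using Suc.prems x by (intro frechet_derivative_transform_within_open[OF _ assms(1) x]) auto
    then show "frechet_derivative f (at x) h = frechet_derivative g (at x) h" by simp
  qed
  then show ?case using diff by simp
qed

lemma linear_eq_sum_Basis:
  fixes f :: "'e::euclidean_space \<Rightarrow> real"
  assumes "linear f"
  shows "f h = (\<Sum>b\<in>Basis. (h \<bullet> b) * f b)"
proof -
  have "f h = f (\<Sum>b\<in>Basis. (h \<bullet> b) *\<^sub>R b)" by (simp add: euclidean_representation)
  also have "\<dots> = (\<Sum>b\<in>Basis. (h \<bullet> b) * f b)"
    by (simp add: linear_sum[OF assms] linear_scale[OF assms])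
  finally show ?thesis .
qed

text \<open>
  The primitive is the integral along radii. Differentiating it along a segment, closedness turns
  the derivative of the integrand into a derivative along the radius.
\<close>

lemma Poincare_lemma_ball:
  fixes a :: "'e::euclidean_space \<Rightarrow> 'e \<Rightarrow> real"
  assumes lin: "\<And>z. z \<in> ball x0 r \<Longrightarrow> linear (a z)"
    and C1: "\<And>h. Ck_on (Suc 0) (ball x0 r) (\<lambda>z. a z h)"
    and closed: "\<And>z h k. z \<in> ball x0 r \<Longrightarrow>
      frechet_derivative (\<lambda>y. a y k) (at z) h = frechet_derivative (\<lambda>y. a y h) (at z) k"
  obtains f where "\<And>x. x \<in> ball x0 r \<Longrightarrow> (f has_derivative a x) (at x)"
proof -
  define Da where "Da k z = frechet_derivative (\<lambda>y. a y k) (at z)" for k z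
  have der: "((\<lambda>y. a y k) has_derivative Da k z) (at z)" if "z \<in> ball x0 r" for k z
    using C1[of k] that unfolding Da_def by (auto simp flip: frechet_derivative_works)
  have Da_lin: "linear (Da k z)" if "z \<in> ball x0 r" for k z
    by (rule has_derivative_linear[OF der[OF that]])
  have Da_cont: "continuous_on (ball x0 r) (\<lambda>z. Da k z h)" for k h
    using C1[of k] unfolding Da_def by simp
  have a_cont: "continuous_on (ball x0 r) (\<lambda>z. a z k)" for k
    by (intro continuous_at_imp_continuous_on ballI has_derivative_continuous[OF der])
  define f where "f x = integral {0..1} (\<lambda>t. a (x0 + t *\<^sub>R (x - x0)) (x - x0))" for x
  \<comment> \<open>A mean value form of the increment. Continuity of the coefficients then suffices
    for the derivative of \<open>f\<close>.\<close>
  have increment: "\<exists>s\<in>{0<..<1}. f (x + h) - f x = a (x + s *\<^sub>R h) h"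
    if x: "x \<in> ball x0 r" and h: "x + h \<in> ball x0 r" for x h
  proof -
    define w where "w s = x - x0 + s *\<^sub>R h" for s
    define z where "z s t = x0 + t *\<^sub>R w s" for s t
    have z_in: "z s t \<in> ball x0 r" if "s \<in> {0..1}" "t \<in> {0..1}" for s t
    proof -
      have "0 < r" using x zero_le_dist[of x0 x] unfolding mem_ball by linarith
      then have "x0 \<in> ball x0 r" by simp
      moreover have "x + s *\<^sub>R h \<in> ball x0 r"
      proof -
        have "(1 - s) *\<^sub>R x + s *\<^sub>R (x + h) \<in> ball x0 r"
          using x h that by (intro convexD[OF convex_ball]) auto
        then show ?thesis by (simp add: algebra_simps)
      qed
      ultimately have "(1 - t) *\<^sub>R x0 + t *\<^sub>R (x + s *\<^sub>R h) \<in> ball x0 r"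
        using that by (intro convexD[OF convex_ball]) auto
      then show ?thesis by (simp add: z_def w_def algebra_simps)
    qed
    define F where "F s t = a (z s t) (w s)" for s t
    \<comment> \<open>The \<open>s\<close>-derivative of \<open>F\<close>, already rewritten by
      closedness: the coefficient in direction \<open>h\<close> is differentiated along
      \<open>w s\<close>. In this shape it is also the \<open>t\<close>-derivative of
      \<open>t * a (z s t) h\<close>, so it integrates at once.\<close>
    define F' where "F' s t = a (z s t) h + t * Da h (z s t) (w s)" for s t
    \<comment> \<open>Base point and argument of \<open>a\<close> both depend on \<open>s\<close>,
      while differentiability is given for fixed arguments; a basis expansion separates the
      two.\<close>
    have F_sum: "F s t = (\<Sum>b\<in>Basis. (w s \<bullet> b) * a (z s t) b)" if "s \<in> {0..1}" "t \<in> {0..1}" for s t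
      unfolding F_def by (rule linear_eq_sum_Basis[OF lin[OF z_in[OF that]]])
    have F'_sum: "F' s t = (\<Sum>b\<in>Basis. (h \<bullet> b) * a (z s t) b + (w s \<bullet> b) * (t * Da b (z s t) h))"
      if "s \<in> {0..1}" "t \<in> {0..1}" for s t
    proof -
      note zi = z_in[OF that]
      have "Da h (z s t) (w s) = (\<Sum>b\<in>Basis. (w s \<bullet> b) * Da h (z s t) b)"
        by (rule linear_eq_sum_Basis[OF Da_lin[OF zi]])
      also have "\<dots> = (\<Sum>b\<in>Basis. (w s \<bullet> b) * Da b (z s t) h)"
        using closed[OF zi] by (simp add: Da_def)
      finally show ?thesis
        unfolding F'_def linear_eq_sum_Basis[OF lin[OF zi], of h]
        by (simp add: sum.distrib sum_distrib_left algebra_simps)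
    qed
    have zs: "((\<lambda>s. z s t) has_derivative (\<lambda>r. r *\<^sub>R (t *\<^sub>R h))) (at s within S)" for s t S
      unfolding z_def w_def by (auto intro!: derivative_eq_intros simp: algebra_simps)
    have zt: "((\<lambda>t. z s t) has_derivative (\<lambda>r. r *\<^sub>R w s)) (at t within S)" for s t S
      unfolding z_def by (auto intro!: derivative_eq_intros)
    have ws: "((\<lambda>s. w s \<bullet> b) has_real_derivative h \<bullet> b) (at s within S)" for s b S
      unfolding w_def by (auto intro!: derivative_eq_intros simp: inner_add_left has_field_derivative_def)
    have F_der: "((\<lambda>s. F s t) has_vector_derivative F' s t) (at s within {0..1})"
      if s: "s \<in> {0..1}" and t: "t \<in> {0..1}" for s t
    proof -
      have "((\<lambda>s. a (z s t) b) has_real_derivative t * Da b (z s t) h) (at s within {0..1})" for b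
      proof -
        have "((\<lambda>s. a (z s t) b) has_derivative (\<lambda>r. Da b (z s t) (r *\<^sub>R (t *\<^sub>R h)))) (at s within {0..1})"
          by (rule has_derivative_compose[OF zs der[OF z_in[OF s t]]])
        then show ?thesis
          by (simp add: linear_scale[OF Da_lin[OF z_in[OF s t]]] has_real_derivative_iff_has_vector_derivative
              has_vector_derivative_def mult_ac)
      qed
      then have "((\<lambda>s. \<Sum>b\<in>Basis. (w s \<bullet> b) * a (z s t) b) has_real_derivative
          (\<Sum>b\<in>Basis. (h \<bullet> b) * a (z s t) b + (t * Da b (z s t) h) * (w s \<bullet> b))) (at s within {0..1})"
        by (intro DERIV_sum DERIV_mult ws)
      then have "((\<lambda>s. \<Sum>b\<in>Basis. (w s \<bullet> b) * a (z s t) b) has_real_derivative F' s t) (at s within {0..1})"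
        unfolding F'_sum[OF s t] by (simp add: mult.commute)
      then have "((\<lambda>s. F s t) has_real_derivative F' s t) (at s within {0..1})"
        by (rule has_field_derivative_transform_within[OF _ zero_less_one s]) (use t in \<open>simp add: F_sum\<close>)
      then show ?thesis by (simp add: has_real_derivative_iff_has_vector_derivative)
    qed
    have z_cont: "continuous_on S (\<lambda>p. z (fst p) (snd p))" for S
      unfolding z_def w_def by (intro continuous_intros)
    have F'_cont: "continuous_on ({0..1} \<times> cbox 0 1) (\<lambda>(s, t). F' s t)"
    proof -
      have zc: "continuous_on ({0..1} \<times> {0..1}) (\<lambda>p. k (z (fst p) (snd p)))"
        if "continuous_on (ball x0 r) k" for k :: "'e \<Rightarrow> real"
        by (rule continuous_on_compose2[OF that z_cont]) (use z_in in auto)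
      have "continuous_on ({0..1} \<times> {0..1}) (\<lambda>p. \<Sum>b\<in>Basis. (h \<bullet> b) * a (z (fst p) (snd p)) b +
          (w (fst p) \<bullet> b) * (snd p * Da b (z (fst p) (snd p)) h))"
        unfolding w_def by (intro continuous_intros zc[OF a_cont] zc[OF Da_cont])
      then show ?thesis
        by (rule continuous_on_eq[THEN iffD1[OF continuous_on_cong[OF _ refl], rotated]]) (auto simp: F'_sum split_beta)
    qed
    have F_int: "F s integrable_on cbox 0 1" if s: "s \<in> {0..1}" for s
    proof -
      have "continuous_on {0..1} (\<lambda>t. \<Sum>b\<in>Basis. (w s \<bullet> b) * a (z s t) b)"
        by (intro continuous_intros continuous_on_compose2[OF a_cont])
          (use z_in[OF s] in \<open>auto simp: z_def intro!: continuous_intros\<close>)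
      then have "continuous_on {0..1} (F s)" by (rule continuous_on_eq) (use s in \<open>simp add: F_sum\<close>)
      then show ?thesis by (simp add: integrable_continuous_real)
    qed
    have F'_integral: "integral (cbox 0 1) (F' s) = a (x + s *\<^sub>R h) h" if s: "s \<in> {0..1}" for s
    proof -
      have "(F' s has_integral (1 * a (z s 1) h - 0 * a (z s 0) h)) {0..1}"
      proof (rule fundamental_theorem_of_calculus)
        fix t :: real assume t: "t \<in> {0..1}"
        have "((\<lambda>t. a (z s t) h) has_derivative (\<lambda>r. Da h (z s t) (r *\<^sub>R w s))) (at t within {0..1})"
          by (rule has_derivative_compose[OF zt der[OF z_in[OF s t]]])
        then have "((\<lambda>t. a (z s t) h) has_real_derivative Da h (z s t) (w s)) (at t within {0..1})"
          by (simp add: linear_scale[OF Da_lin[OF z_in[OF s t]]] has_real_derivative_iff_has_vector_derivative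
              has_vector_derivative_def mult_ac)
        from DERIV_mult[OF DERIV_ident this]
        show "((\<lambda>t. t * a (z s t) h) has_vector_derivative F' s t) (at t within {0..1})"
          by (simp add: F'_def has_real_derivative_iff_has_vector_derivative algebra_simps)
      qed simp
      then show ?thesis by (simp add: integral_unique z_def w_def)
    qed
    have G_eq: "f (x + s *\<^sub>R h) = integral (cbox 0 1) (F s)" for s
    proof -
      have "x + s *\<^sub>R h - x0 = w s" by (simp add: w_def)
      then show ?thesis by (simp add: f_def F_def[abs_def] z_def)
    qed
    have "((\<lambda>s. f (x + s *\<^sub>R h)) has_vector_derivative a (x + s *\<^sub>R h) h) (at s within {0..1})"
      if "s \<in> {0..1}" for s
      unfolding G_eq F'_integral[OF that, symmetric]
      by (rule leibniz_rule_vector_derivative[OF _ F_int F'_cont that]) (use F_der in auto)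
    then have "\<exists>s\<in>{0<..<1}. f (x + 1 *\<^sub>R h) - f (x + 0 *\<^sub>R h) = (1 - 0) *\<^sub>R a (x + s *\<^sub>R h) h"
      unfolding has_vector_derivative_def by (intro mvt_simple) auto
    then show ?thesis by simp
  qed
  show thesis
  proof
    fix x assume x: "x \<in> ball x0 r"
    show "(f has_derivative a x) (at x)"
      unfolding has_derivative_at_alt
    proof (intro conjI allI impI)
      show "bounded_linear (a x)" using lin[OF x] linear_conv_bounded_linear by blast
      fix e :: real assume e: "0 < e"
      \<comment> \<open>The sum over the basis controls the coefficients in all directions at
        once.\<close>
      define \<sigma> where "\<sigma> y = (\<Sum>b\<in>Basis. \<bar>a y b - a x b\<bar>)" for y
      have "continuous_on (ball x0 r) \<sigma>" unfolding \<sigma>_def by (intro continuous_intros a_cont)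
      then have "isCont \<sigma> x" using x by (simp add: continuous_on_eq_continuous_at)
      then obtain d where d: "0 < d" "\<And>y. dist y x < d \<Longrightarrow> \<sigma> y < e"
        using e unfolding continuous_at_eps_delta dist_real_def by (force simp: \<sigma>_def)
      obtain d' where d': "0 < d'" "ball x d' \<subseteq> ball x0 r"
        using open_ball[of x0 r] x unfolding open_contains_ball by blast
      show "\<exists>d>0. \<forall>y. norm (y - x) < d \<longrightarrow> norm (f y - f x - a x (y - x)) \<le> e * norm (y - x)"
      proof (intro exI[of _ "min d d'"] conjI allI impI)
        fix y assume y: "norm (y - x) < min d d'"
        define h where "h = y - x"
        have "y \<in> ball x d'" using y by (simp add: dist_norm norm_minus_commute)
        then have "x + h \<in> ball x0 r" using d' by (auto simp: h_def)
        then obtain s where s: "s \<in> {0<..<1}" "f (x + h) - f x = a (x + s *\<^sub>R h) h"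
          using increment[OF x] by blast
        have "norm (s *\<^sub>R h) \<le> norm h" using s(1) by (simp add: mult_left_le_one_le)
        then have near: "norm (s *\<^sub>R h) < min d d'" using y by (simp add: h_def)
        then have "x + s *\<^sub>R h \<in> ball x d'" by (simp add: dist_norm)
        then have in_ball: "x + s *\<^sub>R h \<in> ball x0 r" using d' by blast
        have "f y - f x - a x h = a (x + s *\<^sub>R h) h - a x h" using s(2) by (simp add: h_def)
        also have "\<dots> = (\<Sum>b\<in>Basis. (h \<bullet> b) * (a (x + s *\<^sub>R h) b - a x b))"
          unfolding linear_eq_sum_Basis[OF lin[OF in_ball], of h] linear_eq_sum_Basis[OF lin[OF x], of h]
          by (simp add: sum_subtractf algebra_simps)
        also have "norm \<dots> \<le> (\<Sum>b\<in>Basis. norm h * \<bar>a (x + s *\<^sub>R h) b - a x b\<bar>)"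
          by (rule sum_norm_le) (auto simp: abs_mult intro!: mult_right_mono Basis_le_norm)
        also have "\<dots> = norm h * \<sigma> (x + s *\<^sub>R h)" by (simp add: \<sigma>_def sum_distrib_left)
        also have "\<dots> \<le> norm h * e"
          using d(2)[of "x + s *\<^sub>R h"] near by (intro mult_left_mono) (auto simp: dist_norm)
        finally show "norm (f y - f x - a x (y - x)) \<le> e * norm (y - x)"
          by (simp add: h_def mult.commute)
      qed (use d d' in auto)
    qed
  qed
qed

section \<open>Local primitives on a manifold\<close>

context atlas
begin

lemma pairing_eq:
  assumes c: "c \<in> charts_at A p" and \<theta>: "\<theta> \<in> cotangent_space A p" and X: "X \<in> tangent_space A p"
  shows "pairing A p \<theta> X = \<theta> c (X c)"
proof -
  define d where "d = (SOME c. c \<in> charts_at A p)"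
  have d: "d \<in> charts_at A p" unfolding d_def using c by (rule someI)
  have "\<theta> c (X c) = \<theta> d (d_transition c d p (X c))" using \<theta> c d unfolding cotangent_space_def by blast
  also have "d_transition c d p (X c) = X d"
  proof (rule sym)
    show "X d = d_transition c d p (X c)" using X c d unfolding tangent_space_def by blast
  qed
  finally show ?thesis unfolding pairing_def Let_def d_def[symmetric] by (rule sym)
qed

lemma locally_path_connected:
  fixes U :: "'a set"
  assumes "open U" "p \<in> U"
  shows "\<exists>W. open W \<and> p \<in> W \<and> W \<subseteq> U \<and> path_connected W"
proof -
  obtain c where c: "c \<in> charts_at A p" by (rule charts_at_nonempty)
  note cA = charts_atD(1)[OF c] and cp = charts_atD(2)[OF c]
  have "open (coord c ` (U \<inter> chart_dom c))"
    using assms open_chart_dom[OF cA] by (intro open_coord_image_subset[OF cA]) auto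
  moreover have "coord c p \<in> coord c ` (U \<inter> chart_dom c)" using cp assms by blast
  ultimately obtain r where r: "0 < r" "ball (coord c p) r \<subseteq> coord c ` (U \<inter> chart_dom c)"
    using open_contains_ball by blast
  define W where "W = chart_dom c \<inter> coord c -` ball (coord c p) r"
  have W_eq: "W = inv_coord c ` ball (coord c p) r"
  proof
    show "W \<subseteq> inv_coord c ` ball (coord c p) r"
      using inv_coord_coord[OF cA] by (force simp: W_def)
    show "inv_coord c ` ball (coord c p) r \<subseteq> W"
      using r(2) inv_coord_in[OF cA] coord_inv_coord[OF cA] by (fastforce simp: W_def)
  qed
  have "path_connected W"
    unfolding W_eq using r(2)
    by (intro path_connected_continuous_image continuous_on_subset[OF continuous_on_inv_coord[OF cA]]
        convex_imp_path_connected) auto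
  moreover have "W \<subseteq> U"
    unfolding W_eq using r(2) inv_coord_coord[OF cA] by (fastforce simp: subset_iff image_iff)
  moreover have "open W" unfolding W_def by (rule open_coord_preimage[OF cA]) simp
  moreover have "p \<in> W" using cp r(1) by (simp add: W_def)
  ultimately show ?thesis by blast
qed

end

locale closed_form = atlas A for A :: "('a::t2_space, 'e::euclidean_space) chart set" +
  fixes \<omega> :: "'a \<Rightarrow> ('a, 'e) tcovec"
  assumes closed_form: "smooth_closed_one_form A \<omega>"
begin

lemma cotangent: "\<omega> p \<in> cotangent_space A p"
  and smooth: "c \<in> A \<Longrightarrow> smooth_on (coord c ` chart_dom c) (\<lambda>x. \<omega> (inv_coord c x) c h)"
  and exterior_derivative: "c \<in> A \<Longrightarrow> x \<in> coord c ` chart_dom c \<Longrightarrow>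
    frechet_derivative (\<lambda>y. \<omega> (inv_coord c y) c k) (at x) h =
    frechet_derivative (\<lambda>y. \<omega> (inv_coord c y) c h) (at x) k"
  using closed_form unfolding smooth_closed_one_form_def smooth_one_form_def by blast+

lemma linear_form: "c \<in> charts_at A p \<Longrightarrow> linear (\<omega> p c)"
  using cotangent[of p] unfolding cotangent_space_def by blast

text \<open>Smoothness is automatic: the derivative of \<open>f\<close> is \<omega>, whose
  coefficients have derivatives of every order.\<close>

lemma primitive_onI:
  assumes U: "open U"
    and der: "\<And>p c. p \<in> U \<Longrightarrow> c \<in> charts_at A p \<Longrightarrow> ((f \<circ> inv_coord c) has_derivative \<omega> p c) (at (coord c p))"
  shows "primitive_on A \<omega> U f"
  unfolding primitive_on_def smooth_fun_on_def smooth_on_def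
proof (intro conjI ballI allI)
  show "\<omega> p c = differential f p c" if "p \<in> U" "c \<in> charts_at A p" for p c
    unfolding differential_def by (rule frechet_derivative_at[OF der[OF that]])
  fix c n assume c: "c \<in> A"
  let ?S = "coord c ` (U \<inter> chart_dom c)"
  have open_S: "open ?S"
    using U open_chart_dom[OF c] by (intro open_coord_image_subset[OF c]) auto
  have der': "((f \<circ> inv_coord c) has_derivative \<omega> (inv_coord c x) c) (at x)" if x: "x \<in> ?S" for x
  proof -
    obtain p where p: "p \<in> U" "p \<in> chart_dom c" "x = coord c p" using x by blast
    then show ?thesis using der[of p c] c inv_coord_coord[OF c p(2)] by (simp add: charts_at_def)
  qed
  show "Ck_on n ?S (f \<circ> inv_coord c)"
  proof (cases n)
    case 0
    show ?thesis
      unfolding 0 Ck_on.simps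
      by (intro continuous_at_imp_continuous_on ballI has_derivative_continuous[OF der'])
  next
    case (Suc m)
    have "Ck_on m ?S (\<lambda>x. frechet_derivative (f \<circ> inv_coord c) (at x) h)" for h
    proof (rule Ck_on_cong[OF open_S])
      show "Ck_on m ?S (\<lambda>x. \<omega> (inv_coord c x) c h)"
        by (rule Ck_on_subset[of _ "coord c ` chart_dom c"]) (use smooth[OF c] in \<open>auto simp: smooth_on_def\<close>)
      show "\<omega> (inv_coord c x) c h = frechet_derivative (f \<circ> inv_coord c) (at x) h" if "x \<in> ?S" for x
        using frechet_derivative_at[OF der'[OF that]] by simp
    qed
    moreover have "(f \<circ> inv_coord c) differentiable (at x)" if "x \<in> ?S" for x
      using der'[OF that] unfolding differentiable_def by blast
    ultimately show ?thesis using Suc by simp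
  qed
qed

lemma primitive_on_has_derivative:
  assumes f: "primitive_on A \<omega> U f" and p: "p \<in> U" and c: "c \<in> charts_at A p"
  shows "((f \<circ> inv_coord c) has_derivative \<omega> p c) (at (coord c p))"
proof -
  have "Ck_on (Suc 0) (coord c ` (U \<inter> chart_dom c)) (f \<circ> inv_coord c)"
    using f charts_atD(1)[OF c] unfolding primitive_on_def smooth_fun_on_def smooth_on_def by blast
  then have "(f \<circ> inv_coord c) differentiable (at (coord c p))"
    using p charts_atD(2)[OF c] by auto
  then show ?thesis
    using f p c unfolding primitive_on_def differential_def by (metis frechet_derivative_works)
qed

text \<open>Covectors transform by the chain rule, so a primitive has to be checked in one chart
  around each point only.\<close>

lemma has_derivative_change_of_chart:
  assumes c: "c \<in> charts_at A p" and d: "d \<in> charts_at A p"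
    and der: "((f \<circ> inv_coord c) has_derivative \<omega> p c) (at (coord c p))"
  shows "((f \<circ> inv_coord d) has_derivative \<omega> p d) (at (coord d p))"
proof -
  note cA = charts_atD(1)[OF c] and dA = charts_atD(1)[OF d]
  note cp = charts_atD(2)[OF c] and dp = charts_atD(2)[OF d]
  have "transition d c (coord d p) = coord c p"
    by (simp add: transition_def inv_coord_coord[OF dA dp])
  then have "((f \<circ> inv_coord c \<circ> transition d c) has_derivative \<omega> p c \<circ> d_transition d c p) (at (coord d p))"
    using der by (intro diff_chain_at transition_has_derivative[OF d c]) simp
  moreover have "\<omega> p c \<circ> d_transition d c p = \<omega> p d"
  proof
    fix h
    have "\<omega> p d h = \<omega> p c (d_transition d c p h)"
      using cotangent[of p] c d unfolding cotangent_space_def by blast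
    then show "(\<omega> p c \<circ> d_transition d c p) h = \<omega> p d h" by simp
  qed
  ultimately have "((f \<circ> inv_coord c \<circ> transition d c) has_derivative \<omega> p d) (at (coord d p))" by simp
  moreover have "open (coord d ` (chart_dom c \<inter> chart_dom d))"
    using open_chart_dom[OF cA] open_chart_dom[OF dA] by (intro open_coord_image_subset[OF dA]) auto
  ultimately show ?thesis
    by (rule has_derivative_transform_within_open)
      (use cp dp inv_coord_coord[OF cA] inv_coord_coord[OF dA] in \<open>auto simp: transition_def\<close>)
qed

lemma local_primitive_exists:
  obtains U f where "open U" "p \<in> U" "primitive_on A \<omega> U f"
proof -
  obtain c where c: "c \<in> charts_at A p" by (rule charts_at_nonempty)
  note cA = charts_atD(1)[OF c] and cp = charts_atD(2)[OF c]
  obtain r where r: "0 < r" "ball (coord c p) r \<subseteq> coord c ` chart_dom c"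
    using open_contains_ball[of "coord c ` chart_dom c"] open_coord_image[OF cA] cp by blast
  obtain f where f: "\<And>x. x \<in> ball (coord c p) r \<Longrightarrow> (f has_derivative \<omega> (inv_coord c x) c) (at x)"
  proof (rule Poincare_lemma_ball[of "coord c p" r "\<lambda>x. \<omega> (inv_coord c x) c"])
    show "linear (\<omega> (inv_coord c z) c)" if "z \<in> ball (coord c p) r" for z
      using inv_coord_in[OF cA] r(2) that cA by (intro linear_form) (auto simp: charts_at_def)
    show "Ck_on (Suc 0) (ball (coord c p) r) (\<lambda>z. \<omega> (inv_coord c z) c h)" for h
      using smooth[OF cA] r(2) Ck_on_subset unfolding smooth_on_def by blast
    show "frechet_derivative (\<lambda>y. \<omega> (inv_coord c y) c k) (at z) h =
        frechet_derivative (\<lambda>y. \<omega> (inv_coord c y) c h) (at z) k" if "z \<in> ball (coord c p) r" for z h k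
      using exterior_derivative[OF cA] r(2) that by blast
  qed blast
  define U where "U = chart_dom c \<inter> coord c -` ball (coord c p) r"
  have "open U" unfolding U_def by (rule open_coord_preimage[OF cA]) simp
  moreover have "p \<in> U" using cp r by (simp add: U_def)
  moreover have "primitive_on A \<omega> U (f \<circ> coord c)"
  proof (rule primitive_onI[OF \<open>open U\<close>])
    fix q d assume q: "q \<in> U" and d: "d \<in> charts_at A q"
    have qc: "q \<in> chart_dom c" and qb: "coord c q \<in> ball (coord c p) r" using q by (auto simp: U_def)
    have "(f has_derivative \<omega> q c) (at (coord c q))" using f[OF qb] by (simp add: inv_coord_coord[OF cA qc])
    then have "((f \<circ> coord c \<circ> inv_coord c) has_derivative \<omega> q c) (at (coord c q))"
      by (rule has_derivative_transform_within_open[OF _ open_ball qb])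
        (use r(2) coord_inv_coord[OF cA] in auto)
    then show "((f \<circ> coord c \<circ> inv_coord d) has_derivative \<omega> q d) (at (coord d q))"
      using has_derivative_change_of_chart[of c q d] d cA qc by (simp add: charts_at_def)
  qed
  ultimately show thesis by (rule that)
qed

lemma primitive_on_continuous:
  assumes U: "open U" and f: "primitive_on A \<omega> U f"
  shows "continuous_on U f"
proof (intro continuous_at_imp_continuous_on ballI)
  fix p assume p: "p \<in> U"
  obtain c where c: "c \<in> charts_at A p" by (rule charts_at_nonempty)
  note cA = charts_atD(1)[OF c] and cp = charts_atD(2)[OF c]
  have "isCont (coord c) p"
    using continuous_on_coord[OF cA] cp open_chart_dom[OF cA] continuous_on_eq_continuous_at by blast
  moreover have "isCont (f \<circ> inv_coord c) (coord c p)"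
    by (rule has_derivative_continuous[OF primitive_on_has_derivative[OF f p c]])
  ultimately have cont: "isCont ((f \<circ> inv_coord c) \<circ> coord c) p" by (rule continuous_at_compose)
  have ev: "\<forall>\<^sub>F q in nhds p. ((f \<circ> inv_coord c) \<circ> coord c) q = f q"
    unfolding eventually_nhds using cp open_chart_dom[OF cA] inv_coord_coord[OF cA] by auto
  show "isCont f p" by (rule iffD1[OF isCont_cong[OF ev] cont])
qed

text \<open>On a coordinate ball, which is convex, the difference has derivative zero.\<close>

lemma primitives_differ_by_locally_constant:
  assumes U: "open U" "primitive_on A \<omega> U f" and V: "open V" "primitive_on A \<omega> V g"
  shows "locally_constant_on (U \<inter> V) (\<lambda>x. f x - g x)"
  unfolding locally_constant_on_def
proof
  fix p assume p: "p \<in> U \<inter> V"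
  obtain c where c: "c \<in> charts_at A p" by (rule charts_at_nonempty)
  note cA = charts_atD(1)[OF c] and cp = charts_atD(2)[OF c]
  have "open (coord c ` (U \<inter> V \<inter> chart_dom c))"
    using U V open_chart_dom[OF cA] by (intro open_coord_image_subset[OF cA]) auto
  moreover have "coord c p \<in> coord c ` (U \<inter> V \<inter> chart_dom c)" using cp p by blast
  ultimately obtain r where r: "0 < r" "ball (coord c p) r \<subseteq> coord c ` (U \<inter> V \<inter> chart_dom c)"
    using open_contains_ball by blast
  define W where "W = chart_dom c \<inter> coord c -` ball (coord c p) r"
  have W: "W \<subseteq> U \<inter> V"
  proof
    fix q assume "q \<in> W"
    then have q: "q \<in> chart_dom c" "coord c q \<in> ball (coord c p) r" by (auto simp: W_def)
    then obtain q' where q': "q' \<in> U \<inter> V \<inter> chart_dom c" "coord c q = coord c q'" using r(2) by blast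
    then have "q = q'" using inv_coord_coord[OF cA] q(1) by (metis IntD2)
    then show "q \<in> U \<inter> V" using q' by simp
  qed
  have "((\<lambda>x. (f \<circ> inv_coord c) x - (g \<circ> inv_coord c) x) has_derivative (\<lambda>h. 0)) (at x within ball (coord c p) r)"
    if x: "x \<in> ball (coord c p) r" for x
  proof -
    obtain q where q: "q \<in> U" "q \<in> V" "q \<in> chart_dom c" "x = coord c q" using r(2) x by blast
    then have cq: "c \<in> charts_at A q" using cA by (simp add: charts_at_def)
    have "((\<lambda>x. (f \<circ> inv_coord c) x - (g \<circ> inv_coord c) x) has_derivative (\<lambda>h. \<omega> q c h - \<omega> q c h)) (at x)"
      unfolding q(4)
      by (intro has_derivative_diff primitive_on_has_derivative[OF U(2) q(1) cq]
          primitive_on_has_derivative[OF V(2) q(2) cq])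
    then show ?thesis by (simp add: has_derivative_at_withinI)
  qed
  then have "\<exists>C. \<forall>x\<in>ball (coord c p) r. (f \<circ> inv_coord c) x - (g \<circ> inv_coord c) x = C"
    by (intro has_derivative_zero_constant convex_ball) auto
  then obtain C where C: "\<And>x. x \<in> ball (coord c p) r \<Longrightarrow> (f \<circ> inv_coord c) x - (g \<circ> inv_coord c) x = C"
    by blast
  have "f q - g q = C" if "q \<in> W" for q
    using C[of "coord c q"] that inv_coord_coord[OF cA] by (auto simp: W_def)
  then have "(\<lambda>x. f x - g x) constant_on W" unfolding constant_on_def by blast
  moreover have "open W" unfolding W_def by (rule open_coord_preimage[OF cA]) simp
  then have "openin (top_of_set (U \<inter> V)) W" using W by (simp add: open_subset)
  moreover have "p \<in> W" using cp r(1) by (simp add: W_def)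
  ultimately show "\<exists>W. openin (top_of_set (U \<inter> V)) W \<and> p \<in> W \<and> (\<lambda>x. f x - g x) constant_on W" by blast
qed

lemma closed_top_form_of: "closed_top_form (top_form_of A \<omega>)"
  unfolding closed_top_form_def
proof (intro conjI)
  show "\<forall>(U, f)\<in>top_form_of A \<omega>. open U \<and> continuous_on U f"
    using primitive_on_continuous by (auto simp: top_form_of_def)
  show "(\<Union>(U, f)\<in>top_form_of A \<omega>. U) = UNIV"
  proof (intro equalityI subsetI UNIV_I)
    fix p
    obtain U f where "open U" "p \<in> U" "primitive_on A \<omega> U f" by (rule local_primitive_exists)
    then show "p \<in> (\<Union>(U, f)\<in>top_form_of A \<omega>. U)" by (auto simp: top_form_of_def)
  qed
  show "\<forall>(U, f)\<in>top_form_of A \<omega>. \<forall>(V, g)\<in>top_form_of A \<omega>. locally_constant_on (U \<inter> V) (\<lambda>x. f x - g x)"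
    using primitives_differ_by_locally_constant by (auto simp: top_form_of_def)
qed

lemma primitive_along_curve_has_derivative:
  assumes \<gamma>: "integral_curve A u \<gamma>" and f: "primitive_on A \<omega> U f" and U: "open U" "\<gamma> t \<in> U"
    and u: "\<And>p. u p \<in> tangent_space A p"
  shows "((\<lambda>t. f (\<gamma> t)) has_real_derivative pairing A (\<gamma> t) (\<omega> (\<gamma> t)) (u (\<gamma> t))) (at t)"
proof -
  obtain c where c: "c \<in> charts_at A (\<gamma> t)" by (rule charts_at_nonempty)
  note cA = charts_atD(1)[OF c] and cp = charts_atD(2)[OF c]
  have "((coord c \<circ> \<gamma>) has_vector_derivative u (\<gamma> t) c) (at t)"
    using \<gamma> c by (simp add: integral_curve_def)
  then have "((f \<circ> inv_coord c \<circ> (coord c \<circ> \<gamma>)) has_derivative (\<omega> (\<gamma> t) c \<circ> (\<lambda>h. h *\<^sub>R u (\<gamma> t) c))) (at t)"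
    unfolding has_vector_derivative_def
    by (rule diff_chain_at) (simp add: primitive_on_has_derivative[OF f U(2) c])
  then have "((f \<circ> inv_coord c \<circ> (coord c \<circ> \<gamma>)) has_real_derivative \<omega> (\<gamma> t) c (u (\<gamma> t) c)) (at t)"
    by (simp add: linear_scale[OF linear_form[OF c]] o_def has_real_derivative_iff_has_vector_derivative
        has_vector_derivative_def)
  moreover have "open (\<gamma> -` chart_dom c)"
    using \<gamma> open_chart_dom[OF cA] by (intro open_vimage) (auto simp: integral_curve_def)
  ultimately have "((\<lambda>t. f (\<gamma> t)) has_real_derivative \<omega> (\<gamma> t) c (u (\<gamma> t) c)) (at t)"
    by (rule has_field_derivative_transform_within_open) (use cp inv_coord_coord[OF cA] in auto)
  then show ?thesis by (simp add: pairing_eq[OF c cotangent u])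
qed

text \<open>In every chart the pairing is the same finite sum of products of coefficients, whichever
  chart \<open>pairing\<close> picks at the single points.\<close>

lemma pairing_continuous:
  assumes u: "\<And>p. u p \<in> tangent_space A p"
    and cont: "\<And>c. c \<in> A \<Longrightarrow> continuous_on (coord c ` chart_dom c) (\<lambda>x. u (inv_coord c x) c)"
  shows "continuous_on UNIV (\<lambda>p. pairing A p (\<omega> p) (u p))"
proof -
  have "continuous_on (\<Union>c\<in>A. chart_dom c) (\<lambda>p. pairing A p (\<omega> p) (u p))"
  proof (rule continuous_on_open_UN)
    fix c assume c: "c \<in> A"
    show "open (chart_dom c)" by (rule open_chart_dom[OF c])
    have "continuous_on (coord c ` chart_dom c) (\<lambda>x. \<omega> (inv_coord c x) c b)" for b
      using smooth[OF c, of b] unfolding smooth_on_def by (metis Ck_on.simps(1))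
    then have "continuous_on (coord c ` chart_dom c)
        (\<lambda>x. \<Sum>b\<in>Basis. (u (inv_coord c x) c \<bullet> b) * \<omega> (inv_coord c x) c b)"
      by (intro continuous_intros cont[OF c])
    then have "continuous_on (chart_dom c) (\<lambda>p. \<Sum>b\<in>Basis. (u (inv_coord c (coord c p)) c \<bullet> b) *
        \<omega> (inv_coord c (coord c p)) c b)"
      by (rule continuous_on_compose2[OF _ continuous_on_coord[OF c]]) simp
    then show "continuous_on (chart_dom c) (\<lambda>p. pairing A p (\<omega> p) (u p))"
    proof (rule continuous_on_eq)
      fix p assume p: "p \<in> chart_dom c"
      then have cp: "c \<in> charts_at A p" using c by (simp add: charts_at_def)
      show "(\<Sum>b\<in>Basis. (u (inv_coord c (coord c p)) c \<bullet> b) * \<omega> (inv_coord c (coord c p)) c b) =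
          pairing A p (\<omega> p) (u p)"
        unfolding pairing_eq[OF cp cotangent u] inv_coord_coord[OF c p]
        by (rule linear_eq_sum_Basis[OF linear_form[OF cp], symmetric])
    qed
  qed
  moreover have "(\<Union>c\<in>A. chart_dom c) = UNIV" using smooth_atlas by (simp add: smooth_atlas_def)
  ultimately show ?thesis by simp
qed

end

section \<open>Gradient-like vector fields\<close>

lemma mono_bounded_tendsto_at_top:
  fixes F :: "real \<Rightarrow> real"
  assumes "mono F" "\<And>t. F t \<le> c"
  obtains B where "(F \<longlongrightarrow> B) at_top" "\<And>t. F t \<le> B"
proof -
  have bdd: "bdd_above (range F)" using assms(2) unfolding bdd_above_def by auto
  define B where "B = (SUP t. F t)"
  have le: "F t \<le> B" for t unfolding B_def by (rule cSUP_upper[OF UNIV_I bdd])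
  have "(F \<longlongrightarrow> B) at_top"
  proof (rule order_tendstoI)
    fix a assume "a < B"
    then obtain s where s: "a < F s" unfolding B_def using less_cSUP_iff[OF _ bdd] by auto
    have "a < F t" if "s \<le> t" for t using s monoD[OF assms(1) that] by simp
    then show "\<forall>\<^sub>F t in at_top. a < F t" unfolding eventually_at_top_linorder by blast
  next
    fix a assume "B < a"
    then show "\<forall>\<^sub>F t in at_top. F t < a" using le by (auto intro: always_eventually order_le_less_trans)
  qed
  then show thesis using le that by blast
qed

lemma disjoint_neighbourhoods:
  fixes Y :: "'i \<Rightarrow> 'a::t2_space set"
  assumes I: "finite I" and Y: "\<And>i. i \<in> I \<Longrightarrow> compact (Y i)"
    "\<And>i j. i \<in> I \<Longrightarrow> j \<in> I \<Longrightarrow> i \<noteq> j \<Longrightarrow> Y i \<inter> Y j = {}"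
    and U: "\<And>i. i \<in> I \<Longrightarrow> open (U i) \<and> Y i \<subseteq> U i"
  obtains V where "\<And>i. i \<in> I \<Longrightarrow> open (V i)" "\<And>i. i \<in> I \<Longrightarrow> Y i \<subseteq> V i" "\<And>i. i \<in> I \<Longrightarrow> V i \<subseteq> U i"
    "\<And>i j. i \<in> I \<Longrightarrow> j \<in> I \<Longrightarrow> i \<noteq> j \<Longrightarrow> V i \<inter> V j = {}"
    "\<And>i j. i \<in> I \<Longrightarrow> j \<in> I \<Longrightarrow> i \<noteq> j \<Longrightarrow> closure (V i) \<inter> Y j = {}"
proof -
  define B where "B i = (\<Union>j\<in>I - {i}. Y j)" for i
  have "\<exists>P Q. open P \<and> open Q \<and> Y i \<subseteq> P \<and> B i \<subseteq> Q \<and> P \<inter> Q = {}" if i: "i \<in> I" for i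
  proof -
    have "compact (B i)" unfolding B_def using I Y(1) by (intro compact_UN) auto
    moreover have "disjnt (Y i) (B i)" using Y(2)[OF i] by (auto simp: B_def disjnt_def)
    moreover have "Hausdorff_space (euclidean :: 'a topology)"
      unfolding Hausdorff_space_def disjnt_def using hausdorff by (metis open_openin)
    ultimately obtain P Q where "open P" "open Q" "Y i \<subseteq> P" "B i \<subseteq> Q" "disjnt P Q"
      using Hausdorff_space_compact_separation[of euclidean "Y i" "B i"] Y(1)[OF i] by auto
    then show ?thesis by (auto simp: disjnt_def)
  qed
  then obtain P Q where PQ: "\<And>i. i \<in> I \<Longrightarrow> open (P i) \<and> open (Q i) \<and> Y i \<subseteq> P i \<and> B i \<subseteq> Q i \<and> P i \<inter> Q i = {}"
    by metis
  \<comment> \<open>The sets \<open>Q j\<close> make \<open>V i\<close> disjoint from the other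
    \<open>P j\<close>, hence from the other \<open>V j\<close>. Disjointness from the open set
    \<open>Q i\<close>, which contains the other \<open>Y j\<close>, survives closure.\<close>
  define V where "V i = P i \<inter> (\<Inter>j\<in>I - {i}. Q j) \<inter> U i" for i
  show thesis
  proof (rule that[of V])
    show "open (V i)" if "i \<in> I" for i
      unfolding V_def using PQ U that I by (intro open_Int open_INT) auto
    show "Y i \<subseteq> V i" if i: "i \<in> I" for i
    proof -
      have "Y i \<subseteq> Q j" if "j \<in> I - {i}" for j
        using PQ[of j] i that unfolding B_def by blast
      then show ?thesis using PQ[OF i] U[OF i] unfolding V_def by blast
    qed
    show "V i \<subseteq> U i" if "i \<in> I" for i by (auto simp: V_def)
    show "V i \<inter> V j = {}" if "i \<in> I" "j \<in> I" "i \<noteq> j" for i j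
      using PQ[OF that(1)] that unfolding V_def by blast
    show "closure (V i) \<inter> Y j = {}" if "i \<in> I" "j \<in> I" "i \<noteq> j" for i j
    proof -
      have "Q i \<inter> V i = {}" using PQ[OF that(1)] unfolding V_def by blast
      then have "Q i \<inter> closure (V i) = {}"
        using open_Int_closure_eq_empty[of "Q i" "V i"] PQ[OF that(1)] by blast
      moreover have "Y j \<subseteq> Q i" using PQ[OF that(1)] that unfolding B_def by blast
      ultimately show ?thesis by blast
    qed
  qed
qed

section \<open>The descending flow of a gradient-like field\<close>

locale gradient_like_field = closed_form A \<omega>
  for A :: "('a::{t2_space, second_countable_topology}, 'e::euclidean_space) chart set"
    and \<omega> :: "'a \<Rightarrow> ('a, 'e) tcovec" +
  fixes v :: "'a \<Rightarrow> ('a, 'e) tvec"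
  assumes compact_manifold: "compact (UNIV :: 'a set)"
    and gradient_like: "gradient_like A \<omega> v"
begin

abbreviation descent_field :: "'a \<Rightarrow> ('a, 'e) tvec" where
  "descent_field \<equiv> \<lambda>q c. - v q c"

abbreviation descent :: "real \<Rightarrow> 'a \<Rightarrow> 'a" where
  "descent \<equiv> flow A descent_field"

definition rate :: "'a \<Rightarrow> real" where
  "rate p = pairing A p (\<omega> p) (v p)"

lemma tangent_v: "v p \<in> tangent_space A p"
  and smooth_v: "c \<in> A \<Longrightarrow> smooth_on (coord c ` chart_dom c) (\<lambda>x. v (inv_coord c x) c)"
  using gradient_like unfolding gradient_like_def smooth_vector_field_def by blast+

lemma rate_eq: "c \<in> charts_at A p \<Longrightarrow> rate p = \<omega> p c (v p c)"
  unfolding rate_def by (rule pairing_eq[OF _ cotangent tangent_v])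

lemma rate_zero_iff: "rate p = 0 \<longleftrightarrow> p \<in> zeros A \<omega>"
proof
  obtain c where c: "c \<in> charts_at A p" by (rule charts_at_nonempty)
  assume "p \<in> zeros A \<omega>"
  then show "rate p = 0" using c by (simp add: rate_eq[OF c] zeros_def vanishes_at_def)
next
  assume "rate p = 0"
  then show "p \<in> zeros A \<omega>"
    using gradient_like unfolding gradient_like_def lyapunov_one_form_def rate_def by fastforce
qed

lemma rate_nonneg': "0 \<le> rate p"
proof (cases "p \<in> zeros A \<omega>")
  case False
  then have "0 < rate p"
    using gradient_like unfolding gradient_like_def lyapunov_one_form_def rate_def by blast
  then show ?thesis by simp
next
  case True
  then show ?thesis using rate_zero_iff[of p] by simp
qed

sublocale C1_vector_field A descent_field
proof
  show "descent_field p \<in> tangent_space A p" for p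
    unfolding tangent_space_def
  proof (intro CollectI ballI)
    fix c d assume c: "c \<in> charts_at A p" and d: "d \<in> charts_at A p"
    have "v p d = d_transition c d p (v p c)" using tangent_v[of p] c d unfolding tangent_space_def by blast
    then show "- v p d = d_transition c d p (- v p c)"
      using linear_neg[OF has_derivative_linear[OF transition_has_derivative[OF c d]]] by simp
  qed
  fix c assume c: "c \<in> A"
  let ?w = "\<lambda>x. v (inv_coord c x) c" and ?S = "coord c ` chart_dom c"
  have w: "Ck_on (Suc 0) ?S ?w" using smooth_v[OF c] unfolding smooth_on_def by blast
  have der: "((\<lambda>x. - ?w x) has_derivative (\<lambda>h. - frechet_derivative ?w (at x) h)) (at x)" if "x \<in> ?S" for x
    using w that by (intro has_derivative_minus) (auto simp flip: frechet_derivative_works)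
  have "continuous_on ?S (\<lambda>x. frechet_derivative (\<lambda>x. - ?w x) (at x) h)" for h
  proof (rule continuous_on_eq)
    show "continuous_on ?S (\<lambda>x. - frechet_derivative ?w (at x) h)"
      using w by (intro continuous_intros) simp
    show "- frechet_derivative ?w (at x) h = frechet_derivative (\<lambda>x. - ?w x) (at x) h" if "x \<in> ?S" for x
      using frechet_derivative_at[OF der[OF that]] by (rule fun_cong)
  qed
  moreover have "(\<lambda>x. - ?w x) differentiable (at x)" if "x \<in> ?S" for x
    using der[OF that] unfolding differentiable_def by blast
  ultimately show "Ck_on (Suc 0) ?S (\<lambda>x. - ?w x)" by simp
qed

sublocale dissipative_flow descent rate
proof
  show "continuous_on UNIV rate"
    unfolding rate_def[abs_def]
  proof (rule pairing_continuous[OF tangent_v])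
    show "continuous_on (coord c ` chart_dom c) (\<lambda>x. v (inv_coord c x) c)" if "c \<in> A" for c
      using smooth_v[OF that] unfolding smooth_on_def by (metis Ck_on.simps(1))
  qed
  \<comment> \<open>Invariance of the zeros is part of the Lyapunov property; it prevents other
    orbits from reaching zeros in finite time.\<close>
  show "rate (descent t p) = 0" if "rate p = 0" for t p
    using gradient_like that unfolding gradient_like_def lyapunov_one_form_def rate_zero_iff by blast
qed (use compact_manifold flow_continuous[OF compact_manifold] flow_0[OF compact_manifold]
    flow_add[OF compact_manifold] rate_nonneg' in auto)

lemma pairing_descent_field: "pairing A p (\<omega> p) (descent_field p) = - rate p"
proof -
  obtain c where c: "c \<in> charts_at A p" by (rule charts_at_nonempty)
  show ?thesis
    unfolding pairing_eq[OF c cotangent tangent] rate_eq[OF c]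
    by (rule linear_neg[OF linear_form[OF c]])
qed

text \<open>For a local primitive \<open>f\<close>, the sum of \<open>f\<close> and
  \<open>loss\<close> has derivative zero along the orbit, since \<omega> takes the value
  \<open>- rate\<close> on the descending field.\<close>

lemma primitive_along_descent:
  "primitive_along (top_form_of A \<omega>) (\<lambda>t. descent t p) UNIV (\<lambda>t. - loss t p)"
proof (rule primitive_alongI)
  fix t U f assume "(U, f) \<in> top_form_of A \<omega>" and t: "descent t p \<in> U"
  then have U: "open U" "primitive_on A \<omega> U f" by (auto simp: top_form_of_def)
  have "continuous_on UNIV (\<lambda>t. descent t p)" by (intro continuous_on_flow continuous_intros)
  then have "open ((\<lambda>t. descent t p) -` U)" using U(1) by (intro open_vimage)
  then obtain e where e: "0 < e" "ball t e \<subseteq> (\<lambda>t. descent t p) -` U"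
    using t open_contains_ball by blast
  have "((\<lambda>s. f (descent s p) + loss s p) has_real_derivative 0) (at s within ball t e)"
    if "s \<in> ball t e" for s
  proof -
    have "descent s p \<in> U" using e(2) that by blast
    from DERIV_add[OF primitive_along_curve_has_derivative[OF flow_integral_curve[OF compact_manifold]
        U(2,1) this tangent] loss_has_derivative[of p s]]
    show ?thesis by (simp add: pairing_descent_field has_field_derivative_at_within)
  qed
  then have "\<exists>C. \<forall>s\<in>ball t e. f (descent s p) + loss s p = C"
    by (intro has_field_derivative_zero_constant convex_ball)
  then obtain C where C: "\<And>s. s \<in> ball t e \<Longrightarrow> f (descent s p) + loss s p = C" by blast
  have "- loss s p - - loss t p = f (descent s p) - f (descent t p)" if "\<bar>s - t\<bar> < e" for s
    using C[of s] C[of t] that e(1) by (simp add: dist_real_def abs_minus_commute)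
  then show "\<exists>e>0. \<forall>s\<in>UNIV. \<bar>s - t\<bar> < e \<longrightarrow> - loss s p - - loss t p = f (descent s p) - f (descent t p)"
    using e(1) by blast
qed

lemma path_descent: "path (\<lambda>t. descent (t * T) p)"
  unfolding path_def by (intro continuous_on_flow continuous_intros)

lemma path_integral_descent: "path_integral (top_form_of A \<omega>) (\<lambda>t. descent (t * T) p) = - loss T p"
proof -
  have "primitive_along (top_form_of A \<omega>) (\<lambda>t. descent (t * T) p) {0..1} (\<lambda>t. - loss (t * T) p)"
    by (rule primitive_along_reparam[OF primitive_along_descent]) (auto intro!: continuous_intros)
  from path_integral_eq_increment[OF closed_top_form_of path_descent this]
  show ?thesis by (simp add: loss_0)
qed

lemma ascending_curve: "integral_curve A v (\<lambda>t. descent (- t) p)"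
  unfolding integral_curve_def
proof (intro conjI allI ballI)
  show "continuous_on UNIV (\<lambda>t. descent (- t) p)" by (intro continuous_on_flow continuous_intros)
  fix t c assume "c \<in> charts_at A (descent (- t) p)"
  then have "((coord c \<circ> (\<lambda>t. descent t p)) has_vector_derivative - v (descent (- t) p) c) (at (- t))"
    using flow_integral_curve[OF compact_manifold, of p] by (simp add: integral_curve_def)
  then have "(((coord c \<circ> (\<lambda>t. descent t p)) \<circ> uminus) has_vector_derivative
      (- 1) *\<^sub>R - v (descent (- t) p) c) (at t)"
    by (intro vector_diff_chain_at) (auto intro!: derivative_eq_intros)
  then show "((coord c \<circ> (\<lambda>t. descent (- t) p)) has_vector_derivative v (descent (- t) p) c) (at t)"
    by (simp add: o_def)
qed

lemma form_along_ascending: "form_along A \<omega> (\<lambda>t. descent (- t) p) t = rate (descent (- t) p)"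
proof -
  \<comment> \<open>The chart picked inside \<open>pairing\<close>; the velocity has to be evaluated
    in this very chart.\<close>
  define c where "c = (SOME c. c \<in> charts_at A (descent (- t) p))"
  have c: "c \<in> charts_at A (descent (- t) p)"
    unfolding c_def by (rule charts_at_nonempty) (rule someI)
  have "velocity (\<lambda>t. descent (- t) p) t c = v (descent (- t) p) c"
    unfolding velocity_def using ascending_curve c
    by (intro vector_derivative_at) (simp add: integral_curve_def)
  then show ?thesis
    unfolding pairing_def Let_def rate_eq[OF c] c_def[symmetric] by simp
qed

text \<open>A bounded monotone primitive has limits at both ends. As the integrand is nonnegative,
  these limits give integrability along with the value of the integral.\<close>

lemma integral_along_ascending:
  assumes bound: "\<And>a b. loss b p - loss a p \<le> N"
  shows "interval_lebesgue_integrable lborel (-\<infinity>) \<infinity> (form_along A \<omega> (\<lambda>t. descent (- t) p))"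
    and "(LBINT t=-\<infinity>..\<infinity>. form_along A \<omega> (\<lambda>t. descent (- t) p) t) \<le> N"
proof -
  define F where "F t = - loss (- t) p" for t
  define f where "f t = rate (descent (- t) p)" for t
  have f: "form_along A \<omega> (\<lambda>t. descent (- t) p) = f" by (simp add: fun_eq_iff form_along_ascending f_def)
  have F_mono: "mono F" unfolding F_def by (intro monoI) (simp add: loss_mono)
  have F_bound: "F b - F a \<le> N" for a b using bound[of "- a" "- b"] by (simp add: F_def)
  obtain B where B: "(F \<longlongrightarrow> B) at_top" "\<And>t. F t \<le> B"
    by (rule mono_bounded_tendsto_at_top[OF F_mono, of "F 0 + N"]) (use F_bound[of _ 0] in \<open>auto simp: algebra_simps\<close>)
  \<comment> \<open>The limit at minus infinity, obtained from the mirrored function at plus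
    infinity.\<close>
  obtain A' where A': "((\<lambda>t. - F (- t)) \<longlongrightarrow> A') at_top" "\<And>t. - F (- t) \<le> A'"
  proof (rule mono_bounded_tendsto_at_top)
    show "mono (\<lambda>t. - F (- t))" using F_mono by (auto simp: mono_def)
    show "- F (- t) \<le> N - F 0" for t using F_bound[of 0 "- t"] by simp
  qed blast
  have bot: "(F \<longlongrightarrow> - A') at_bot"
    unfolding filterlim_at_bot_mirror using tendsto_minus[OF A'(1)] by simp
  have der: "(F has_real_derivative f t) (at t)" for t
  proof -
    have "((\<lambda>t. - loss (- t) p) has_real_derivative - (f t * - 1)) (at t)"
      unfolding f_def
      by (intro DERIV_minus DERIV_chain2[OF loss_has_derivative]) (auto intro!: derivative_eq_intros)
    then show ?thesis by (simp add: F_def[abs_def])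
  qed
  have "continuous_on UNIV f"
    unfolding f_def by (intro continuous_on_rate continuous_on_flow continuous_intros)
  then have cont: "isCont f t" for t by (simp add: continuous_on_eq_continuous_at)
  have f_nonneg: "0 \<le> f t" for t unfolding f_def by (rule rate_nonneg)
  have FTC: "set_integrable lborel (einterval (-\<infinity>) \<infinity>) f" "(LBINT t=-\<infinity>..\<infinity>. f t) = B - - A'"
    by (rule interval_integral_FTC_nonneg[of _ _ F];
      use der cont B(1) bot f_nonneg in \<open>auto simp: ereal_tendsto_simps\<close>)+
  show "interval_lebesgue_integrable lborel (-\<infinity>) \<infinity> (form_along A \<omega> (\<lambda>t. descent (- t) p))"
    unfolding f interval_lebesgue_integrable_def using FTC(1) by simp
  have "B - - A' \<le> N"
  proof (rule tendsto_upperbound)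
    show "((\<lambda>t. F t - F (- t)) \<longlongrightarrow> B - - A') at_top"
      using tendsto_add[OF B(1) A'(1)] by simp
  qed (use F_bound in auto)
  then show "(LBINT t=-\<infinity>..\<infinity>. form_along A \<omega> (\<lambda>t. descent (- t) p) t) \<le> N"
    unfolding f FTC(2) .
qed

end

section \<open>Existence of the cycle of orbits\<close>

lemma (in gradient_like_field) homoclinic_cycle_exists:
  assumes Y: "bij_betw Y {1..k} (components (zeros A \<omega>))"
    and \<U>: "\<And>i. i \<in> {1..k} \<Longrightarrow> finite (\<U> i)"
      "\<And>i U. i \<in> {1..k} \<Longrightarrow> U \<in> \<U> i \<Longrightarrow> open U \<and> null_homotopic U"
      "\<And>i. i \<in> {1..k} \<Longrightarrow> Y i \<subseteq> \<Union>(\<U> i)"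
    and N: "0 < N"
    and no_cover: "\<And>T. 0 < T \<Longrightarrow> \<not> rel_cat {p. loss T p < N} \<le> enat (\<Sum>i=1..k. card (\<U> i))"
  shows "\<exists>(l::nat) (\<gamma> :: nat \<Rightarrow> real \<Rightarrow> 'a) (i :: nat \<Rightarrow> nat).
        1 \<le> l \<and> l \<le> k \<and> \<gamma> (l + 1) = \<gamma> 1 \<and>
        (\<forall>j\<in>{1..l}.
           integral_curve A v (\<gamma> j) \<and> range (\<gamma> j) \<inter> zeros A \<omega> = {} \<and>
           i j \<in> {1..k} \<and>
           (\<Inter>t. closure (\<gamma> j ` {t..})) \<subseteq> Y (i j) \<and>
           (\<Inter>t. closure (\<gamma> (j + 1) ` {..t})) \<subseteq> Y (i j) \<and>
           interval_lebesgue_integrable lborel (-\<infinity>) \<infinity> (form_along A \<omega> (\<gamma> j))) \<and>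
        (\<Sum>j=1..l. LBINT t=-\<infinity>..\<infinity>. form_along A \<omega> (\<gamma> j) t) \<le> real k * N"
proof -
  define I where "I = {1..k}"
  have zeros_eq: "zeros A \<omega> = {p. rate p = 0}" by (simp add: rate_zero_iff)
  have "closed (zeros A \<omega>)"
    unfolding zeros_eq using continuous_rate by (intro closed_Collect_eq continuous_intros)
  have Y_comp: "Y i \<in> components (zeros A \<omega>)" if "i \<in> I" for i
    using Y that unfolding bij_betw_def I_def by blast
  have Y_compact: "compact (Y i)" if "i \<in> I" for i
    using compact_Int_closed[OF compact_manifold closed_components[OF \<open>closed (zeros A \<omega>)\<close> Y_comp[OF that]]] by simp
  have Y_disjoint: "Y i \<inter> Y j = {}" if "i \<in> I" "j \<in> I" "i \<noteq> j" for i j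
  proof -
    have "Y i \<noteq> Y j" using Y that unfolding bij_betw_def inj_on_def I_def by blast
    then show ?thesis using components_nonoverlap[OF Y_comp[OF that(1)] Y_comp[OF that(2)]] by simp
  qed
  have Y_Union: "zeros A \<omega> = (\<Union>i\<in>I. Y i)"
    using Union_components[of "zeros A \<omega>"] Y unfolding bij_betw_def I_def by simp
  have \<U>_open: "open (\<Union>(\<U> i)) \<and> Y i \<subseteq> \<Union>(\<U> i)" if "i \<in> I" for i
    using \<U>(2,3) that unfolding I_def by blast
  have "finite I" by (simp add: I_def)
  obtain V where V: "\<And>i. i \<in> I \<Longrightarrow> open (V i)" "\<And>i. i \<in> I \<Longrightarrow> Y i \<subseteq> V i" "\<And>i. i \<in> I \<Longrightarrow> V i \<subseteq> \<Union>(\<U> i)"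
    "\<And>i j. i \<in> I \<Longrightarrow> j \<in> I \<Longrightarrow> i \<noteq> j \<Longrightarrow> V i \<inter> V j = {}"
    "\<And>i j. i \<in> I \<Longrightarrow> j \<in> I \<Longrightarrow> i \<noteq> j \<Longrightarrow> closure (V i) \<inter> Y j = {}"
    by (rule disjoint_neighbourhoods[of I Y "\<lambda>i. \<Union>(\<U> i)", OF \<open>finite I\<close> Y_compact Y_disjoint \<U>_open]) blast+
  \<comment> \<open>A zero in the closure of \<open>V i\<close> lies in some component, and that
    closure meets no component other than \<open>Y i\<close>.\<close>
  have in_Y: "p \<in> Y i" if i: "i \<in> I" and p: "p \<in> closure (V i)" "rate p = 0" for i p
  proof -
    have "p \<in> (\<Union>i\<in>I. Y i)" using p(2) Y_Union zeros_eq by blast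
    then obtain j where "j \<in> I" "p \<in> Y j" by blast
    then show ?thesis using V(5)[OF i, of j] p(1) by blast
  qed
  interpret isolated_zeros descent rate I V N
  proof
    show "\<exists>i\<in>I. p \<in> V i" if "rate p = 0" for p
    proof -
      have "p \<in> (\<Union>i\<in>I. Y i)" using that Y_Union zeros_eq by blast
      then show ?thesis using V(2) by blast
    qed
    show "p \<in> V i" if "i \<in> I" "p \<in> closure (V i)" "rate p = 0" for i p
      using in_Y[OF that] V(2)[OF that(1)] by blast
  qed (use V N \<open>finite I\<close> in auto)
  have limit_in_Y: "(\<Inter>t. closure (\<gamma> ` {t..})) \<subseteq> Y i" if conv: "converges_to \<gamma> i" for \<gamma> i
  proof -
    have "i \<in> I" using conv unfolding converges_to_def by blast
    then show ?thesis using limit_set_subset[OF conv] in_Y closure_subset[of "V i"] by blast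
  qed
  \<comment> \<open>Without returns the sets \<open>D i\<close> would cover the points of small loss
    and flow into the chosen covers of the components, against \<open>no_cover\<close>.\<close>
  have "\<exists>i\<in>I. returns i i"
  proof (rule ccontr)
    assume no: "\<not> ?thesis"
    obtain T D \<tau> where T: "0 < T" and D: "\<And>i. i \<in> I \<Longrightarrow> open (D i)" "\<And>i. i \<in> I \<Longrightarrow> continuous_on (D i) (\<tau> i)"
      "\<And>i p. i \<in> I \<Longrightarrow> p \<in> D i \<Longrightarrow> descent (\<tau> i p) p \<in> V i"
      "\<And>p. loss T p < N \<Longrightarrow> \<exists>i\<in>I. p \<in> D i"
      by (rule no_return_cover) (use no in blast)+
    have "rel_cat {p. loss T p < N} \<le> enat (\<Sum>i\<in>I. card (\<U> i))"
    proof (rule rel_cat_le_sum[where D = D and H = "\<lambda>i z. descent (snd z * \<tau> i (fst z)) (fst z)"])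
      show "continuous_on (D i \<times> {0..1}) (\<lambda>z. descent (snd z * \<tau> i (fst z)) (fst z))" if "i \<in> I" for i
        by (intro continuous_on_flow continuous_intros continuous_on_compose2[OF D(2)[OF that]]) auto
      show "descent (snd (p, 1) * \<tau> i (fst (p, 1))) (fst (p, 1)) \<in> \<Union>(\<U> i)" if "i \<in> I" "p \<in> D i" for i p
        using D(3)[OF that] V(3)[OF that(1)] by auto
    qed (use \<open>finite I\<close> \<U> D flow_zero in \<open>auto simp: I_def\<close>)
    then show False using no_cover[OF T] by (simp add: I_def)
  qed
  then obtain i0 where i0: "i0 \<in> I" "returns i0 i0" by blast
  obtain l J X where l: "1 \<le> l" "l \<le> card I" and J: "J l = J 0" "\<And>n. J n \<in> I"
    and conn: "\<And>n. connects (J n) (J (Suc n)) (X (J n))"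
    using returns_cycle[OF i0] by blast
  text \<open>The index is reversed because the descending orbits run against the orbits of \<open>v\<close>.\<close>
  define \<gamma> where "\<gamma> j = (\<lambda>t. descent (- t) (X (J (l + 1 - j))))" for j
  have bound: "loss b (X (J n)) - loss a (X (J n)) \<le> N" for a b n
    using conn[of n] unfolding connects_def by blast
  \<comment> \<open>The two curves belong to the indices \<open>J 0\<close> and \<open>J l\<close>,
    which coincide.\<close>
  have "\<gamma> (l + 1) = \<gamma> 1" by (simp add: \<gamma>_def J(1))
  moreover have "l \<le> k" using l(2) by (simp add: I_def)
  moreover have "\<forall>j\<in>{1..l}.
      integral_curve A v (\<gamma> j) \<and> range (\<gamma> j) \<inter> zeros A \<omega> = {} \<and> J (l + 1 - j) \<in> {1..k} \<and>
      (\<Inter>t. closure (\<gamma> j ` {t..})) \<subseteq> Y (J (l + 1 - j)) \<and>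
      (\<Inter>t. closure (\<gamma> (j + 1) ` {..t})) \<subseteq> Y (J (l + 1 - j)) \<and>
      interval_lebesgue_integrable lborel (-\<infinity>) \<infinity> (form_along A \<omega> (\<gamma> j))"
  proof (intro ballI conjI)
    fix j assume j: "j \<in> {1..l}"
    show "integral_curve A v (\<gamma> j)" unfolding \<gamma>_def by (rule ascending_curve)
    have "0 < rate (X (J (l + 1 - j)))" using conn unfolding connects_def by blast
    then have "0 < rate (\<gamma> j t)" for t unfolding \<gamma>_def by (rule rate_pos_flow)
    then show "range (\<gamma> j) \<inter> zeros A \<omega> = {}" unfolding zeros_eq by (auto simp: less_le)
    show "J (l + 1 - j) \<in> {1..k}" using J(2) by (simp add: I_def)
    show "(\<Inter>t. closure (\<gamma> j ` {t..})) \<subseteq> Y (J (l + 1 - j))"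
      unfolding \<gamma>_def using conn by (intro limit_in_Y) (simp add: connects_def)
    show "(\<Inter>t. closure (\<gamma> (j + 1) ` {..t})) \<subseteq> Y (J (l + 1 - j))"
    proof -
      \<comment> \<open>\<open>\<gamma> (j + 1)\<close> runs backwards along the descending orbit
        from \<open>J (l - j)\<close> to \<open>J (l + 1 - j)\<close>, so its past is the future of
        that orbit.\<close>
      let ?x = "X (J (l - j))"
      have "Suc (l - j) = l + 1 - j" using j by auto
      then have "converges_to (\<lambda>t. descent t ?x) (J (l + 1 - j))"
        using conn[of "l - j"] by (simp add: connects_def)
      from limit_in_Y[OF this]
      have *: "(\<Inter>t. closure ((\<lambda>t. descent t ?x) ` {t..})) \<subseteq> Y (J (l + 1 - j))" .
      have eq: "\<gamma> (j + 1) ` {..- t} = (\<lambda>t. descent t ?x) ` {t..}" for t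
      proof -
        have "\<gamma> (j + 1) ` {..- t} = (\<lambda>t. descent t ?x) ` (uminus ` {..- t})"
          unfolding image_image by (simp add: \<gamma>_def)
        then show ?thesis by simp
      qed
      have "(\<Inter>t. closure (\<gamma> (j + 1) ` {..t})) \<subseteq> (\<Inter>t. closure ((\<lambda>t. descent t ?x) ` {t..}))"
      proof (rule INT_greatest)
        fix t
        have "(\<Inter>t. closure (\<gamma> (j + 1) ` {..t})) \<subseteq> closure (\<gamma> (j + 1) ` {..- t})"
          by (rule INT_lower) simp
        then show "(\<Inter>t. closure (\<gamma> (j + 1) ` {..t})) \<subseteq> closure ((\<lambda>t. descent t ?x) ` {t..})"
          unfolding eq .
      qed
      then show ?thesis using * by (rule subset_trans)
    qed
    show "interval_lebesgue_integrable lborel (-\<infinity>) \<infinity> (form_along A \<omega> (\<gamma> j))"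
      unfolding \<gamma>_def by (rule integral_along_ascending(1)[OF bound])
  qed
  moreover have "(\<Sum>j=1..l. LBINT t=-\<infinity>..\<infinity>. form_along A \<omega> (\<gamma> j) t) \<le> real k * N"
  proof -
    have "(\<Sum>j=1..l. LBINT t=-\<infinity>..\<infinity>. form_along A \<omega> (\<gamma> j) t) \<le> (\<Sum>j=1..l. N)"
      unfolding \<gamma>_def by (intro sum_mono integral_along_ascending(2)[OF bound])
    also have "\<dots> \<le> real k * N" using \<open>l \<le> k\<close> N by simp
    finally show ?thesis .
  qed
  ultimately show ?thesis using l(1) by (intro exI[of _ l] exI[of _ \<gamma>] exI[of _ "\<lambda>j. J (l + 1 - j)"]) blast
qed

theorem theorem12:
  fixes A :: "('a::{t2_space, second_countable_topology}, 'e::euclidean_space) chart set"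
    and \<omega> :: "'a \<Rightarrow> ('a, 'e) tcovec"
    and k :: nat
    and Y :: "nat \<Rightarrow> 'a set"
  assumes "closed_smooth_manifold A"
    and "smooth_closed_one_form A \<omega>"
    and "\<exists>U f. open U \<and> zeros A \<omega> \<subseteq> U \<and> primitive_on A \<omega> U f"
    and "bij_betw Y {1..k} (components (zeros A \<omega>))"
    and "(\<Sum>i=1..k. rel_cat (Y i)) < cat_class (cohom_class (top_form_of A \<omega>))"
  shows "\<exists>N::int. N > 0 \<and>
    (\<forall>v. gradient_like A \<omega> v \<longrightarrow>
      (\<exists>(l::nat) (\<gamma> :: nat \<Rightarrow> real \<Rightarrow> 'a) (i :: nat \<Rightarrow> nat).
        1 \<le> l \<and> l \<le> k \<and> \<gamma> (l + 1) = \<gamma> 1 \<and>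
        (\<forall>j\<in>{1..l}.
           integral_curve A v (\<gamma> j) \<and> range (\<gamma> j) \<inter> zeros A \<omega> = {} \<and>
           i j \<in> {1..k} \<and>
           (\<Inter>t. closure (\<gamma> j ` {t..})) \<subseteq> Y (i j) \<and>
           (\<Inter>t. closure (\<gamma> (j + 1) ` {..t})) \<subseteq> Y (i j) \<and>
           interval_lebesgue_integrable lborel (-\<infinity>) \<infinity> (form_along A \<omega> (\<gamma> j))) \<and>
        (\<Sum>j=1..l. LBINT t=-\<infinity>..\<infinity>. form_along A \<omega> (\<gamma> j) t) \<le> real_of_int N))"
proof -
  have atlas: "smooth_atlas A" and compact: "compact (UNIV :: 'a set)"
    using assms(1) by (auto simp: closed_smooth_manifold_def)
  interpret closed_form A \<omega> by unfold_locales (use atlas assms(2) in auto)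
  let ?\<xi> = "cohom_class (top_form_of A \<omega>)"
  \<comment> \<open>The sum is strictly below an extended number, so every summand is finite and
    optimal covers exist.\<close>
  have "rel_cat (Y i) \<noteq> \<infinity>" if i: "i \<in> {1..k}" for i
  proof
    assume "rel_cat (Y i) = \<infinity>"
    moreover have "rel_cat (Y i) \<le> (\<Sum>i=1..k. rel_cat (Y i))"
      using i by (intro member_le_sum) auto
    ultimately show False using assms(5) by simp
  qed
  then have "\<exists>\<U>. finite \<U> \<and> (\<forall>U\<in>\<U>. open U \<and> null_homotopic U) \<and> Y i \<subseteq> \<Union>\<U> \<and> rel_cat (Y i) = enat (card \<U>)"
    if "i \<in> {1..k}" for i
    using rel_cat_attained[of "Y i"] that by metis
  then obtain \<U> where \<U>: "\<And>i. i \<in> {1..k} \<Longrightarrow> finite (\<U> i) \<and> (\<forall>U\<in>\<U> i. open U \<and> null_homotopic U) \<and>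
      Y i \<subseteq> \<Union>(\<U> i) \<and> rel_cat (Y i) = enat (card (\<U> i))"
    by metis
  define K where "K = (\<Sum>i=1..k. card (\<U> i))"
  have "(\<Sum>i=1..k. rel_cat (Y i)) = (\<Sum>i=1..k. enat (card (\<U> i)))"
    using \<U> by (intro sum.cong) auto
  also have "\<dots> = enat K" unfolding K_def by (induction k) (auto simp: zero_enat_def)
  finally have K: "enat K < cat_class ?\<xi>" using assms(5) by simp
  \<comment> \<open>The representative picked in \<open>cat_class\<close>; it may differ from the
    form given by \<omega>, hence the comparison constant \<open>C\<close> below.\<close>
  define F where "F = (SOME F. represents F ?\<xi>)"
  have "represents (top_form_of A \<omega>) ?\<xi>" using closed_top_form_of by (simp add: represents_def)
  then have "represents F ?\<xi>" unfolding F_def by (rule someI)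
  then have F: "closed_top_form F" "cohom_class F = ?\<xi>" by (auto simp: represents_def)
  have "\<not> (\<forall>N>0. \<exists>S. closed S \<and> movable F N S \<and> rel_cat (- S) \<le> enat K)"
  proof
    assume "\<forall>N>0. \<exists>S. closed S \<and> movable F N S \<and> rel_cat (- S) \<le> enat K"
    then have "cat_class ?\<xi> \<le> enat K"
      unfolding cat_class_def F_def[symmetric] Let_def by (intro Inf_lower) blast
    then show False using K by simp
  qed
  then obtain N0 where N0: "0 < N0" "\<And>S. closed S \<Longrightarrow> movable F N0 S \<Longrightarrow> \<not> rel_cat (- S) \<le> enat K" by blast
  obtain C where C: "\<And>\<gamma>. path \<gamma> \<Longrightarrow> \<bar>path_integral F \<gamma> - path_integral (top_form_of A \<omega>) \<gamma>\<bar> \<le> C"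
    using cohomologous_path_integrals_bounded[OF F(1) closed_top_form_of F(2) compact locally_path_connected] by blast
  \<comment> \<open>A loss of at least \<open>N\<close> means an integral of \<omega> at most
    \<open>- N\<close>, hence an integral of \<open>F\<close> at most \<open>C - N\<close>, which is
    at most \<open>- N0\<close>. Both \<open>N0\<close> and \<open>C\<close> are obtained before any
    vector field is chosen.\<close>
  define N where "N = real_of_int N0 + \<bar>C\<bar>"
  have N: "0 < N" using N0(1) by (simp add: N_def)
  show ?thesis
  \<comment> \<open>The maximum with 1 keeps the bound positive even for
    \<open>k = 0\<close>.\<close>
  proof (intro exI[of _ "max 1 \<lceil>real k * N\<rceil>"] conjI allI impI)
    fix v assume "gradient_like A \<omega> v"
    then interpret gradient_like_field A \<omega> v by unfold_locales (use compact in auto)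
    have no_cover: "\<not> rel_cat {p. loss T p < N} \<le> enat (\<Sum>i=1..k. card (\<U> i))" if T: "0 < T" for T
    proof -
      have cont: "continuous_on UNIV (loss T)"
        using continuous_on_loss[of UNIV "\<lambda>_. T" "\<lambda>p. p"] by (simp add: continuous_on_id)
      have "closed {p. N \<le> loss T p}" by (intro closed_Collect_le continuous_intros cont)
      \<comment> \<open>The homotopy is the descending flow up to time \<open>T\<close>, rescaled to
        the unit interval.\<close>
      moreover have "movable F N0 {p. N \<le> loss T p}"
        unfolding movable_def
      proof (intro exI[of _ "\<lambda>z. descent (snd z * T) (fst z)"] conjI ballI)
        show "continuous_on ({p. N \<le> loss T p} \<times> {0..1}) (\<lambda>z. descent (snd z * T) (fst z))"
          by (intro continuous_on_flow continuous_intros)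
        fix p assume p: "p \<in> {p. N \<le> loss T p}"
        show "descent (snd (p, 0 :: real) * T) (fst (p, 0 :: real)) = p" by (simp add: flow_zero)
        have "path_integral F (\<lambda>t. descent (t * T) p) \<le> C - loss T p"
          using C[OF path_descent[of T p]] by (simp add: path_integral_descent abs_le_iff)
        then show "path_integral F (\<lambda>t. descent (snd (p, t) * T) (fst (p, t))) \<le> - real_of_int N0"
          using p by (simp add: N_def)
      qed
      moreover have "- {p. N \<le> loss T p} = {p. loss T p < N}" by auto
      ultimately show ?thesis using N0(2)[of "{p. N \<le> loss T p}"] by (simp add: K_def)
    qed
    have le: "real k * N \<le> real_of_int (max 1 \<lceil>real k * N\<rceil>)" by linarith
    show "\<exists>(l::nat) (\<gamma> :: nat \<Rightarrow> real \<Rightarrow> 'a) (i :: nat \<Rightarrow> nat).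
        1 \<le> l \<and> l \<le> k \<and> \<gamma> (l + 1) = \<gamma> 1 \<and>
        (\<forall>j\<in>{1..l}.
           integral_curve A v (\<gamma> j) \<and> range (\<gamma> j) \<inter> zeros A \<omega> = {} \<and>
           i j \<in> {1..k} \<and>
           (\<Inter>t. closure (\<gamma> j ` {t..})) \<subseteq> Y (i j) \<and>
           (\<Inter>t. closure (\<gamma> (j + 1) ` {..t})) \<subseteq> Y (i j) \<and>
           interval_lebesgue_integrable lborel (-\<infinity>) \<infinity> (form_along A \<omega> (\<gamma> j))) \<and>
        (\<Sum>j=1..l. LBINT t=-\<infinity>..\<infinity>. form_along A \<omega> (\<gamma> j) t) \<le> real_of_int (max 1 \<lceil>real k * N\<rceil>)"
      using homoclinic_cycle_exists[OF assms(4) _ _ _ N no_cover] \<U> le order_trans by (smt (verit))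
  qed simp
qed

end
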